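(* Let $K\ge1$ and $\mu\ge0$. Suppose that $f(z)=h(z)+\overline{g(z)}=\sum_{n=0}^\infty a_nz^n+\overline{\sum_{n=1}^\infty b_nz^n}$ is a sense-preserving $K$-quasiconformal harmonic mapping in $\mathbb{D}$ and $h\prec\phi$, where $\phi$ is analytic and univalent in $\mathbb{D}$. Then $$\sum_{n=1}^\infty\left(|a_n|+|b_n|\right)r^n+\mu\left(\frac{S_r(h)}{\pi}\right)^{1/2}\le d(\phi(0),\partial\phi(\mathbb{D}))\quad\text{for } r\le r_0,$$ where $r_0\in(0,1/3)$ is the unique positive root in $(0,1/3)$ of the equation $$(1-r^2)^2-\left(\frac{8K}{K+1}\right)r(1+r)^2-4\mu r\sqrt{r^4+4r^2+1}=0.$$ The number $r_0$ is the best possible: for given $K$ and $\mu$ it cannot be replaced by any larger number for which the inequality holds for all such $f$ and $\phi$.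
   Context: $\mathbb{D}=\{z\in\mathbb{C}:|z|<1\}$, $\mathbb{D}_r=\{z\in\mathbb{C}:|z|<r\}$, and $r=|z|\in[0,1)$. A harmonic mapping in $\mathbb{D}$ is written $f=h+\overline{g}$ with $h,g$ analytic in $\mathbb{D}$. It is locally univalent and sense-preserving if $h'\neq0$ in $\mathbb{D}$ and the dilatation $\omega=g'/h'$ satisfies $|\omega|<1$ in $\mathbb{D}$. Such an $f$ is called $K$-quasiconformal for $K\ge1$ if $|\omega(z)|\le k<1$ for all $z\in\mathbb{D}$, where $K=(1+k)/(1-k)$, i.e. $k=(K-1)/(K+1)$. For analytic $h,\phi$ in $\mathbb{D}$, $h\prec\phi$ (subordination) means $h=\phi\circ w$ for some analytic $w:\mathbb{D}\to\mathbb{D}$ with $w(0)=0$. Univalent means injective. $d(\phi(0),\partial\phi(\mathbb{D}))$ is the Euclidean distance from $\phi(0)$ to the boundary of $\phi(\mathbb{D})$. $S_r(h)=\int_{\mathbb{D}_r}|h'(z)|^2\,dA(z)$ with $dA$ planar Lebesgue measure, so that $S_r(h)/\pi=\sum_{n=1}^\infty n|a_n|^2r^{2n}$. *)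

theory Defs
  imports "HOL-Complex_Analysis.Complex_Analysis"
begin

abbreviation unit_disc :: "complex set" where
  "unit_disc \<equiv> ball 0 1"

text \<open>The normalisation $g(0) = 0$ is not part of this definition; in the theorem it comes from
  the power series of $g$, which starts at $n = 1$.\<close>
definition harmonic_mapping ::
  "(complex \<Rightarrow> complex) \<Rightarrow> (complex \<Rightarrow> complex) \<Rightarrow> (complex \<Rightarrow> complex) \<Rightarrow> bool" where
  "harmonic_mapping f h g \<longleftrightarrow>
     h holomorphic_on unit_disc \<and> g holomorphic_on unit_disc \<and>
     (\<forall>z\<in>unit_disc. f z = h z + cnj (g z))"

definition dilatation ::
  "(complex \<Rightarrow> complex) \<Rightarrow> (complex \<Rightarrow> complex) \<Rightarrow> complex \<Rightarrow> complex" where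
  "dilatation h g z = deriv g z / deriv h z"

definition sense_preserving_locally_univalent ::
  "(complex \<Rightarrow> complex) \<Rightarrow> (complex \<Rightarrow> complex) \<Rightarrow> bool" where
  "sense_preserving_locally_univalent h g \<longleftrightarrow>
     (\<forall>z\<in>unit_disc. deriv h z \<noteq> 0 \<and> norm (dilatation h g z) < 1)"

text \<open>The parameters are the analytic and co-analytic parts of a harmonic mapping.  Injectivity
  of the mapping is not required.\<close>
definition quasiconformal ::
  "real \<Rightarrow> (complex \<Rightarrow> complex) \<Rightarrow> (complex \<Rightarrow> complex) \<Rightarrow> bool" where
  "quasiconformal K h g \<longleftrightarrow>
     sense_preserving_locally_univalent h g \<and>
     (\<forall>z\<in>unit_disc. norm (dilatation h g z) \<le> (K - 1) / (K + 1))"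

definition subordinate :: "(complex \<Rightarrow> complex) \<Rightarrow> (complex \<Rightarrow> complex) \<Rightarrow> bool" where
  "subordinate h \<phi> \<longleftrightarrow>
     (\<exists>w. w holomorphic_on unit_disc \<and> w ` unit_disc \<subseteq> unit_disc \<and> w 0 = 0 \<and>
          (\<forall>z\<in>unit_disc. h z = \<phi> (w z)))"

definition area_functional :: "real \<Rightarrow> (complex \<Rightarrow> complex) \<Rightarrow> real" where
  "area_functional r h = (LINT z:ball 0 r|lborel. (norm (deriv h z))\<^sup>2)"

text \<open>The hypotheses of the theorem on $f = h + \overline{g} = \sum_{n \ge 0} a_n z^n +
  \overline{\sum_{n \ge 1} b_n z^n}$ and $\phi$.  The value of \<open>b 0\<close> is irrelevant.\<close>
definition admissible ::
  "real \<Rightarrow> (complex \<Rightarrow> complex) \<Rightarrow> (complex \<Rightarrow> complex) \<Rightarrow> (complex \<Rightarrow> complex) \<Rightarrow>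
   (nat \<Rightarrow> complex) \<Rightarrow> (nat \<Rightarrow> complex) \<Rightarrow> (complex \<Rightarrow> complex) \<Rightarrow> bool" where
  "admissible K f h g a b \<phi> \<longleftrightarrow>
     harmonic_mapping f h g \<and>
     (\<forall>z\<in>unit_disc. (\<lambda>n. a n * z ^ n) sums h z) \<and>
     (\<forall>z\<in>unit_disc. (\<lambda>n. b (Suc n) * z ^ Suc n) sums g z) \<and>
     quasiconformal K h g \<and>
     \<phi> holomorphic_on unit_disc \<and> inj_on \<phi> unit_disc \<and>
     subordinate h \<phi>"

definition radius_eqn :: "real \<Rightarrow> real \<Rightarrow> real \<Rightarrow> bool" where
  "radius_eqn K \<mu> r \<longleftrightarrow>
     (1 - r\<^sup>2)\<^sup>2 - (8 * K / (K + 1)) * r * (1 + r)\<^sup>2 - 4 * \<mu> * r * sqrt (r ^ 4 + 4 * r\<^sup>2 + 1) = 0"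

text \<open>All power series involved converge absolutely on the unit disc, so for \<open>0 \<le> r < 1\<close> the
  series below is summable and the integral exists; neither takes a default value.\<close>
definition bohr_ineq ::
  "real \<Rightarrow> (complex \<Rightarrow> complex) \<Rightarrow> (nat \<Rightarrow> complex) \<Rightarrow> (nat \<Rightarrow> complex) \<Rightarrow>
   (complex \<Rightarrow> complex) \<Rightarrow> real \<Rightarrow> bool" where
  "bohr_ineq \<mu> h a b \<phi> r \<longleftrightarrow>
     (\<Sum>n. (norm (a (Suc n)) + norm (b (Suc n))) * r ^ Suc n)
       + \<mu> * sqrt (area_functional r h / pi)
     \<le> infdist (\<phi> 0) (frontier (\<phi> ` unit_disc))"

end

theory Submission
  imports Defs
begin

text \<open>
  After subordination (Bohr's majorant for the coefficients, valid for \<open>r \<le> 1/3\<close>, and Rogosinski's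
  inequality for their squares), everything reduces to bounding \<open>\<Sum> |a\<^sub>n| r^n\<close> and \<open>\<Sum> n |a\<^sub>n|^2 r^(2n)\<close>
  for a univalent \<open>\<phi>\<close> by their values for \<open>4 d\<close> times the Koebe function, where \<open>d\<close> is the distance of
  \<open>\<phi> 0\<close> to the boundary. De Branges' theorem would give this at once, but it is not needed since
  \<open>r\<^sub>0 \<le> 3 - 2 \<surd>2 < 0.1716\<close>. Normalise \<open>\<phi>\<close> to a schlicht function \<open>f\<close> omitting \<open>\<omega>\<close> and put
  \<open>\<alpha> = 1 / (4 |\<omega>|) \<le> 1\<close>, so that \<open>|\<phi>'(0)| = 4 \<alpha> d\<close>. Bieberbach's inequality for the omitted-value
  transform forces \<open>|a\<^sub>2| \<ge> 4 \<alpha> - 2\<close>. Writing \<open>f = z / p^2\<close>, the area theorem then makes the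
  deviation \<open>a\<^sub>n - n\<close> small in \<open>l\<^sup>2\<close> when \<open>\<alpha>\<close> is close to \<open>1\<close>. In the expansion of \<open>|a\<^sub>n|^2\<close> around
  \<open>n^2\<close> the linear term has the right sign by the growth and distortion theorems on the real axis, and
  the quadratic term is paid for by the factor \<open>\<alpha>^2\<close>. For smaller \<open>\<alpha>\<close> a crude majorant suffices.
  The Koebe function with \<open>g = k h\<close> gives sharpness.
\<close>

section \<open>Change of variables in the plane\<close>

text \<open>The inequality is an equality at \<open>r0\<close> for a Koebe mapping, so no estimate
  may lose anything at \<alpha> = 1, and the area theorem alone does not give |a_n| \<le> n. The
  argument rests on a matching of orders: with 2 b = |a_2| the omitted value gives 1 - b \<le> 2 (1
  - \<alpha>), the squared l2 deviation from the Koebe coefficients is at most a multiple of 1 - b,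
  and the factor \<alpha>^2 frees (1 - \<alpha>^2) times the Koebe value, also of first order in 1 -
  \<alpha>. What remains is a comparison of numerical constants, small enough because of the bound
  0.1716. The equation for \<open>r0\<close> comes from the Koebe sums: n r^n adds up to r / (1 -
  r)^2 and n^3 r^(2n) to r^2 (1 + 4 r^2 + r^4) / (1 - r^2)^4; at a root the Bohr sum of h = Koebe, g
  = k h is 1/4. Areas are not computed from boundary curves. The area theorem and the area
  functional are both integrals of a Jacobian in the coordinate u = log z, where annulus and disc
  become a rectangle and a half-strip and Parseval's identity evaluates the inner integral; hence
  the transformation formula at the start.\<close>

definition complex_of_R2 :: "real ^ 2 \<Rightarrow> complex" where
  "complex_of_R2 v = Complex (v $ 1) (v $ 2)"

definition R2_of_complex :: "complex \<Rightarrow> real ^ 2" where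
  "R2_of_complex z = vector [Re z, Im z]"

lemma complex_of_R2_inverse [simp]: "R2_of_complex (complex_of_R2 v) = v"
  by (simp add: R2_of_complex_def complex_of_R2_def vec_eq_iff forall_2)

lemma R2_of_complex_inverse [simp]: "complex_of_R2 (R2_of_complex z) = z"
  by (simp add: R2_of_complex_def complex_of_R2_def)

lemma R2_of_complex_nth [simp]: "R2_of_complex z $ 1 = Re z" "R2_of_complex z $ 2 = Im z"
  by (simp_all add: R2_of_complex_def)

lemma bounded_linear_R2: "bounded_linear R2_of_complex" "bounded_linear complex_of_R2"
proof -
  show "bounded_linear R2_of_complex"
    by (rule linear_conv_bounded_linear[THEN iffD1], rule linearI)
       (auto simp: vec_eq_iff forall_2)
  show "bounded_linear complex_of_R2"
    by (rule linear_conv_bounded_linear[THEN iffD1], rule linearI)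
       (auto simp: complex_of_R2_def complex_eq_iff)
qed

lemma measurable_R2 [measurable]:
  "R2_of_complex \<in> borel_measurable borel" "complex_of_R2 \<in> borel_measurable borel"
  by (intro borel_measurable_continuous_onI linear_continuous_on bounded_linear_R2)+

text \<open>Lebesgue measure is determined by its values on boxes, and boxes correspond to
  boxes.\<close>

lemma distr_lborel_R2: "distr lborel borel complex_of_R2 = (lborel :: complex measure)"
proof (rule lborel_eqI[symmetric])
  fix l u :: complex
  assume lu: "\<And>b. b \<in> Basis \<Longrightarrow> l \<bullet> b \<le> u \<bullet> b"
  have "complex_of_R2 -` box l u = box (R2_of_complex l) (R2_of_complex u)"
    by (auto simp: box_def complex_of_R2_def Basis_complex_def Basis_vec_def inner_axis forall_2 exhaust_2)
  moreover have *: "Basis = {axis 1 1, axis 2 1 :: real^2}"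
    by (auto simp: Basis_vec_def UNIV_2)
  have **: "axis 1 1 \<noteq> (axis 2 1 :: real^2)" by (simp add: axis_eq_axis)
  have le: "Re l \<le> Re u" "Im l \<le> Im u" using lu[of 1] lu[of \<i>] by (auto simp: Basis_complex_def)
  have "emeasure lborel (box (R2_of_complex l) (R2_of_complex u)) =
    ennreal ((Re u - Re l) * (Im u - Im l))"
    unfolding emeasure_lborel_box_eq * using ** le by (simp add: inner_axis inner_diff_left)
  ultimately show "emeasure (distr lborel borel complex_of_R2) (box l u) = ennreal (prod ((\<bullet>) (u - l)) Basis)"
    by (simp add: emeasure_distr Basis_complex_def inner_diff_left)
qed simp

lemma integrable_lborel_R2:
  fixes f :: "complex \<Rightarrow> real"
  assumes [measurable]: "f \<in> borel_measurable borel"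
  shows "integrable lborel (\<lambda>v. f (complex_of_R2 v)) \<longleftrightarrow> integrable lborel f"
    and "(LINT v|lborel. f (complex_of_R2 v)) = (LINT z|lborel. f z)"
proof -
  show "integrable lborel (\<lambda>v. f (complex_of_R2 v)) \<longleftrightarrow> integrable lborel f"
    using integrable_distr_eq[of complex_of_R2 lborel borel f] by (simp add: distr_lborel_R2)
  show "(LINT v|lborel. f (complex_of_R2 v)) = (LINT z|lborel. f z)"
    using integral_distr[of complex_of_R2 lborel borel f] by (simp add: distr_lborel_R2)
qed

lemma set_integrable_lborel_R2:
  fixes f :: "complex \<Rightarrow> real"
  assumes f: "(\<lambda>z. indicator S z * f z) \<in> borel_measurable borel"
  shows "(f \<circ> complex_of_R2) absolutely_integrable_on (complex_of_R2 -` S) \<longleftrightarrow> set_integrable lborel S f"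
    and "set_integrable lborel S f \<Longrightarrow> integral (complex_of_R2 -` S) (f \<circ> complex_of_R2) = (LINT z:S|lborel. f z)"
proof -
  have m: "(\<lambda>x. indicator (complex_of_R2 -` S) x *\<^sub>R f (complex_of_R2 x)) \<in> borel_measurable borel"
    using measurable_compose[OF measurable_R2(2) f] by (simp add: indicator_def vimage_def of_bool_def)
  have eq: "(indicator (complex_of_R2 -` S) x :: real) = indicator S (complex_of_R2 x)" for x
    by (simp add: indicator_def)
  show *: "(f \<circ> complex_of_R2) absolutely_integrable_on (complex_of_R2 -` S) \<longleftrightarrow> set_integrable lborel S f"
    unfolding set_integrable_def o_def using m integrable_lborel_R2(1)[OF f]
    by (subst integrable_completion) (simp_all add: eq)
  assume S: "set_integrable lborel S f"
  have "integral (complex_of_R2 -` S) (f \<circ> complex_of_R2) = (LINT x:(complex_of_R2 -` S)|lebesgue. (f \<circ> complex_of_R2) x)"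
    by (rule set_lebesgue_integral_eq_integral(2)[symmetric]) (use S * in simp)
  also have "\<dots> = (LINT z:S|lborel. f z)"
    unfolding set_lebesgue_integral_def o_def using m integrable_lborel_R2(2)[OF f]
    by (subst integral_completion) (simp_all add: eq)
  finally show "integral (complex_of_R2 -` S) (f \<circ> complex_of_R2) = (LINT z:S|lborel. f z)" .
qed

lemma det_matrix_R2:
  assumes "linear h"
  shows "det (matrix (\<lambda>v. R2_of_complex (h (complex_of_R2 v)))) = Re (h 1) * Im (h \<i>) - Im (h 1) * Re (h \<i>)"
proof -
  have "complex_of_R2 (axis 1 1) = 1" "complex_of_R2 (axis 2 1) = \<i>"
    by (simp_all add: complex_of_R2_def axis_def complex_eq_iff)
  then show ?thesis by (simp add: det_2 matrix_def)
qed

text \<open>The transformation formula is transported from \<open>real ^ 2\<close> to the complex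
  plane. \<open>J\<close> is prescribed only on \<open>S\<close>, so that a closed form of the
  Jacobian can be supplied, and measurability is asked only after restriction to \<open>S\<close>
  and its image, because derivatives are controlled only inside the disc.\<close>

lemma change_of_variables_complex:
  fixes g :: "complex \<Rightarrow> complex" and f :: "complex \<Rightarrow> real"
  assumes S: "S \<in> sets borel" and T: "g ` S \<in> sets borel"
    and der: "\<And>z. z \<in> S \<Longrightarrow> (g has_derivative g' z) (at z within S)"
    and inj: "inj_on g S"
    and J: "\<And>z. z \<in> S \<Longrightarrow> J z = \<bar>Re (g' z 1) * Im (g' z \<i>) - Im (g' z 1) * Re (g' z \<i>)\<bar>"
    and f: "(\<lambda>w. indicator (g ` S) w * f w) \<in> borel_measurable borel"
    and Jm: "(\<lambda>z. indicator S z * (J z * f (g z))) \<in> borel_measurable borel"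
    and int: "set_integrable lborel (g ` S) f"
  shows "set_integrable lborel S (\<lambda>z. J z * f (g z))"
    and "(LINT z:S|lborel. J z * f (g z)) = (LINT w:g ` S|lborel. f w)"
proof -
  let ?P = R2_of_complex and ?Q = complex_of_R2
  define g2 where "g2 = (\<lambda>v. ?P (g (?Q v)))"
  define g2' where "g2' = (\<lambda>v x. ?P (g' (?Q v) (?Q x)))"
  \<comment> \<open>The underlying formula is for vector-valued integrands, so \<open>f\<close> is
    read as a function into \<open>real ^ 1\<close>.\<close>
  define f2 where "f2 = (\<lambda>v. vec (f (?Q v)) :: real^1)"
  have Qim: "?Q ` (?Q -` A) = A" for A by (force intro: image_eqI[of _ _ "?P _"])
  have QP: "?Q -` A = ?P ` A" for A by (auto intro: image_eqI[of _ _ "?Q _"])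
  have im: "g2 ` (?Q -` S) = ?Q -` (g ` S)"
    unfolding g2_def QP by (simp add: image_image)
  have S2: "?Q -` S \<in> sets lebesgue"
    using measurable_sets[OF measurable_R2(2), of S] S by simp
  have der2: "(g2 has_derivative g2' v) (at v within ?Q -` S)" if "v \<in> ?Q -` S" for v
  proof -
    have "(g has_derivative g' (?Q v)) (at (?Q v) within ?Q ` (?Q -` S))"
      using der that by (simp only: Qim vimage_eq)
    from diff_chain_within[OF bounded_linear_imp_has_derivative[OF bounded_linear_R2(2)] this]
    have "((g \<circ> ?Q) has_derivative (g' (?Q v) \<circ> ?Q)) (at v within ?Q -` S)" by simp
    from diff_chain_within[OF this bounded_linear_imp_has_derivative[OF bounded_linear_R2(1)]]
    show ?thesis by (simp add: g2_def g2'_def o_def)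
  qed
  have inj2: "inj_on g2 (?Q -` S)"
  proof (rule inj_onI)
    fix x y assume *: "x \<in> ?Q -` S" "y \<in> ?Q -` S" "g2 x = g2 y"
    then have "g (?Q x) = g (?Q y)" unfolding g2_def by (metis R2_of_complex_inverse)
    then have "?Q x = ?Q y" using inj * by (auto dest: inj_onD)
    then show "x = y" by (metis complex_of_R2_inverse)
  qed
  have det: "\<bar>det (matrix (g2' v))\<bar> = J (?Q v)" if "v \<in> ?Q -` S" for v
    unfolding g2'_def using that
    by (subst det_matrix_R2) (auto simp: J intro!: has_derivative_linear[OF der])
  have f2: "f2 absolutely_integrable_on g2 ` (?Q -` S)"
    using set_integrable_lborel_R2(1)[OF f] int
    by (simp add: im f2_def absolutely_integrable_on_1_iff o_def)
  have f2i: "integral (g2 ` (?Q -` S)) f2 = vec (LINT w:g ` S|lborel. f w)"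
    using set_integrable_lborel_R2(2)[OF f int]
    by (simp add: im f2_def integral_on_1_eq o_def)
  have *: "(\<lambda>v. \<bar>det (matrix (g2' v))\<bar> *\<^sub>R f2 (g2 v)) absolutely_integrable_on (?Q -` S) \<and>
    integral (?Q -` S) (\<lambda>v. \<bar>det (matrix (g2' v))\<bar> *\<^sub>R f2 (g2 v)) = vec (LINT w:g ` S|lborel. f w)"
    using has_absolute_integral_change_of_variables[OF S2 der2 inj2, of f2] f2 f2i by blast
  have cong: "(\<bar>det (matrix (g2' v))\<bar> *\<^sub>R f2 (g2 v)) $ 1 = ((\<lambda>z. J z * f (g z)) \<circ> ?Q) v" if "v \<in> ?Q -` S" for v
    using det[OF that] by (simp add: f2_def g2_def)
  have "((\<lambda>z. J z * f (g z)) \<circ> ?Q) absolutely_integrable_on (?Q -` S)"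
  proof -
    have "(\<lambda>v. (\<bar>det (matrix (g2' v))\<bar> *\<^sub>R f2 (g2 v)) $ 1) absolutely_integrable_on (?Q -` S)"
      using * unfolding absolutely_integrable_on_1_iff by blast
    then have "integrable lebesgue (\<lambda>v. indicat_real (?Q -` S) v *\<^sub>R (\<bar>det (matrix (g2' v))\<bar> *\<^sub>R f2 (g2 v)) $ 1)"
      unfolding set_integrable_def .
    also have "(\<lambda>v. indicat_real (?Q -` S) v *\<^sub>R (\<bar>det (matrix (g2' v))\<bar> *\<^sub>R f2 (g2 v)) $ 1) =
      (\<lambda>v. indicat_real (?Q -` S) v *\<^sub>R ((\<lambda>z. J z * f (g z)) \<circ> ?Q) v)"
    proof
      fix v show "indicat_real (?Q -` S) v *\<^sub>R (\<bar>det (matrix (g2' v))\<bar> *\<^sub>R f2 (g2 v)) $ 1 =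
        indicat_real (?Q -` S) v *\<^sub>R ((\<lambda>z. J z * f (g z)) \<circ> ?Q) v"
        using cong[of v] by (cases "v \<in> ?Q -` S") auto
    qed
    finally show ?thesis unfolding set_integrable_def .
  qed
  moreover have "integral (?Q -` S) ((\<lambda>z. J z * f (g z)) \<circ> ?Q) = (LINT w:g ` S|lborel. f w)"
  proof -
    have "integral (?Q -` S) (\<lambda>v. (\<bar>det (matrix (g2' v))\<bar> *\<^sub>R f2 (g2 v)) $ 1) = (LINT w:g ` S|lborel. f w)"
      using * unfolding integral_on_1_eq vec_eq_iff by simp
    then show ?thesis using integral_cong[OF cong, of "?Q -` S" "\<lambda>v. v"] by (simp add: o_def)
  qed
  ultimately show "set_integrable lborel S (\<lambda>z. J z * f (g z))"
    and "(LINT z:S|lborel. J z * f (g z)) = (LINT w:g ` S|lborel. f w)"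
    using set_integrable_lborel_R2[OF Jm] by auto
qed

section \<open>Power series on the unit disc\<close>

text \<open>Holomorphy on the whole disc makes the germ at 0 determine all values, so a function and
  its formal series can be used interchangeably. Coefficient identities are obtained by expanding
  one function in two ways and applying \<open>disc_expansion_unique\<close>.\<close>

definition disc_expansion :: "(complex \<Rightarrow> complex) \<Rightarrow> complex fps \<Rightarrow> bool" where
  "disc_expansion f A \<longleftrightarrow> f holomorphic_on unit_disc \<and> f has_fps_expansion A"

lemma disc_expansion_sums:
  assumes "disc_expansion f A" "norm z < 1"
  shows "(\<lambda>n. fps_nth A n * z ^ n) sums f z"
proof (rule has_fps_expansion_imp_sums_complex)
  show "f holomorphic_on eball 0 1"
    using assms(1) unfolding disc_expansion_def
    by (rule_tac holomorphic_on_subset[of _ unit_disc]) (auto simp: eball_def)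
qed (use assms in \<open>auto simp: disc_expansion_def\<close>)

lemma disc_expansion_abs_summable:
  assumes "disc_expansion f A" "0 \<le> r" "r < 1"
  shows "summable (\<lambda>n. norm (fps_nth A n) * r ^ n)"
proof -
  have "summable (\<lambda>n. fps_nth A n * of_real ((1 + r) / 2) ^ n)"
    using disc_expansion_sums[OF assms(1), of "of_real ((1 + r) / 2)"] assms
    by (intro sums_summable) (auto simp: norm_of_real simp del: of_real_divide of_real_add)
  from powser_insidea[OF this, of "of_real r"] show ?thesis
    using assms by (simp add: norm_mult norm_power del: of_real_divide of_real_add)
qed

lemma disc_expansion_fps_expansion:
  "f holomorphic_on unit_disc \<Longrightarrow> disc_expansion f (fps_expansion f 0)"
  unfolding disc_expansion_def by (auto intro: has_fps_expansion_fps_expansion[of unit_disc])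

lemma disc_expansion_unique: "disc_expansion f A \<Longrightarrow> disc_expansion f B \<Longrightarrow> A = B"
  unfolding disc_expansion_def using fps_expansion_unique_complex by blast

lemma disc_expansion_cong:
  assumes "disc_expansion f A" "\<And>z. z \<in> unit_disc \<Longrightarrow> g z = f z"
  shows "disc_expansion g A"
proof -
  have "eventually (\<lambda>z. g z = f z) (nhds 0)"
    using assms(2) by (intro eventually_nhds_in_open[of unit_disc, THEN eventually_mono]) auto
  then show ?thesis
    using assms unfolding disc_expansion_def
    using has_fps_expansion_cong[of g f A A] holomorphic_transform[of f unit_disc g] by auto
qed

lemma disc_expansionI:
  assumes "\<And>z. norm z < 1 \<Longrightarrow> (\<lambda>n. c n * z ^ n) sums f z"
  shows "disc_expansion f (Abs_fps c)"
proof -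
  have hol: "f holomorphic_on unit_disc"
    using power_series_holomorphic[of 0 1 c f] assms by simp
  \<comment> \<open>\<open>has_fps_expansion\<close> concerns the germ at 0, so any positive bound
    on the radius suffices; convergence at 1/2 provides one.\<close>
  have "fps_conv_radius (Abs_fps c) \<ge> ereal (1/2)"
    using conv_radius_geI[OF sums_summable[OF assms[of "1/2"]]] by (simp add: fps_conv_radius_def)
  moreover have "eventually (\<lambda>z. eval_fps (Abs_fps c) z = f z) (nhds 0)"
  proof (rule eventually_nhds_in_open[of unit_disc, THEN eventually_mono])
    fix z :: complex assume "z \<in> unit_disc"
    then show "eval_fps (Abs_fps c) z = f z"
      using assms[of z] by (simp add: eval_fps_def sums_iff)
  qed auto
  ultimately have "f has_fps_expansion Abs_fps c"
    unfolding has_fps_expansion_def by (auto intro: less_le_trans[of 0 "ereal (1/2)"])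
  with hol show ?thesis by (simp add: disc_expansion_def)
qed

lemma disc_expansion_mult:
  "disc_expansion f A \<Longrightarrow> disc_expansion g B \<Longrightarrow> disc_expansion (\<lambda>z. f z * g z) (A * B)"
  unfolding disc_expansion_def by (auto intro!: holomorphic_intros fps_expansion_intros)

lemma disc_expansion_add:
  "disc_expansion f A \<Longrightarrow> disc_expansion g B \<Longrightarrow> disc_expansion (\<lambda>z. f z + g z) (A + B)"
  unfolding disc_expansion_def by (auto intro!: holomorphic_intros fps_expansion_intros)

lemma disc_expansion_diff:
  "disc_expansion f A \<Longrightarrow> disc_expansion g B \<Longrightarrow> disc_expansion (\<lambda>z. f z - g z) (A - B)"
  unfolding disc_expansion_def by (auto intro!: holomorphic_intros fps_expansion_intros)

lemma disc_expansion_const: "disc_expansion (\<lambda>_. c) (fps_const c)"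
  unfolding disc_expansion_def by (auto intro!: holomorphic_intros fps_expansion_intros)

lemma disc_expansion_X: "disc_expansion (\<lambda>z. z) fps_X"
  unfolding disc_expansion_def by (auto intro!: holomorphic_intros fps_expansion_intros)

lemma disc_expansion_deriv:
  "disc_expansion f A \<Longrightarrow> disc_expansion (deriv f) (fps_deriv A)"
  unfolding disc_expansion_def by (auto intro!: holomorphic_deriv fps_expansion_intros)

lemma disc_expansion_compose:
  assumes "disc_expansion f A" "disc_expansion g B" "fps_nth B 0 = 0" "g ` unit_disc \<subseteq> unit_disc"
  shows "disc_expansion (\<lambda>z. f (g z)) (fps_compose A B)"
proof -
  have "(f \<circ> g) holomorphic_on unit_disc"
    using assms by (intro holomorphic_on_compose_gen[of g unit_disc f unit_disc]) (auto simp: disc_expansion_def)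
  moreover have "(f \<circ> g) has_fps_expansion fps_compose A B"
    using assms by (intro has_fps_expansion_compose) (auto simp: disc_expansion_def)
  ultimately show ?thesis by (simp add: disc_expansion_def o_def)
qed

lemma disc_expansion_at_0: "disc_expansion f A \<Longrightarrow> f 0 = fps_nth A 0"
  using sums_unique2[OF disc_expansion_sums[of f A 0] powser_sums_zero] by simp

text \<open>The quotient (f - f 0) / z with its singularity at 0 removed; defining it by the shifted
  series gives holomorphy at 0 directly.\<close>

lemma disc_expansion_shift:
  assumes "disc_expansion f A"
  obtains u where "disc_expansion u (fps_shift 1 A)" "\<And>z. norm z < 1 \<Longrightarrow> f z = fps_nth A 0 + z * u z"
proof -
  define u where "u z = (\<Sum>n. fps_nth A (Suc n) * z ^ n)" for z
  have *: "(\<lambda>n. fps_nth A (Suc n) * z ^ n) sums u z \<and> f z = fps_nth A 0 + z * u z" if z: "norm z < 1" for z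
  proof -
    have s: "(\<lambda>n. fps_nth A (Suc n) * z ^ Suc n) sums (f z - fps_nth A 0)"
      using disc_expansion_sums[OF assms z] sums_Suc_iff[of "\<lambda>n. fps_nth A n * z ^ n" "f z - fps_nth A 0"]
      by simp
    have "summable (\<lambda>n. norm (fps_nth A (Suc n)) * norm z ^ n)"
    proof -
      \<comment> \<open>A positive radius is needed because the shift divides by it, and z may be
        0.\<close>
      define r where "r = (1 + norm z) / 2"
      have r: "norm z \<le> r" "r < 1" "0 < r" using z by (auto simp: r_def add_pos_nonneg)
      have "summable (\<lambda>n. norm (fps_nth A (Suc n)) * r ^ Suc n)"
        using disc_expansion_abs_summable[OF assms, of r] r
          summable_Suc_iff[of "\<lambda>n. norm (fps_nth A n) * r ^ n"] by simp
      then have "summable (\<lambda>n. norm (fps_nth A (Suc n)) * r ^ Suc n / r)"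
        by (rule summable_divide)
      moreover have "norm (fps_nth A (Suc n)) * r ^ Suc n / r = norm (fps_nth A (Suc n)) * r ^ n" for n
        using r by simp
      ultimately have "summable (\<lambda>n. norm (fps_nth A (Suc n)) * r ^ n)" by (simp only:)
      then show ?thesis
      proof (rule summable_comparison_test'[where N = 0])
        fix n :: nat
        have "norm z ^ n \<le> r ^ n" using r by (intro power_mono) auto
        then show "norm (norm (fps_nth A (Suc n)) * norm z ^ n) \<le> norm (fps_nth A (Suc n)) * r ^ n"
          by (simp add: mult_left_mono)
      qed
    qed
    then have "summable (\<lambda>n. norm (fps_nth A (Suc n) * z ^ n))"
      by (simp add: norm_mult norm_power)
    then have "summable (\<lambda>n. fps_nth A (Suc n) * z ^ n)"
      by (rule summable_norm_cancel)
    then have u: "(\<lambda>n. fps_nth A (Suc n) * z ^ n) sums u z" unfolding u_def by (rule summable_sums)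
    from sums_mult[OF this, of z] have "(\<lambda>n. fps_nth A (Suc n) * z ^ Suc n) sums (z * u z)"
      by (simp add: mult_ac)
    with s have "f z - fps_nth A 0 = z * u z" by (rule sums_unique2)
    then have "f z = fps_nth A 0 + z * u z" by (simp add: diff_eq_eq add.commute)
    with u show ?thesis by blast
  qed
  have "Abs_fps (\<lambda>n. fps_nth A (Suc n)) = fps_shift 1 A" by (simp add: fps_eq_iff)
  moreover have "disc_expansion u (Abs_fps (\<lambda>n. fps_nth A (Suc n)))"
    by (rule disc_expansionI) (use * in blast)
  ultimately have "disc_expansion u (fps_shift 1 A)" by simp
  then show ?thesis by (rule that) (use * in blast)
qed

section \<open>Parseval's identity\<close>

lemma cis_integral_zero:
  assumes "k \<noteq> (0::int)"
  shows "((\<lambda>t. cis (of_int k * t)) has_integral 0) {0..2*pi}"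
proof -
  define a where "a = \<i> * of_int k"
  have a: "a \<noteq> 0" using assms by (simp add: a_def)
  have cis: "cis (of_int k * t) = exp (t *\<^sub>R a)" for t
    by (simp add: a_def cis_conv_exp scaleR_conv_of_real mult_ac)
  have "((\<lambda>t. exp (t *\<^sub>R a)) has_integral (exp ((2*pi) *\<^sub>R a) * inverse a - exp (0 *\<^sub>R a) * inverse a)) {0..2*pi}"
  proof (rule fundamental_theorem_of_calculus)
    fix t
    have "((\<lambda>t. exp (t *\<^sub>R a) * inverse a) has_vector_derivative (exp (t *\<^sub>R a) * a) * inverse a) (at t within {0..2*pi})"
      by (rule has_vector_derivative_mult_left exp_scaleR_has_vector_derivative_right)+
    then show "((\<lambda>t. exp (t *\<^sub>R a) * inverse a) has_vector_derivative exp (t *\<^sub>R a)) (at t within {0..2*pi})"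
      using a by (simp add: mult.assoc)
  qed simp
  moreover have "cis (of_int k * (2*pi)) = 1"
    using cis_multiple_2pi[of k] by (simp add: mult_ac)
  ultimately show ?thesis by (simp add: cis)
qed

lemma parseval_polynomial:
  fixes c :: "nat \<Rightarrow> complex"
  shows "((\<lambda>t. (norm (\<Sum>n<N. c n * cis (of_nat n * t)))\<^sup>2) has_integral (2 * pi * (\<Sum>n<N. (norm (c n))\<^sup>2))) {0..2*pi}"
proof -
  have *: "complex_of_real ((norm (\<Sum>n<N. c n * cis (of_nat n * t)))\<^sup>2) =
     (\<Sum>m<N. \<Sum>n<N. (c m * cnj (c n)) * cis (of_int (int m - int n) * t))" for t
  proof -
    have "complex_of_real ((norm (\<Sum>n<N. c n * cis (of_nat n * t)))\<^sup>2) =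
      (\<Sum>m<N. c m * cis (of_nat m * t)) * (\<Sum>n<N. cnj (c n) * cis (- (of_nat n * t)))"
      by (simp only: complex_norm_square cnj_sum complex_cnj_mult cis_cnj)
    also have "\<dots> = (\<Sum>m<N. \<Sum>n<N. (c m * cis (of_nat m * t)) * (cnj (c n) * cis (- (of_nat n * t))))"
      by (simp add: sum_product)
    also have "\<dots> = (\<Sum>m<N. \<Sum>n<N. (c m * cnj (c n)) * cis (of_int (int m - int n) * t))"
    proof (intro sum.cong refl)
      fix m n
      have "cis (of_int (int m - int n) * t) = cis (of_nat m * t) * cis (- (of_nat n * t))"
        by (simp add: cis_mult left_diff_distrib)
      then show "(c m * cis (of_nat m * t)) * (cnj (c n) * cis (- (of_nat n * t))) =
        (c m * cnj (c n)) * cis (of_int (int m - int n) * t)" by simp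
    qed
    finally show ?thesis .
  qed
  have "((\<lambda>t. \<Sum>m<N. \<Sum>n<N. (c m * cnj (c n)) * cis (of_int (int m - int n) * t)) has_integral
     (\<Sum>m<N. \<Sum>n<N. (c m * cnj (c n)) * (if m = n then 2 * pi else 0))) {0..2*pi}"
  proof (intro has_integral_sum finite_lessThan has_integral_mult_right)
    fix m n
    show "((\<lambda>t. cis (of_int (int m - int n) * t)) has_integral complex_of_real (if m = n then 2 * pi else 0)) {0..2*pi}"
      using cis_integral_zero[of "int m - int n"] has_integral_const_real[of "1::complex" 0 "2*pi"]
      by (auto simp: scaleR_conv_of_real)
  qed
  also have "(\<Sum>m<N. \<Sum>n<N. (c m * cnj (c n)) * complex_of_real (if m = n then 2 * pi else 0)) =
     (\<Sum>m<N. of_real (2 * pi) * (c m * cnj (c m)))"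
    by (simp add: if_distrib sum.delta mult_ac cong: if_cong)
  also have "\<dots> =
     complex_of_real (2 * pi * (\<Sum>n<N. (norm (c n))\<^sup>2))"
    by (simp only: complex_norm_square of_real_mult[of "2*pi"] of_real_sum sum_distrib_left)
  finally have "((\<lambda>t. complex_of_real ((norm (\<Sum>n<N. c n * cis (of_nat n * t)))\<^sup>2)) has_integral
      complex_of_real (2 * pi * (\<Sum>n<N. (norm (c n))\<^sup>2))) {0..2*pi}"
    by (simp only: *)
  from has_integral_linear[OF this bounded_linear_Re] show ?thesis by (simp add: o_def)
qed

text \<open>The partial sums converge uniformly on the circle, by the M-test with the absolutely
  summable coefficients \<open>c\<close>, so the identity for polynomials passes to the limit. The
  limit of the integrals also delivers summability.\<close>

lemma parseval:
  assumes A: "disc_expansion f A" and \<rho>: "0 \<le> \<rho>" "\<rho> < 1"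
  shows "((\<lambda>t. (norm (f (\<rho> * cis t)))\<^sup>2) has_integral (2 * pi * (\<Sum>n. (norm (fps_nth A n))\<^sup>2 * \<rho> ^ (2 * n)))) {0..2*pi}"
    and "summable (\<lambda>n. (norm (fps_nth A n))\<^sup>2 * \<rho> ^ (2 * n))"
proof -
  define c where "c n = fps_nth A n * of_real (\<rho> ^ n)" for n
  define P where "P N t = (\<Sum>n<N. c n * cis (of_nat n * t))" for N :: nat and t
  have cn: "(norm (c n))\<^sup>2 = (norm (fps_nth A n))\<^sup>2 * \<rho> ^ (2 * n)" for n
    using \<rho> by (simp add: c_def norm_mult norm_power power_mult_distrib power_even_eq)
  have sumc: "summable (\<lambda>n. norm (c n))"
    using disc_expansion_abs_summable[OF A \<rho>] \<rho> by (simp add: c_def norm_mult norm_power)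
  have fP: "f (\<rho> * cis t) = (\<Sum>n. c n * cis (of_nat n * t))" for t
    using disc_expansion_sums[OF A, of "\<rho> * cis t"] \<rho>
    by (simp add: norm_mult sums_iff c_def power_mult_distrib DeMoivre mult.assoc Complex.DeMoivre)
  have u: "uniform_limit {0..2*pi} P (\<lambda>t. f (\<rho> * cis t)) sequentially"
    unfolding P_def fP by (rule Weierstrass_m_test[OF _ sumc]) (simp add: norm_mult)
  have bdd: "bounded ((\<lambda>t. f (\<rho> * cis t)) ` {0..2*pi})"
  proof (rule boundedI)
    fix y assume "y \<in> (\<lambda>t. f (\<rho> * cis t)) ` {0..2*pi}"
    then show "norm y \<le> (\<Sum>n. norm (c n))"
      unfolding fP using sumc by (auto intro!: order_trans[OF summable_norm] simp: norm_mult)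
  qed
  have u2: "uniform_limit {0..2*pi} (\<lambda>N t. (norm (P N t))\<^sup>2) (\<lambda>t. (norm (f (\<rho> * cis t)))\<^sup>2) sequentially"
    unfolding power2_eq_square
    by (intro uniform_lim_mult uniform_limit_intros u) (simp_all add: bounded_norm_comp bdd)
  obtain I J where I: "\<And>N. ((\<lambda>t. (norm (P N t))\<^sup>2) has_integral I N) {0..2*pi}"
    and J: "((\<lambda>t. (norm (f (\<rho> * cis t)))\<^sup>2) has_integral J) {0..2*pi}" and IJ: "I \<longlonglongrightarrow> J"
    by (rule uniform_limit_integral[OF u2]) (auto intro!: continuous_intros simp: P_def)
  have "I N = 2 * pi * (\<Sum>n<N. (norm (c n))\<^sup>2)" for N
    using I[of N] parseval_polynomial[of c N] unfolding P_def by (rule has_integral_unique)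
  then have "(\<lambda>N. 2 * pi * (\<Sum>n<N. (norm (c n))\<^sup>2) / (2 * pi)) \<longlonglongrightarrow> J / (2 * pi)"
    using tendsto_divide[OF IJ tendsto_const, of "2 * pi"] by simp
  then have "(\<lambda>n. (norm (c n))\<^sup>2) sums (J / (2 * pi))"
    by (simp add: sums_def)
  then show "((\<lambda>t. (norm (f (\<rho> * cis t)))\<^sup>2) has_integral (2 * pi * (\<Sum>n. (norm (fps_nth A n))\<^sup>2 * \<rho> ^ (2 * n)))) {0..2*pi}"
    and "summable (\<lambda>n. (norm (fps_nth A n))\<^sup>2 * \<rho> ^ (2 * n))"
    using J by (simp_all add: cn sums_iff)
qed

lemma parseval_mono:
  assumes A: "disc_expansion f A" and B: "disc_expansion g B" and \<rho>: "0 \<le> \<rho>" "\<rho> < 1"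
    and le: "\<And>z. norm z = \<rho> \<Longrightarrow> norm (f z) \<le> C * norm (g z)"
  shows "(\<Sum>n. (norm (fps_nth A n))\<^sup>2 * \<rho> ^ (2 * n)) \<le> C\<^sup>2 * (\<Sum>n. (norm (fps_nth B n))\<^sup>2 * \<rho> ^ (2 * n))"
proof -
  have "2 * pi * (\<Sum>n. (norm (fps_nth A n))\<^sup>2 * \<rho> ^ (2 * n)) \<le>
    C\<^sup>2 * (2 * pi * (\<Sum>n. (norm (fps_nth B n))\<^sup>2 * \<rho> ^ (2 * n)))"
  proof (rule has_integral_le[OF parseval(1)[OF A \<rho>] has_integral_mult_right[OF parseval(1)[OF B \<rho>]]])
    fix t
    have "norm (f (\<rho> * cis t)) \<le> C * norm (g (\<rho> * cis t))"
      using \<rho> by (intro le) (simp add: norm_mult)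
    then have "(norm (f (\<rho> * cis t)))\<^sup>2 \<le> (C * norm (g (\<rho> * cis t)))\<^sup>2"
      by (intro power_mono) auto
    then show "(norm (f (\<rho> * cis t)))\<^sup>2 \<le> C\<^sup>2 * (norm (g (\<rho> * cis t)))\<^sup>2"
      by (simp add: power_mult_distrib)
  qed
  then have "2 * pi * (\<Sum>n. (norm (fps_nth A n))\<^sup>2 * \<rho> ^ (2 * n)) \<le>
    2 * pi * (C\<^sup>2 * (\<Sum>n. (norm (fps_nth B n))\<^sup>2 * \<rho> ^ (2 * n)))" by (simp only: mult_ac)
  then show ?thesis by (rule mult_left_le_imp_le) simp
qed

text \<open>On the unit circle itself neither function need have values, so the comparison is made
  on circles of radius \<rho> < 1, and \<rho> tends to 1 in a finite sum.\<close>

lemma coeff_l2_mono: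
  assumes A: "disc_expansion f A" and B: "disc_expansion g B"
    and le: "\<And>z. norm z < 1 \<Longrightarrow> norm (f z) \<le> norm (g z)"
    and S: "\<And>M. (\<Sum>n\<le>M. (norm (fps_nth B n))\<^sup>2) \<le> S"
  shows "(\<Sum>n\<le>M. (norm (fps_nth A n))\<^sup>2) \<le> S"
proof -
  have *: "(\<Sum>n\<le>M. (norm (fps_nth A n))\<^sup>2 * \<rho> ^ (2 * n)) \<le> S" if \<rho>: "0 \<le> \<rho>" "\<rho> < 1" for \<rho> :: real
  proof -
    have "(\<Sum>n\<le>M. (norm (fps_nth A n))\<^sup>2 * \<rho> ^ (2 * n)) \<le> (\<Sum>n. (norm (fps_nth A n))\<^sup>2 * \<rho> ^ (2 * n))"
      using \<rho> by (intro sum_le_suminf parseval(2)[OF A]) auto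
    also have "\<dots> \<le> (\<Sum>n. (norm (fps_nth B n))\<^sup>2 * \<rho> ^ (2 * n))"
      using parseval_mono[OF A B \<rho>, of 1] le \<rho> by simp
    also have "\<dots> \<le> S"
    proof (rule suminf_le_const[OF parseval(2)[OF B \<rho>]])
      fix N
      have "(\<Sum>n<N. (norm (fps_nth B n))\<^sup>2 * \<rho> ^ (2 * n)) \<le> (\<Sum>n<N. (norm (fps_nth B n))\<^sup>2)"
        using \<rho> by (intro sum_mono mult_right_le_one_le) (auto simp: power_le_one)
      also have "\<dots> \<le> (\<Sum>n\<le>N. (norm (fps_nth B n))\<^sup>2)" by (intro sum_mono2) auto
      finally show "(\<Sum>n<N. (norm (fps_nth B n))\<^sup>2 * \<rho> ^ (2 * n)) \<le> S" using S[of N] by simp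
    qed
    finally show ?thesis .
  qed
  have "((\<lambda>\<rho>. \<Sum>n\<le>M. (norm (fps_nth A n))\<^sup>2 * \<rho> ^ (2 * n)) \<longlongrightarrow> (\<Sum>n\<le>M. (norm (fps_nth A n))\<^sup>2 * 1 ^ (2 * n))) (at_left 1)"
    by (intro tendsto_intros)
  moreover have "eventually (\<lambda>\<rho>. (\<Sum>n\<le>M. (norm (fps_nth A n))\<^sup>2 * \<rho> ^ (2 * n)) \<le> S) (at_left (1::real))"
    by (rule eventually_mono[OF eventually_at_left_real[of 0 1]]) (auto intro: *)
  ultimately show ?thesis
    using tendsto_upperbound[of "\<lambda>\<rho>. \<Sum>n\<le>M. (norm (fps_nth A n))\<^sup>2 * \<rho> ^ (2 * n)" _ "at_left 1" S] by simp
qed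

lemma disc_expansion_power: "disc_expansion f A \<Longrightarrow> disc_expansion (\<lambda>z. f z ^ n) (A ^ n)"
proof (induction n)
  case 0
  then show ?case using disc_expansion_const[of 1] by simp
next
  case (Suc n)
  then show ?case using disc_expansion_mult[of f A "\<lambda>z. f z ^ n" "A ^ n"] by simp
qed

section \<open>The inequalities of Bohr and Rogosinski\<close>

text \<open>The hypothesis is what the l2 comparison of u (1 + c z^n) with 1 + c z^n gives once the
  phases are aligned and |c| = t; optimising over t yields the sharp bound.\<close>

lemma quadratic_family_bound:
  fixes x y :: real
  assumes xy: "x \<ge> 0" "y \<ge> 0" and *: "\<And>t. t \<ge> 0 \<Longrightarrow> x\<^sup>2 + (y + t * x)\<^sup>2 \<le> 1 + t\<^sup>2"
  shows "y \<le> 1 - x\<^sup>2"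
proof -
  have s: "x\<^sup>2 + y\<^sup>2 \<le> 1" using *[of 0] by simp
  have x1: "x\<^sup>2 \<le> 1" using s zero_le_power2[of y] by linarith
  define D where "D = 1 - x\<^sup>2"
  show ?thesis
  proof (cases "D = 0")
    case True
    then have "y\<^sup>2 = 0" using s zero_le_power2[of y] unfolding D_def by linarith
    then have "y = 0" by simp
    then show ?thesis using True unfolding D_def by linarith
  next
    case False
    then have D: "D > 0" using x1 unfolding D_def by linarith
    \<comment> \<open>The maximiser of (y + t x)^2 - t^2.\<close>
    define t where "t = x * y / D"
    have t: "t \<ge> 0" "t * D = x * y" using D xy by (simp_all add: t_def)
    have "x\<^sup>2 + (y + t * x)\<^sup>2 \<le> 1 + t\<^sup>2" by (rule *[OF t(1)])
    moreover have "x\<^sup>2 + (y + t * x)\<^sup>2 - (1 + t\<^sup>2) = y\<^sup>2 + 2 * (t * (x * y)) - t * (t * D) - D"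
      unfolding D_def by algebra
    ultimately have "y\<^sup>2 + t * (x * y) \<le> D" unfolding t(2) by linarith
    then have "(y\<^sup>2 + t * (x * y)) * D \<le> D * D"
      using D by (intro mult_right_mono) auto
    also have "(y\<^sup>2 + t * (x * y)) * D = y\<^sup>2 * D + (t * D) * (x * y)" by algebra
    also have "\<dots> = y\<^sup>2" unfolding t(2) unfolding D_def by algebra
    finally have "y\<^sup>2 \<le> D\<^sup>2" unfolding power2_eq_square .
    then have "y \<le> D" using D by (rule_tac power2_le_imp_le) auto
    then show ?thesis by (simp add: D_def)
  qed
qed

text \<open>Multiplication by the test polynomial Q = 1 + c z^n couples the coefficients 0 and n of
  u: |u Q| \<le> |Q| on the disc, and the square sum of Q is 1 + |c|^2. Varying c gives more than
  the square sum of u alone.\<close>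

lemma bounded_coeff_bound:
  assumes U: "disc_expansion u U" and le: "\<And>z. norm z < 1 \<Longrightarrow> norm (u z) \<le> 1" and n: "n > 0"
  shows "norm (fps_nth U n) \<le> 1 - (norm (fps_nth U 0))\<^sup>2"
proof -
  have main: "(norm (fps_nth U 0))\<^sup>2 + (norm (fps_nth U n + c * fps_nth U 0))\<^sup>2 \<le> 1 + (norm c)\<^sup>2" for c
  proof -
    define Q where "Q = 1 + fps_const c * fps_X ^ n"
    have Q: "disc_expansion (\<lambda>z. 1 + c * z ^ n) Q"
      unfolding Q_def fps_const_1_eq_1[symmetric]
      by (intro disc_expansion_add disc_expansion_mult disc_expansion_const disc_expansion_power disc_expansion_X)
    have Qn: "fps_nth Q i = (if i = 0 then 1 else if i = n then c else 0)" for i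
      using n by (auto simp: Q_def)
    have UQ: "fps_nth (U * Q) 0 = fps_nth U 0" "fps_nth (U * Q) n = fps_nth U n + c * fps_nth U 0"
      using n by (simp_all add: Q_def distrib_left mult.left_commute[of U] fps_X_power_mult_right_nth)
    have S: "(\<Sum>i\<le>M. (norm (fps_nth Q i))\<^sup>2) \<le> 1 + (norm c)\<^sup>2" for M
    proof -
      have "(\<Sum>i\<le>M. (norm (fps_nth Q i))\<^sup>2) = (\<Sum>i\<in>{..M} \<inter> {0, n}. (norm (fps_nth Q i))\<^sup>2)"
        by (intro sum.mono_neutral_right) (auto simp: Qn)
      also have "\<dots> \<le> (\<Sum>i\<in>{0, n}. (norm (fps_nth Q i))\<^sup>2)"
        by (intro sum_mono2) auto
      finally show ?thesis using n by (simp add: Qn)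
    qed
    have "(norm (fps_nth (U * Q) 0))\<^sup>2 + (norm (fps_nth (U * Q) n))\<^sup>2 = (\<Sum>i\<in>{0, n}. (norm (fps_nth (U * Q) i))\<^sup>2)"
      using n by (simp del: fps_mult_nth_0)
    also have "\<dots> \<le> (\<Sum>i\<le>n. (norm (fps_nth (U * Q) i))\<^sup>2)"
      by (intro sum_mono2) auto
    also have "\<dots> \<le> 1 + (norm c)\<^sup>2"
      by (rule coeff_l2_mono[OF disc_expansion_mult[OF U Q] Q _ S])
         (simp add: norm_mult mult_left_le_one_le le)
    finally show ?thesis unfolding UQ .
  qed
  define x where "x = norm (fps_nth U 0)"
  define y where "y = norm (fps_nth U n)"
  have xy: "x \<ge> 0" "y \<ge> 0" by (simp_all add: x_def y_def)
  have *: "x\<^sup>2 + (y + t * x)\<^sup>2 \<le> 1 + t\<^sup>2" if t: "t \<ge> 0" for t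
  proof (cases "fps_nth U n = 0 \<or> fps_nth U 0 = 0")
    case True
    then show ?thesis
    proof
      assume "fps_nth U n = 0"
      then show ?thesis using main[of "of_real t"] t by (simp add: x_def y_def norm_mult)
    next
      assume "fps_nth U 0 = 0"
      then have "y\<^sup>2 \<le> 1" "x = 0" using main[of 0] by (simp_all add: x_def y_def)
      moreover have "(1::real) \<le> 1 + t\<^sup>2" by simp
      ultimately have "y\<^sup>2 \<le> 1 + t\<^sup>2" by linarith
      then show ?thesis using \<open>x = 0\<close> by simp
    qed
  next
    case False
    \<comment> \<open>\<open>c\<close> has modulus t, and its phase makes c U_0 point in the
      direction of U_n.\<close>
    define c where "c = of_real t * sgn (fps_nth U n) / sgn (fps_nth U 0)"
    have nc: "norm c = t" using t False by (simp add: c_def norm_mult norm_divide norm_sgn)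
    have "sgn (fps_nth U n) * of_real y = fps_nth U n" using False by (simp add: y_def sgn_eq)
    moreover have c0: "c * fps_nth U 0 = sgn (fps_nth U n) * of_real (t * x)"
    proof -
      have "fps_nth U 0 / sgn (fps_nth U 0) = of_real x" using False by (simp add: x_def sgn_eq)
      moreover have "c * fps_nth U 0 = of_real t * sgn (fps_nth U n) * (fps_nth U 0 / sgn (fps_nth U 0))"
        by (simp only: c_def times_divide_eq_left times_divide_eq_right)
      ultimately show ?thesis by (simp only: of_real_mult mult_ac)
    qed
    ultimately have "fps_nth U n + c * fps_nth U 0 = sgn (fps_nth U n) * of_real (y + t * x)"
      by (simp only: distrib_left of_real_add)
    then have "norm (fps_nth U n + c * fps_nth U 0) = \<bar>y + t * x\<bar>"
      using False by (simp only: norm_mult norm_of_real norm_sgn) auto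
    then show ?thesis using main[of c] nc by (simp add: x_def)
  qed
  have "y \<le> 1 - x\<^sup>2" by (rule quadratic_family_bound[OF xy *])
  then show ?thesis by (simp add: x_def y_def)
qed

text \<open>The number 1/3 appears because 1 - x^2 \<le> 2 (1 - x) and the powers of 1/3 from the
  first on sum to 1/2, so that the tail fits exactly into 1 - x.\<close>

lemma bohr_majorant_le_1:
  assumes U: "disc_expansion u U" and le: "\<And>z. norm z < 1 \<Longrightarrow> norm (u z) \<le> 1" and r: "0 \<le> r" "r \<le> 1/3"
  shows "(\<Sum>n\<le>N. norm (fps_nth U n) * r ^ n) \<le> 1"
proof -
  define x where "x = norm (fps_nth U 0)"
  have x: "0 \<le> x" "x \<le> 1" using le[of 0] disc_expansion_at_0[OF U] by (simp_all add: x_def)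
  have "(\<Sum>n<N. norm (fps_nth U (Suc n)) * r ^ Suc n) \<le> (\<Sum>n<N. 2 * (1 - x) * (1/3) ^ Suc n)"
  proof (intro sum_mono mult_mono power_mono r)
    fix n
    have "norm (fps_nth U (Suc n)) \<le> 1 - x\<^sup>2" using bounded_coeff_bound[OF U le, of "Suc n"] by (simp add: x_def)
    also have "\<dots> = (1 - x) * (1 + x)" by (simp add: power2_eq_square algebra_simps)
    also have "\<dots> \<le> (1 - x) * 2" using x by (intro mult_left_mono) auto
    finally show "norm (fps_nth U (Suc n)) \<le> 2 * (1 - x)" by simp
  qed (use x r in auto)
  also have "\<dots> = 2 * (1 - x) * (\<Sum>n<N. (1/3) ^ Suc n)" by (simp only: sum_distrib_left)
  also have "\<dots> \<le> 2 * (1 - x) * (1/2)"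
  proof (rule mult_left_mono)
    have "(\<Sum>n<N. (1/3::real) ^ Suc n) = 1/2 - (1/3)^N / 2"
      by (induction N) simp_all
    also have "\<dots> \<le> 1/2" by simp
    finally show "(\<Sum>n<N. (1/3::real) ^ Suc n) \<le> 1/2" .
  qed (use x in auto)
  finally have "(\<Sum>n<N. norm (fps_nth U (Suc n)) * r ^ Suc n) \<le> 1 - x" by simp
  moreover have "(\<Sum>n\<le>N. norm (fps_nth U n) * r ^ n) = x + (\<Sum>n<N. norm (fps_nth U (Suc n)) * r ^ Suc n)"
    by (simp add: sum.atMost_shift x_def)
  ultimately show ?thesis by simp
qed

lemma bohr_majorant:
  assumes U: "disc_expansion u U" and le: "\<And>z. norm z < 1 \<Longrightarrow> norm (u z) \<le> C" and r: "0 \<le> r" "r \<le> 1/3"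
  shows "(\<Sum>n\<le>N. norm (fps_nth U n) * r ^ n) \<le> C"
proof -
  have C: "C \<ge> 0" using le[of 0] norm_ge_zero[of "u 0"] by (simp del: norm_ge_zero)
  \<comment> \<open>Scaling by D > C instead of C covers the case C = 0.\<close>
  have "(\<Sum>n\<le>N. norm (fps_nth U n) * r ^ n) \<le> D" if D: "D > C" for D
  proof -
    have "disc_expansion (\<lambda>z. of_real (1/D) * u z) (fps_const (of_real (1/D)) * U)"
      by (intro disc_expansion_mult disc_expansion_const U)
    from bohr_majorant_le_1[OF this _ r, of N]
    have "(\<Sum>n\<le>N. norm (fps_nth U n) * r ^ n / D) \<le> 1"
      using le C D by (fastforce simp: norm_mult norm_divide field_simps)
    then show ?thesis using C D by (simp add: sum_divide_distrib[symmetric] field_simps)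
  qed
  then show ?thesis by (rule dense_ge)
qed

section \<open>Majorants of products, powers and compositions of power series\<close>

text \<open>The pairs with i + j \<le> N form a triangle inside the square of all pairs up to N.
  Partial sums avoid any question of convergence of majorant series.\<close>

lemma fps_mult_partial_sum_le:
  fixes X Y :: "real fps"
  assumes "\<And>n. fps_nth X n \<ge> 0" "\<And>n. fps_nth Y n \<ge> 0" "r \<ge> 0"
  shows "(\<Sum>n\<le>N. fps_nth (X * Y) n * r ^ n) \<le> (\<Sum>n\<le>N. fps_nth X n * r ^ n) * (\<Sum>n\<le>N. fps_nth Y n * r ^ n)"
proof -
  have "(\<Sum>n\<le>N. fps_nth (X * Y) n * r ^ n) =
    (\<Sum>n\<le>N. \<Sum>i\<le>n. (fps_nth X i * r ^ i) * (fps_nth Y (n - i) * r ^ (n - i)))"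
    unfolding fps_mult_nth sum_distrib_right atLeast0AtMost
    by (intro sum.cong refl) (simp add: mult_ac flip: power_add)
  also have "\<dots> = (\<Sum>(i, j)\<in>{(i, j). i + j \<le> N}. (fps_nth X i * r ^ i) * (fps_nth Y j * r ^ j))"
    by (rule sum.triangle_reindex_eq[symmetric])
  also have "\<dots> \<le> (\<Sum>(i, j)\<in>{..N} \<times> {..N}. (fps_nth X i * r ^ i) * (fps_nth Y j * r ^ j))"
    using assms by (intro sum_mono2) auto
  also have "\<dots> = (\<Sum>n\<le>N. fps_nth X n * r ^ n) * (\<Sum>n\<le>N. fps_nth Y n * r ^ n)"
    by (simp add: sum_product sum.cartesian_product)
  finally show ?thesis .
qed

definition fps_majorant :: "complex fps \<Rightarrow> real fps" where
  "fps_majorant A = Abs_fps (\<lambda>n. norm (fps_nth A n))"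

lemma fps_majorant_nth [simp]: "fps_nth (fps_majorant A) n = norm (fps_nth A n)"
  by (simp add: fps_majorant_def)

lemma norm_fps_mult_nth_le:
  "norm (fps_nth (A * B) n) \<le> fps_nth (fps_majorant A * fps_majorant B) n"
  unfolding fps_mult_nth by (rule order_trans[OF norm_sum]) (simp add: norm_mult)

lemma fps_power_majorant_nonneg: "fps_nth (fps_majorant A ^ k) n \<ge> 0"
  by (induction k arbitrary: n) (auto simp: fps_mult_nth intro!: sum_nonneg)

lemma norm_fps_power_nth_le: "norm (fps_nth (A ^ k) n) \<le> fps_nth (fps_majorant A ^ k) n"
proof (induction k arbitrary: n)
  case 0
  then show ?case by (cases n) auto
next
  case (Suc k)
  have "norm (fps_nth (A ^ Suc k) n) \<le> fps_nth (fps_majorant A * fps_majorant (A ^ k)) n"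
    using norm_fps_mult_nth_le by simp
  also have "\<dots> \<le> fps_nth (fps_majorant A * fps_majorant A ^ k) n"
    unfolding fps_mult_nth by (intro sum_mono mult_left_mono) (simp_all add: Suc)
  finally show ?case by simp
qed

lemma fps_power_majorant_partial_sum_le:
  assumes "r \<ge> 0"
  shows "(\<Sum>n\<le>N. fps_nth (fps_majorant A ^ k) n * r ^ n) \<le> (\<Sum>n\<le>N. norm (fps_nth A n) * r ^ n) ^ k"
proof (induction k)
  case 0
  then show ?case by (simp add: sum.atMost_shift)
next
  case (Suc k)
  have "(\<Sum>n\<le>N. fps_nth (fps_majorant A ^ Suc k) n * r ^ n) \<le>
     (\<Sum>n\<le>N. fps_nth (fps_majorant A) n * r ^ n) * (\<Sum>n\<le>N. fps_nth (fps_majorant A ^ k) n * r ^ n)"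
    using fps_mult_partial_sum_le[of "fps_majorant A" "fps_majorant A ^ k" r N] assms fps_power_majorant_nonneg by simp
  also have "\<dots> \<le> (\<Sum>n\<le>N. fps_nth (fps_majorant A) n * r ^ n) * (\<Sum>n\<le>N. norm (fps_nth A n) * r ^ n) ^ k"
    using assms by (intro mult_left_mono Suc sum_nonneg) auto
  finally show ?case by simp
qed

text \<open>Coefficient n of a composition involves only the powers W^i with i \<le> n, so the same
  cut-off N serves both sides, and the majorant of W^i is at most the i-th power of that of
  W.\<close>

lemma fps_compose_partial_sum_le:
  fixes A W :: "complex fps"
  assumes W0: "fps_nth W 0 = 0" and r: "r \<ge> 0" and M: "(\<Sum>n\<le>N. norm (fps_nth W n) * r ^ n) \<le> s"
  shows "(\<Sum>n\<le>N. norm (fps_nth (fps_compose A W) n) * r ^ n) \<le> (\<Sum>n\<le>N. norm (fps_nth A n) * s ^ n)"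
proof -
  have "(\<Sum>n\<le>N. norm (fps_nth (fps_compose A W) n) * r ^ n) \<le>
    (\<Sum>n\<le>N. \<Sum>i\<le>N. norm (fps_nth A i) * (fps_nth (fps_majorant W ^ i) n * r ^ n))"
  proof (rule sum_mono)
    fix n assume n: "n \<in> {..N}"
    have "norm (fps_nth (fps_compose A W) n) \<le> (\<Sum>i\<in>{0..n}. norm (fps_nth A i) * fps_nth (fps_majorant W ^ i) n)"
      unfolding fps_compose_nth
      by (rule order_trans[OF norm_sum]) (auto intro!: sum_mono mult_left_mono norm_fps_power_nth_le simp: norm_mult)
    also have "\<dots> \<le> (\<Sum>i\<le>N. norm (fps_nth A i) * fps_nth (fps_majorant W ^ i) n)"
      using n by (intro sum_mono2) (auto intro!: mult_nonneg_nonneg fps_power_majorant_nonneg)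
    finally have "norm (fps_nth (fps_compose A W) n) * r ^ n \<le>
       (\<Sum>i\<le>N. norm (fps_nth A i) * fps_nth (fps_majorant W ^ i) n) * r ^ n"
      using r by (intro mult_right_mono) auto
    then show "norm (fps_nth (fps_compose A W) n) * r ^ n \<le>
      (\<Sum>i\<le>N. norm (fps_nth A i) * (fps_nth (fps_majorant W ^ i) n * r ^ n))"
      by (simp add: sum_distrib_right mult.assoc)
  qed
  also have "\<dots> = (\<Sum>i\<le>N. norm (fps_nth A i) * (\<Sum>n\<le>N. fps_nth (fps_majorant W ^ i) n * r ^ n))"
    by (subst sum.swap) (simp add: sum_distrib_left)
  also have "\<dots> \<le> (\<Sum>i\<le>N. norm (fps_nth A i) * s ^ i)"
  proof (intro sum_mono mult_left_mono)
    fix i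
    have "(\<Sum>n\<le>N. fps_nth (fps_majorant W ^ i) n * r ^ n) \<le> (\<Sum>n\<le>N. norm (fps_nth W n) * r ^ n) ^ i"
      by (rule fps_power_majorant_partial_sum_le[OF r])
    also have "\<dots> \<le> s ^ i" using M r by (intro power_mono sum_nonneg) auto
    finally show "(\<Sum>n\<le>N. fps_nth (fps_majorant W ^ i) n * r ^ n) \<le> s ^ i" .
  qed auto
  finally show ?thesis .
qed

section \<open>Subordination: Schwarz functions, majorants and square sums\<close>

locale schwarz_function =
  fixes w :: "complex \<Rightarrow> complex" and W :: "complex fps"
  assumes W: "disc_expansion w W" and w0: "w 0 = 0" and w1: "w ` unit_disc \<subseteq> unit_disc"
begin

lemma W0: "fps_nth W 0 = 0"
  using disc_expansion_at_0[OF W] w0 by simp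

lemma norm_le: "norm z < 1 \<Longrightarrow> norm (w z) \<le> norm z"
  using Schwarz_Lemma(1)[of w z] W w0 w1 unfolding disc_expansion_def by (force simp: image_subset_iff)

text \<open>By the Schwarz lemma w = z u with |u| \<le> 1; Bohr's inequality for u, multiplied by r,
  is the claim.\<close>

lemma majorant_le:
  assumes r: "0 \<le> r" "r \<le> 1/3"
  shows "(\<Sum>n\<le>N. norm (fps_nth W n) * r ^ n) \<le> r"
proof -
  obtain u where u: "disc_expansion u (fps_shift 1 W)" and wu: "\<And>z. norm z < 1 \<Longrightarrow> w z = fps_nth W 0 + z * u z"
    using disc_expansion_shift[OF W] by blast
  \<comment> \<open>At z = 0 division by z is impossible; there |u 0| = |W_1| \<le> 1 comes from
    comparing square sums with those of the identity.\<close>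
  have "norm (fps_nth W 1) ^ 2 \<le> (\<Sum>n\<le>1. (norm (fps_nth W n))\<^sup>2)" by simp
  also have "\<dots> \<le> 1"
  proof (rule coeff_l2_mono[OF W disc_expansion_X norm_le])
    fix M show "(\<Sum>n\<le>M. (norm (fps_nth (fps_X :: complex fps) n))\<^sup>2) \<le> 1"
    proof -
      have "(\<Sum>n\<le>M. (norm (fps_nth (fps_X :: complex fps) n))\<^sup>2) \<le> (\<Sum>n\<in>{..M}. if n = 1 then 1 else 0)"
        by (intro sum_mono) (auto simp: fps_X_nth)
      then show ?thesis by (auto simp: sum.delta split: if_splits)
    qed
  qed auto
  finally have W1: "norm (fps_nth W 1) \<le> 1" by (simp add: power_le_one_iff)
  have "norm (u z) \<le> 1" if z: "norm z < 1" for z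
  proof (cases "z = 0")
    case True
    then show ?thesis using disc_expansion_at_0[OF u] W1 by simp
  next
    case False
    have "norm z * norm (u z) \<le> norm z * 1" using wu[OF z] norm_le[OF z] W0 by (simp add: norm_mult)
    then show ?thesis using False by (subst (asm) mult_le_cancel_left) auto
  qed
  note b = bohr_majorant_le_1[OF u this r]
  show ?thesis
  proof (cases N)
    case 0 then show ?thesis using W0 r by simp
  next
    case (Suc M)
    have "(\<Sum>n\<le>N. norm (fps_nth W n) * r ^ n) = r * (\<Sum>n\<le>M. norm (fps_nth (fps_shift 1 W) n) * r ^ n)"
      unfolding Suc sum.atMost_Suc_shift using W0 by (simp add: sum_distrib_left mult_ac)
    also have "\<dots> \<le> r * 1" using b r by (intro mult_left_mono) auto
    finally show ?thesis by simp
  qed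
qed

text \<open>Composition replaces r by the majorant of w at r, which is again at most r as long as r
  \<le> 1/3. The constant terms of both sides agree and cancel.\<close>

lemma subordinate_majorant:
  assumes r: "0 \<le> r" "r \<le> 1/3"
  shows "(\<Sum>n<N. norm (fps_nth (fps_compose A W) (Suc n)) * r ^ Suc n) \<le> (\<Sum>n<N. norm (fps_nth A (Suc n)) * r ^ Suc n)"
  using fps_compose_partial_sum_le[OF W0 r(1) majorant_le[OF r], where A = A and N = N]
  by (simp add: sum.atMost_shift)

text \<open>Rogosinski's argument in Horner form: q(w) = c_0 + w q_1(w). The series of w q_1(w) has
  no constant term, so the square sums add, and the factor w does not increase them because |w|
  \<le> 1. Expansion and bound are proved together since the comparison for w q_1(w) needs the
  expansion of q_1(w).\<close>

lemma polynomial_l2: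
  "disc_expansion (\<lambda>z. \<Sum>i\<le>N. c i * w z ^ i) (\<Sum>i\<le>N. fps_const (c i) * W ^ i) \<and>
   (\<Sum>n\<le>M. (norm (fps_nth (\<Sum>i\<le>N. fps_const (c i) * W ^ i) n))\<^sup>2) \<le> (\<Sum>i\<le>N. (norm (c i))\<^sup>2)"
proof (induction N arbitrary: c M)
  case 0
  have "(\<Sum>n\<le>M. (norm (fps_nth (fps_const (c 0)) n))\<^sup>2) = (\<Sum>n\<le>M. if n = 0 then (norm (c 0))\<^sup>2 else 0)"
    by (intro sum.cong) auto
  then show ?case using disc_expansion_const[of "c 0"] by (simp add: sum.delta)
next
  case (Suc N)
  let ?q = "\<lambda>z. \<Sum>i\<le>N. c (Suc i) * w z ^ i" and ?Q = "\<Sum>i\<le>N. fps_const (c (Suc i)) * W ^ i"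
  have Q: "disc_expansion ?q ?Q" and QM: "\<And>M. (\<Sum>n\<le>M. (norm (fps_nth ?Q n))\<^sup>2) \<le> (\<Sum>i\<le>N. (norm (c (Suc i)))\<^sup>2)"
    using Suc[of "\<lambda>i. c (Suc i)"] by auto
  have WQ: "disc_expansion (\<lambda>z. w z * ?q z) (W * ?Q)" by (rule disc_expansion_mult[OF W Q])
  have e1: "(\<lambda>z. \<Sum>i\<le>Suc N. c i * w z ^ i) = (\<lambda>z. c 0 + w z * ?q z)"
    by (rule ext) (subst sum.atMost_Suc_shift, simp add: sum_distrib_left mult_ac)
  have e2: "(\<Sum>i\<le>Suc N. fps_const (c i) * W ^ i) = fps_const (c 0) + W * ?Q"
    by (subst sum.atMost_Suc_shift) (simp add: sum_distrib_left mult_ac)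
  have le: "(\<Sum>n\<le>M. (norm (fps_nth (W * ?Q) n))\<^sup>2) \<le> (\<Sum>i\<le>N. (norm (c (Suc i)))\<^sup>2)" for M
  proof (rule coeff_l2_mono[OF WQ Q _ QM])
    fix z :: complex assume "norm z < 1"
    then have "norm (w z) \<le> 1" using norm_le[of z] by simp
    then show "norm (w z * ?q z) \<le> norm (?q z)" by (simp add: norm_mult mult_left_le_one_le)
  qed
  have "(\<Sum>n\<le>M. (norm (fps_nth (fps_const (c 0) + W * ?Q) n))\<^sup>2) =
      (norm (c 0))\<^sup>2 + (\<Sum>n<M. (norm (fps_nth (W * ?Q) (Suc n)))\<^sup>2)"
    by (simp add: sum.atMost_shift W0)
  also have "(\<Sum>n<M. (norm (fps_nth (W * ?Q) (Suc n)))\<^sup>2) = (\<Sum>n\<le>M. (norm (fps_nth (W * ?Q) n))\<^sup>2)"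
    by (simp add: sum.atMost_shift W0)
  also have "(norm (c 0))\<^sup>2 + \<dots> \<le> (norm (c 0))\<^sup>2 + (\<Sum>i\<le>N. (norm (c (Suc i)))\<^sup>2)"
    using le by simp
  also have "\<dots> = (\<Sum>i\<le>Suc N. (norm (c i))\<^sup>2)"
    by (subst sum.atMost_Suc_shift) simp
  finally show ?case
    unfolding e1 e2 using disc_expansion_add[OF disc_expansion_const WQ] by blast
qed

text \<open>The coefficients up to N of the composition depend only on the Taylor polynomial of
  degree N of \<open>A\<close>, so polynomials suffice.\<close>

lemma subordinate_l2:
  "(\<Sum>n\<le>N. (norm (fps_nth (fps_compose A W) n))\<^sup>2) \<le> (\<Sum>n\<le>N. (norm (fps_nth A n))\<^sup>2)"
proof -
  have "fps_nth (fps_compose A W) n = fps_nth (\<Sum>i\<le>N. fps_const (fps_nth A i) * W ^ i) n" if "n \<le> N" for n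
  proof -
    have "fps_nth (fps_compose A W) n = (\<Sum>i\<in>{0..n}. fps_nth A i * fps_nth (W ^ i) n)"
      by (simp add: fps_compose_nth)
    also have "\<dots> = (\<Sum>i\<le>N. fps_nth A i * fps_nth (W ^ i) n)"
      using that startsby_zero_power_prefix[OF W0] by (intro sum.mono_neutral_left) auto
    finally show ?thesis by (simp add: fps_sum_nth)
  qed
  then show ?thesis using polynomial_l2[where M = N and N = N and c = "fps_nth A"] by simp
qed

end

text \<open>Summation by parts, done as an induction whose claim retains the current weight times
  the total difference.\<close>

lemma weighted_partial_sums_le:
  fixes x y wt :: "nat \<Rightarrow> real"
  assumes le: "\<And>N. (\<Sum>n\<le>N. x n) \<le> (\<Sum>n\<le>N. y n)" and dec: "\<And>n. wt (Suc n) \<le> wt n" and nn: "\<And>n. wt n \<ge> 0"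
  shows "(\<Sum>n\<le>N. wt n * x n) \<le> (\<Sum>n\<le>N. wt n * y n)"
proof -
  have "wt N * (\<Sum>n\<le>N. y n - x n) \<le> (\<Sum>n\<le>N. wt n * (y n - x n))"
  proof (induction N)
    case (Suc N)
    have "0 \<le> (\<Sum>n\<le>N. y n - x n)" using le[of N] by (simp add: sum_subtractf)
    then have "wt (Suc N) * (\<Sum>n\<le>N. y n - x n) \<le> wt N * (\<Sum>n\<le>N. y n - x n)"
      using dec by (intro mult_right_mono) auto
    then show ?case using Suc by (simp add: distrib_left)
  qed simp
  moreover have "0 \<le> wt N * (\<Sum>n\<le>N. y n - x n)"
    using le[of N] nn by (intro mult_nonneg_nonneg) (auto simp: sum_subtractf)
  ultimately show ?thesis by (simp add: right_diff_distrib sum_subtractf)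
qed

lemma dilatation_majorant:
  assumes Om: "disc_expansion om Om" and le: "\<And>z. norm z < 1 \<Longrightarrow> norm (om z) \<le> k"
    and eq: "fps_deriv B = Om * fps_deriv A" and r: "0 \<le> r" "r \<le> 1/3"
  shows "(\<Sum>n\<le>N. norm (fps_nth B (Suc n)) * r ^ Suc n) \<le> k * (\<Sum>n\<le>N. norm (fps_nth A (Suc n)) * r ^ Suc n)"
proof -
  define X where "X = fps_shift 1 (fps_majorant A)"
  have Xn: "fps_nth X n = norm (fps_nth A (Suc n))" for n by (simp add: X_def)
  have B: "norm (fps_nth B (Suc n)) \<le> fps_nth (fps_majorant Om * X) n" for n
  proof -
    have "real (Suc n) * norm (fps_nth B (Suc n)) = norm (fps_nth (fps_deriv B) n)"
      unfolding fps_deriv_nth norm_mult by (simp del: of_nat_Suc)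
    also have "\<dots> \<le> (\<Sum>i=0..n. norm (fps_nth Om i) * (real (Suc (n - i)) * norm (fps_nth A (Suc (n - i)))))"
      unfolding eq fps_mult_nth
      by (rule order_trans[OF norm_sum]) (simp add: norm_mult del: of_nat_Suc)
    also have "\<dots> \<le> (\<Sum>i=0..n. norm (fps_nth Om i) * (real (Suc n) * norm (fps_nth A (Suc (n - i)))))"
      by (intro sum_mono mult_left_mono mult_right_mono) auto
    also have "\<dots> = real (Suc n) * fps_nth (fps_majorant Om * X) n"
      unfolding fps_mult_nth Xn fps_majorant_nth sum_distrib_left by (simp only: mult.left_commute)
    finally show ?thesis by (subst (asm) mult_le_cancel_left) (auto simp del: of_nat_Suc)
  qed
  have "(\<Sum>n\<le>N. norm (fps_nth B (Suc n)) * r ^ n) \<le> (\<Sum>n\<le>N. fps_nth (fps_majorant Om * X) n * r ^ n)"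
    using r by (intro sum_mono mult_right_mono B) auto
  also have "\<dots> \<le> (\<Sum>n\<le>N. norm (fps_nth Om n) * r ^ n) * (\<Sum>n\<le>N. fps_nth X n * r ^ n)"
    using fps_mult_partial_sum_le[of "fps_majorant Om" X r N] r by (simp add: Xn)
  also have "\<dots> \<le> k * (\<Sum>n\<le>N. fps_nth X n * r ^ n)"
    using r by (intro mult_right_mono bohr_majorant[OF Om le r] sum_nonneg) (auto simp: Xn)
  finally have "(\<Sum>n\<le>N. norm (fps_nth B (Suc n)) * r ^ n) * r \<le> k * (\<Sum>n\<le>N. fps_nth X n * r ^ n) * r"
    using r by (intro mult_right_mono) auto
  then show ?thesis by (simp add: Xn sum_distrib_right sum_distrib_left mult_ac)
qed

section \<open>The area theorem\<close>

lemma distr_lborel_Complex: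
  "distr (lborel \<Otimes>\<^sub>M lborel) borel (\<lambda>(x, y). Complex x y) = (lborel :: complex measure)"
proof (rule lborel_eqI[symmetric])
  have m: "(\<lambda>(x, y). Complex x y) \<in> borel_measurable (lborel \<Otimes>\<^sub>M lborel)"
    unfolding Complex_eq by measurable
  fix l u :: complex
  assume lu: "\<And>b. b \<in> Basis \<Longrightarrow> l \<bullet> b \<le> u \<bullet> b"
  have "(\<lambda>(x, y). Complex x y) -` box l u = {Re l<..<Re u} \<times> {Im l<..<Im u}"
    by (auto simp: box_def Basis_complex_def)
  then show "emeasure (distr (lborel \<Otimes>\<^sub>M lborel) borel (\<lambda>(x, y). Complex x y)) (box l u) = ennreal (prod ((\<bullet>) (u - l)) Basis)"
    using lu[of 1] lu[of \<i>] m
    by (simp add: emeasure_distr space_pair_measure lborel.emeasure_pair_measure_Times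
      Basis_complex_def inner_diff_left ennreal_mult)
qed simp

lemma nn_integral_complex:
  assumes [measurable]: "f \<in> borel_measurable borel"
  shows "(\<integral>\<^sup>+u. f u \<partial>lborel) = (\<integral>\<^sup>+x. \<integral>\<^sup>+y. f (Complex x y) \<partial>lborel \<partial>lborel)"
proof -
  have m [measurable]: "(\<lambda>(x, y). Complex x y) \<in> borel_measurable (lborel \<Otimes>\<^sub>M lborel)"
    unfolding Complex_eq by measurable
  have "(\<integral>\<^sup>+u. f u \<partial>lborel) = (\<integral>\<^sup>+p. f ((\<lambda>(x, y). Complex x y) p) \<partial>(lborel \<Otimes>\<^sub>M lborel))"
    by (subst distr_lborel_Complex[symmetric], subst nn_integral_distr) auto
  also have "\<dots> = (\<integral>\<^sup>+x. \<integral>\<^sup>+y. f ((\<lambda>(x, y). Complex x y) (x, y)) \<partial>lborel \<partial>lborel)"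
    by (rule lborel.nn_integral_fst[symmetric]) measurable
  finally show ?thesis by simp
qed

text \<open>Logarithmic coordinates: \<open>exp\<close> is injective here, and its image is the set
  of nonzero z with ln |z| in \<open>I\<close>, cut along the positive real axis.\<close>

definition log_strip :: "real set \<Rightarrow> complex set" where
  "log_strip I = {u. Re u \<in> I \<and> Im u \<in> {0<..<2*pi}}"

lemma log_strip_iff: "Complex x y \<in> log_strip I \<longleftrightarrow> x \<in> I \<and> y \<in> {0<..<2*pi}"
  by (simp add: log_strip_def)

lemma open_log_strip: "open I \<Longrightarrow> open (log_strip I)"
proof -
  assume "open I"
  then have "open (Re -` I \<inter> Im -` {0<..<2*pi})"
    by (intro open_Int open_vimage continuous_intros) auto
  moreover have "log_strip I = Re -` I \<inter> Im -` {0<..<2*pi}" by (auto simp: log_strip_def)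
  ultimately show ?thesis by simp
qed

lemma inj_on_exp_log_strip: "inj_on exp (log_strip I)"
proof (rule inj_onI)
  fix u v assume uv: "u \<in> log_strip I" "v \<in> log_strip I" "exp u = exp v"
  then obtain n :: int where n: "u = v + (of_int (2 * n) * pi) * \<i>" by (auto simp: exp_eq)
  then have "Im u - Im v = 2 * pi * of_int n" by simp
  then have "\<bar>2 * pi * of_int n\<bar> < 2 * pi * 1" using uv by (auto simp: log_strip_def)
  then have "\<bar>of_int n :: real\<bar> < 1" by (simp add: abs_mult)
  then have "n = 0" by linarith
  then show "u = v" using n by simp
qed

text \<open>Integrating first over the imaginary part is Parseval's identity on the circle of radius
  e^x, which diagonalises the integral. The exponent k is 2 for the area functional, where |exp u|^2
  is the Jacobian, and -2 for the area theorem, because of the pole 1/z. With nonnegative integrals,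
  Tonelli and the exchange with the series hold unconditionally.\<close>

lemma nn_integral_log_strip:
  assumes P: "disc_expansion p A" and I: "I \<in> sets borel" "I \<subseteq> {..<0}"
  shows "(\<integral>\<^sup>+u. ennreal (indicator (log_strip I) u * ((norm (p (exp u)))\<^sup>2 * exp (k * Re u))) \<partial>lborel) =
    (\<Sum>n. ennreal (2 * pi * (norm (fps_nth A n))\<^sup>2) * (\<integral>\<^sup>+x. ennreal (exp ((2 * real n + k) * x)) * indicator I x \<partial>lborel))"
proof -
  have strip: "log_strip I \<in> sets borel"
  proof -
    have "log_strip I = (Re -` I \<inter> space borel) \<inter> (Im -` {0<..<2*pi} \<inter> space borel)" by (auto simp: log_strip_def)
    moreover have "Re -` I \<inter> space borel \<in> sets borel" "Im -` {0<..<2*pi} \<inter> space borel \<in> sets borel"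
      using I by (intro measurable_sets[of _ borel borel]; simp)+
    ultimately show ?thesis by simp
  qed
  have contp: "continuous_on {u. Re u < 0} (\<lambda>u. (norm (p (exp u)))\<^sup>2 * exp (k * Re u))"
  proof -
    have "continuous_on unit_disc p" using P by (simp add: disc_expansion_def holomorphic_on_imp_continuous_on)
    then have "continuous_on {u. Re u < 0} (\<lambda>u. p (exp u))"
      by (rule continuous_on_compose2) (auto intro!: continuous_intros)
    then show ?thesis by (intro continuous_intros)
  qed
  have H: "{u. Re u < 0} \<in> sets borel" by (simp add: open_halfspace_Re_lt)
  have m: "(\<lambda>u. ennreal (indicator (log_strip I) u * ((norm (p (exp u)))\<^sup>2 * exp (k * Re u)))) \<in> borel_measurable borel"
  proof -
    have "(\<lambda>u. indicator {u. Re u < 0} u *\<^sub>R ((norm (p (exp u)))\<^sup>2 * exp (k * Re u))) \<in> borel_measurable borel"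
      by (rule borel_measurable_continuous_on_indicator[OF H contp])
    then have "(\<lambda>u. indicator (log_strip I) u * (indicator {u. Re u < 0} u *\<^sub>R ((norm (p (exp u)))\<^sup>2 * exp (k * Re u)))) \<in> borel_measurable borel"
      using strip by (rule_tac borel_measurable_times[OF borel_measurable_indicator])
    also have "(\<lambda>u. indicator (log_strip I) u * (indicator {u. Re u < 0} u *\<^sub>R ((norm (p (exp u)))\<^sup>2 * exp (k * Re u)))) =
       (\<lambda>u. indicator (log_strip I) u * ((norm (p (exp u)))\<^sup>2 * exp (k * Re u)))"
      using I by (auto simp: fun_eq_iff indicator_def log_strip_def)
    finally show ?thesis by (rule measurable_compose) simp
  qed
  have inner: "(\<integral>\<^sup>+y. ennreal (indicator (log_strip I) (Complex x y) * ((norm (p (exp (Complex x y))))\<^sup>2 * exp (k * Re (Complex x y)))) \<partial>lborel) =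
     (\<Sum>n. ennreal (2 * pi * (norm (fps_nth A n))\<^sup>2) * (ennreal (exp ((2 * real n + k) * x)) * indicator I x))" for x
  proof (cases "x \<in> I")
    case False
    then show ?thesis by (simp add: log_strip_iff)
  next
    case True
    define \<rho> where "\<rho> = exp x"
    have \<rho>: "0 \<le> \<rho>" "\<rho> < 1" using True I by (auto simp: \<rho>_def)
    have ex: "exp (Complex x y) = \<rho> * cis y" for y by (simp add: \<rho>_def exp_eq_polar)
    define F where "F y = (norm (p (\<rho> * cis y)))\<^sup>2" for y
    define T where "T = (\<Sum>n. (norm (fps_nth A n))\<^sup>2 * \<rho> ^ (2 * n))"
    have F: "(F has_integral 2 * pi * T) {0..2*pi}" and sm: "summable (\<lambda>n. (norm (fps_nth A n))\<^sup>2 * \<rho> ^ (2 * n))"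
      using parseval[OF P \<rho>] unfolding F_def T_def by auto
    \<comment> \<open>The strip is open in the imaginary direction while Parseval integrates over
      the closed interval; the two endpoints form a null set.\<close>
    have AE: "AE y in lborel. y \<notin> {0, 2*pi}"
      by (rule AE_not_in) (rule finite_imp_null_set_lborel, simp)
    have contF: "continuous_on UNIV F"
    proof -
      have "continuous_on unit_disc p" using P by (simp add: disc_expansion_def holomorphic_on_imp_continuous_on)
      then have "continuous_on UNIV (\<lambda>y. p (\<rho> * cis y))"
        using \<rho> by (rule_tac continuous_on_compose2[of unit_disc p]) (auto intro!: continuous_intros simp: norm_mult)
      then show ?thesis unfolding F_def by (intro continuous_intros)
    qed
    have [measurable]: "F \<in> borel_measurable borel" by (rule borel_measurable_continuous_onI[OF contF])
    have kn: "exp (k * x) * \<rho> ^ (2 * n) = exp ((2 * real n + k) * x)" for n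
    proof -
      have "(2 * real n + k) * x = k * x + of_nat (2 * n) * x" by (simp add: algebra_simps)
      then show ?thesis unfolding \<rho>_def by (simp only: exp_add exp_of_nat_mult)
    qed
    have kn': "exp (k * x) * (2 * pi) * ((norm (fps_nth A n))\<^sup>2 * \<rho> ^ (2 * n)) =
      2 * pi * (norm (fps_nth A n))\<^sup>2 * exp ((2 * real n + k) * x)" for n
      unfolding kn[of n, symmetric] by (simp only: mult_ac)
    have "(\<integral>\<^sup>+y. ennreal (indicator (log_strip I) (Complex x y) * ((norm (p (exp (Complex x y))))\<^sup>2 * exp (k * Re (Complex x y)))) \<partial>lborel) =
      (\<integral>\<^sup>+y. ennreal (exp (k * x)) * (ennreal (F y) * indicator {0..2*pi} y) \<partial>lborel)"
      by (rule nn_integral_cong_AE, rule AE_mp[OF AE], rule AE_I2)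
         (use True in \<open>auto simp: log_strip_iff ex F_def indicator_def mult.commute ennreal_mult''\<close>)
    also have "\<dots> = ennreal (exp (k * x)) * (\<integral>\<^sup>+y. ennreal (F y) * indicator {0..2*pi} y \<partial>lborel)"
      by (rule nn_integral_cmult) measurable
    also have "(\<integral>\<^sup>+y. ennreal (F y) * indicator {0..2*pi} y \<partial>lborel) = ennreal (2 * pi * T)"
    proof -
      have "(\<integral>\<^sup>+y. ennreal (indicator {0..2*pi} y * F y) \<partial>lborel) = ennreal (2 * pi * T)"
      proof (rule nn_integral_has_integral_lborel)
        show "(\<lambda>y. indicator {0..2*pi} y * F y) \<in> borel_measurable borel"
          by measurable
        have "((\<lambda>y. if y \<in> {0..2*pi} then F y else 0) has_integral 2 * pi * T) UNIV"
          using F by (simp only: has_integral_restrict_UNIV)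
        then show "((\<lambda>y. indicator {0..2*pi} y * F y) has_integral 2 * pi * T) UNIV"
          by (rule has_integral_eq[rotated]) (auto simp: indicator_def)
      qed (simp add: F_def)
      moreover have "ennreal (indicator {0..2*pi} y * F y) = ennreal (F y) * indicator {0..2*pi} y" for y
        by (simp add: indicator_def)
      ultimately show ?thesis by simp
    qed
    also have "ennreal (exp (k * x)) * ennreal (2 * pi * T) = ennreal (\<Sum>n. 2 * pi * (norm (fps_nth A n))\<^sup>2 * exp ((2 * real n + k) * x))"
    proof -
      have "exp (k * x) * (2 * pi * T) = (\<Sum>n. exp (k * x) * (2 * pi) * ((norm (fps_nth A n))\<^sup>2 * \<rho> ^ (2 * n)))"
        unfolding T_def by (subst suminf_mult[OF sm]) (simp only: mult_ac)
      also have "\<dots> = (\<Sum>n. 2 * pi * (norm (fps_nth A n))\<^sup>2 * exp ((2 * real n + k) * x))"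
        by (simp only: kn')
      finally show ?thesis by (simp only: ennreal_mult'[symmetric] exp_ge_zero)
    qed
    also have "\<dots> = (\<Sum>n. ennreal (2 * pi * (norm (fps_nth A n))\<^sup>2 * exp ((2 * real n + k) * x)))"
    proof (rule suminf_ennreal2[symmetric])
      have "summable (\<lambda>n. exp (k * x) * (2 * pi) * ((norm (fps_nth A n))\<^sup>2 * \<rho> ^ (2 * n)))"
        by (rule summable_mult[OF sm])
      then show "summable (\<lambda>n. 2 * pi * (norm (fps_nth A n))\<^sup>2 * exp ((2 * real n + k) * x))"
        by (simp only: kn')
    qed auto
    finally show ?thesis using True by (simp add: ennreal_mult'')
  qed
  show ?thesis
    unfolding nn_integral_complex[OF m] inner
    using I by (subst nn_integral_suminf) (auto simp: nn_integral_cmult)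
qed

lemma has_real_derivative_exp_divide:
  fixes c :: real
  assumes "c \<noteq> 0"
  shows "((\<lambda>x. exp (c * x) / c) has_real_derivative exp (c * x)) (at x within S)"
proof -
  have "((\<lambda>x. exp (c * x)) has_real_derivative exp (c * x) * c) (at x within S)"
    by (auto intro!: derivative_eq_intros)
  from DERIV_cdivide[OF this, of c] show ?thesis using assms by simp
qed

lemma nn_integral_exp_interval:
  assumes "c \<noteq> 0" "a \<le> b"
  shows "(\<integral>\<^sup>+x. ennreal (exp (c * x)) * indicator {a<..<b} x \<partial>lborel) = ennreal ((exp (c * b) - exp (c * a)) / c)"
proof -
  have AE: "AE x in lborel. x \<notin> {a, b}"
    by (rule AE_not_in) (rule finite_imp_null_set_lborel, simp)
  have "(\<integral>\<^sup>+x. ennreal (exp (c * x)) * indicator {a<..<b} x \<partial>lborel) =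
     (\<integral>\<^sup>+x. ennreal (exp (c * x)) * indicator {a..b} x \<partial>lborel)"
    by (rule nn_integral_cong_AE, rule AE_mp[OF AE], rule AE_I2) (auto simp: indicator_def)
  also have "\<dots> = ennreal (exp (c * b) / c - exp (c * a) / c)"
  proof (rule nn_integral_FTC_Icc)
    show "(\<lambda>x. exp (c * x)) \<in> borel_measurable borel" by measurable
    show "DERIV (\<lambda>x. exp (c * x) / c) x :> exp (c * x)" for x
      by (rule has_real_derivative_exp_divide[OF assms(1)])
  qed (use assms in auto)
  finally show ?thesis by (simp only: diff_divide_distrib)
qed

lemma nn_integral_exp_lessThan:
  assumes "c > 0"
  shows "(\<integral>\<^sup>+x. ennreal (exp (c * x)) * indicator {..<b} x \<partial>lborel) = ennreal (exp (c * b) / c)"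
proof -
  have AE: "AE x in lborel. x \<notin> {b}"
    by (rule AE_not_in) (rule finite_imp_null_set_lborel, simp)
  have "(\<integral>\<^sup>+x. ennreal (exp (c * x)) * indicator {..<b} x \<partial>lborel) =
     (\<integral>\<^sup>+x. ennreal (exp (c * x)) * indicator {..b} x \<partial>lborel)"
    by (rule nn_integral_cong_AE, rule AE_mp[OF AE], rule AE_I2) (auto simp: indicator_def)
  also have "\<dots> = (\<integral>\<^sup>+x. ennreal (exp (c * (- x))) * indicator {..b} (- x) \<partial>lborel)"
    using nn_integral_real_affine[of "\<lambda>x. ennreal (exp (c * x)) * indicator {..b} x" "-1" 0] by simp
  also have "\<dots> = (\<integral>\<^sup>+x. ennreal (exp (- c * x)) * indicator {-b..} x \<partial>lborel)"
    by (rule nn_integral_cong) (auto simp: indicator_def)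
  also have "\<dots> = ennreal (0 - exp (- c * (- b)) / (- c))"
  proof (rule nn_integral_FTC_atLeast)
    show "((\<lambda>x. exp (- c * x) / (- c)) \<longlongrightarrow> 0) at_top"
    proof -
      have "filterlim (\<lambda>x. - c * x) at_bot at_top"
        using assms by (intro filterlim_tendsto_neg_mult_at_bot[OF tendsto_const] filterlim_ident) auto
      then have "((\<lambda>x. exp (- c * x) / (- c)) \<longlongrightarrow> 0 / (- c)) at_top"
        using assms by (intro tendsto_divide tendsto_const filterlim_compose[OF exp_at_bot]) auto
      then show ?thesis by simp
    qed
    show "(\<lambda>x. exp (- c * x)) \<in> borel_measurable borel" by measurable
    show "DERIV (\<lambda>x. exp (- c * x) / (- c)) x :> exp (- c * x)" for x
      by (rule has_real_derivative_exp_divide) (use assms in simp)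
  qed simp
  finally show ?thesis by simp
qed

section \<open>Area of the image of an annulus\<close>

text \<open>The map h to a h + c cnj (a h) is multiplication by a, of determinant |a|^2, followed by
  v to v + c cnj v, of determinant 1 - |c|^2.\<close>

lemma complex_det_bound_form:
  fixes a c :: complex
  shows "\<bar>Re (a * 1 + c * cnj (a * 1)) * Im (a * \<i> + c * cnj (a * \<i>)) -
     Im (a * 1 + c * cnj (a * 1)) * Re (a * \<i> + c * cnj (a * \<i>))\<bar> = \<bar>1 - (norm c)\<^sup>2\<bar> * (norm a)\<^sup>2"
proof -
  have "Re (a * 1 + c * cnj (a * 1)) * Im (a * \<i> + c * cnj (a * \<i>)) -
     Im (a * 1 + c * cnj (a * 1)) * Re (a * \<i> + c * cnj (a * \<i>)) = (1 - (norm c)\<^sup>2) * (norm a)\<^sup>2"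
    unfolding cmod_power2 by simp algebra
  then show ?thesis by (simp add: abs_mult)
qed

text \<open>Injectivity turns the integral of the Jacobian into the measure of the image, which is
  open by invariance of domain and lies in a disc of area \<pi> R^2.\<close>

lemma measure_image_le:
  fixes \<Psi> :: "complex \<Rightarrow> complex"
  assumes S: "open S" and cont: "continuous_on S \<Psi>" and inj: "inj_on \<Psi> S"
    and der: "\<And>z. z \<in> S \<Longrightarrow> (\<Psi> has_derivative \<Psi>' z) (at z within S)"
    and J: "\<And>z. z \<in> S \<Longrightarrow> J z = \<bar>Re (\<Psi>' z 1) * Im (\<Psi>' z \<i>) - Im (\<Psi>' z 1) * Re (\<Psi>' z \<i>)\<bar>"
    and contJ: "continuous_on S J"
    and R: "\<Psi> ` S \<subseteq> cball 0 R" "R \<ge> 0"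
  shows "(\<integral>\<^sup>+z. ennreal (indicator S z * J z) \<partial>lborel) \<le> ennreal (pi * R\<^sup>2)"
proof -
  have op: "open (\<Psi> ` S)" by (rule invariance_of_domain[OF cont S inj])
  have em: "emeasure lborel (\<Psi> ` S) \<le> ennreal (pi * R\<^sup>2)"
  proof -
    have "emeasure lborel (\<Psi> ` S) \<le> emeasure lborel (cball (0::complex) R)"
      by (rule emeasure_mono[OF R(1)]) simp
    also have "\<dots> = ennreal (pi * R\<^sup>2)"
      using emeasure_cball[OF R(2), of "0::complex"] by (simp add: unit_ball_vol_2)
    finally show ?thesis .
  qed
  then have fin: "emeasure lborel (\<Psi> ` S) < \<infinity>" by (rule le_less_trans) simp
  have int: "set_integrable lborel (\<Psi> ` S) (\<lambda>_. 1 :: real)"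
    unfolding set_integrable_def using fin op by simp
  have Jm: "(\<lambda>z. indicator S z * (J z * 1)) \<in> borel_measurable borel"
    using borel_measurable_continuous_on_indicator[OF _ contJ] S by simp
  have S': "S \<in> sets borel" "\<Psi> ` S \<in> sets borel" using S op by auto
  note cv = change_of_variables_complex[OF S' der inj J _ Jm int]
  have "set_integrable lborel S (\<lambda>z. J z * 1)"
    by (rule cv) (use S' in auto)
  then have i1: "integrable lborel (\<lambda>z. indicator S z * J z)" by (simp add: set_integrable_def)
  have "(LINT z:S|lborel. J z * 1) = (LINT w:\<Psi> ` S|lborel. 1)"
    by (rule cv) (use S' in auto)
  then have i2: "integral\<^sup>L lborel (\<lambda>z. indicator S z * J z) = measure lborel (\<Psi> ` S)"
    using S' by (simp add: set_lebesgue_integral_def)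
  have "(\<integral>\<^sup>+z. ennreal (indicator S z * J z) \<partial>lborel) = ennreal (measure lborel (\<Psi> ` S))"
    unfolding i2[symmetric]
    by (rule nn_integral_eq_integral[OF i1]) (auto simp: indicator_def J)
  also have "\<dots> = emeasure lborel (\<Psi> ` S)"
    using fin by (intro emeasure_eq_ennreal_measure[symmetric]) auto
  finally show ?thesis using em by simp
qed

text \<open>Both sides are areas divided by \<pi>: on the left that of the image of the annulus,
  evaluated by Parseval and cut off after N, on the right that of a disc containing the image. The
  parameter c is kept free so that it can be chosen to round off the image of the inner
  circle.\<close>

lemma area_inequality_annulus:
  assumes B: "disc_expansion g B" and inj: "inj_on (\<lambda>z. 1 / z - g z) (unit_disc - {0})"
    and sr: "0 < s" "s < r" "r < 1" and c: "norm c < 1"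
    and R: "\<And>z. s < norm z \<Longrightarrow> norm z < r \<Longrightarrow> norm ((1 / z - g z) + c * cnj (1 / z - g z)) \<le> R"
  shows "(1 - (norm c)\<^sup>2) * ((1 / s\<^sup>2 - 1 / r\<^sup>2) + (\<Sum>n\<le>N. real n * (norm (fps_nth B n))\<^sup>2 * (r ^ (2 * n) - s ^ (2 * n)))) \<le> R\<^sup>2"
proof -
  define I where "I = {ln s<..<ln r}"
  define S where "S = log_strip I"
  define \<Psi> where "\<Psi> u = (1 / exp u - g (exp u)) + c * cnj (1 / exp u - g (exp u))" for u
  define a where "a u = (- 1 / (exp u)\<^sup>2 - deriv g (exp u)) * exp u" for u
  define \<Psi>' where "\<Psi>' u h = a u * h + c * cnj (a u * h)" for u h
  \<comment> \<open>The derivative of 1/z - g is - p / z^2. Since p has no linear term, the exponent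
    2 n - 2 = 0, whose integral would be ln (r / s), contributes nothing.\<close>
  define p where "p z = 1 + z\<^sup>2 * deriv g z" for z
  define P where "P = 1 + fps_X ^ 2 * fps_deriv B"
  define q where "q = 1 - (norm c)\<^sup>2"
  have q: "q > 0" using c by (simp add: q_def abs_square_less_1)
  have I0: "I \<subseteq> {..<0}" using sr by (auto simp: I_def intro: less_trans[of _ "ln r"])
  have rng: "s < norm (exp u) \<and> norm (exp u) < r" if "u \<in> S" for u
  proof -
    have "ln s < Re u" "Re u < ln r" using that by (auto simp: S_def log_strip_def I_def)
    then have "exp (ln s) < exp (Re u)" "exp (Re u) < exp (ln r)" by simp_all
    then show ?thesis using sr by simp
  qed
  have expS: "exp u \<in> unit_disc" "exp u \<noteq> 0" if "u \<in> S" for u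
    using rng[OF that] sr by (auto simp del: norm_exp_eq_Re)
  have holg: "g holomorphic_on unit_disc" using B by (simp add: disc_expansion_def)
  have derG: "((\<lambda>u. 1 / exp u - g (exp u)) has_field_derivative a u) (at u)" if "u \<in> S" for u
  proof -
    have "(g has_field_derivative deriv g (exp u)) (at (exp u))"
      using holomorphic_derivI[OF holg _ expS(1)[OF that]] by simp
    then have 1: "((\<lambda>u. g (exp u)) has_field_derivative deriv g (exp u) * exp u) (at u)"
      by (rule DERIV_chain2) (rule DERIV_exp)
    have 2: "((\<lambda>u. inverse (exp u)) has_field_derivative - (exp u * inverse ((exp u)\<^sup>2))) (at u)"
      using DERIV_inverse_fun[OF DERIV_exp, of u] by (simp add: numeral_2_eq_2)
    show ?thesis
      using DERIV_diff[OF 2 1] by (simp add: a_def inverse_eq_divide left_diff_distrib)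
  qed
  have der: "(\<Psi> has_derivative \<Psi>' u) (at u within S)" if "u \<in> S" for u
  proof -
    have "((\<lambda>u. 1 / exp u - g (exp u)) has_derivative (*) (a u)) (at u within S)"
      using derG[OF that] by (simp add: has_field_derivative_def has_derivative_at_withinI)
    from has_derivative_add[OF this has_derivative_mult_right[OF bounded_linear.has_derivative[OF bounded_linear_cnj this]]]
    show ?thesis unfolding \<Psi>_def \<Psi>'_def .
  qed
  have S: "open S" unfolding S_def I_def by (rule open_log_strip) simp
  have injS: "inj_on \<Psi> S"
  proof (rule inj_onI)
    fix u v assume uv: "u \<in> S" "v \<in> S" "\<Psi> u = \<Psi> v"
    define d where "d = (1 / exp u - g (exp u)) - (1 / exp v - g (exp v))"
    \<comment> \<open>The real-linear map v to v + c cnj v is injective because |c| < 1.\<close>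
    have "d = - (c * cnj d)" using uv(3) by (simp add: \<Psi>_def d_def algebra_simps)
    then have "norm d = norm c * norm d" by (metis norm_minus_cancel norm_mult complex_mod_cnj)
    then have "d = 0" using c by auto
    then have "exp u = exp v"
      using inj uv expS by (auto simp: d_def dest: inj_onD)
    then show "u = v" using inj_on_exp_log_strip[of I] uv by (auto simp: S_def dest: inj_onD)
  qed
  define J where "J u = q * ((norm (p (exp u)))\<^sup>2 * exp (-2 * Re u))" for u
  have Jeq: "J u = \<bar>Re (\<Psi>' u 1) * Im (\<Psi>' u \<i>) - Im (\<Psi>' u 1) * Re (\<Psi>' u \<i>)\<bar>" if "u \<in> S" for u
  proof -
    have "a u = - p (exp u) / exp u"
      by (simp add: a_def p_def field_simps power2_eq_square)
    then have "(norm (a u))\<^sup>2 = (norm (p (exp u)))\<^sup>2 / (exp (Re u))\<^sup>2"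
      by (simp add: norm_divide power_divide)
    also have "\<dots> = (norm (p (exp u)))\<^sup>2 * exp (-2 * Re u)"
      by (simp add: exp_minus divide_inverse flip: exp_double)
    finally have "(norm (a u))\<^sup>2 = (norm (p (exp u)))\<^sup>2 * exp (-2 * Re u)" .
    then show ?thesis
      using q unfolding \<Psi>'_def complex_det_bound_form J_def q_def by simp
  qed
  have Pexp: "disc_expansion p P"
    unfolding p_def P_def fps_const_1_eq_1[symmetric]
    by (intro disc_expansion_add disc_expansion_mult disc_expansion_const disc_expansion_power disc_expansion_X disc_expansion_deriv B)
  have contJ: "continuous_on S J"
  proof -
    have "continuous_on unit_disc p" using Pexp by (simp add: disc_expansion_def holomorphic_on_imp_continuous_on)
    then have "continuous_on S (\<lambda>u. p (exp u))"
      by (rule continuous_on_compose2) (auto intro!: continuous_intros dest: expS)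
    then show ?thesis unfolding J_def by (intro continuous_intros)
  qed
  have "R \<ge> 0"
  proof -
    have "s < norm (complex_of_real ((s + r) / 2))" "norm (complex_of_real ((s + r) / 2)) < r"
      using sr unfolding norm_of_real by auto
    from R[OF this] show ?thesis by (rule order_trans[OF norm_ge_zero])
  qed
  have "(\<integral>\<^sup>+u. ennreal (indicator S u * J u) \<partial>lborel) \<le> ennreal (pi * R\<^sup>2)"
  proof (rule measure_image_le[OF S _ injS der Jeq contJ _ \<open>R \<ge> 0\<close>])
    show "continuous_on S \<Psi>" using der by (rule has_derivative_continuous_on)
    show "\<Psi> ` S \<subseteq> cball 0 R" using R rng by (auto simp: \<Psi>_def)
  qed
  also have "(\<integral>\<^sup>+u. ennreal (indicator S u * J u) \<partial>lborel) =
     ennreal q * (\<integral>\<^sup>+u. ennreal (indicator (log_strip I) u * ((norm (p (exp u)))\<^sup>2 * exp (-2 * Re u))) \<partial>lborel)"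
  proof -
    have m: "(\<lambda>u. ennreal (indicator S u * J u)) \<in> borel_measurable borel"
      using borel_measurable_continuous_on_indicator[OF _ contJ] S by (intro measurable_compose[OF _ measurable_ennreal]) auto
    have "(\<integral>\<^sup>+u. ennreal (1/q) * ennreal (indicator S u * J u) \<partial>lborel) = ennreal (1/q) * (\<integral>\<^sup>+u. ennreal (indicator S u * J u) \<partial>lborel)"
      using m by (intro nn_integral_cmult) simp
    moreover have "ennreal (1/q) * ennreal (indicator S u * J u) =
      ennreal (indicator (log_strip I) u * ((norm (p (exp u)))\<^sup>2 * exp (-2 * Re u)))" for u
      using q by (subst ennreal_mult'[symmetric]) (auto simp: J_def S_def)
    ultimately have *: "(\<integral>\<^sup>+u. ennreal (indicator (log_strip I) u * ((norm (p (exp u)))\<^sup>2 * exp (-2 * Re u))) \<partial>lborel) =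
       ennreal (1/q) * (\<integral>\<^sup>+u. ennreal (indicator S u * J u) \<partial>lborel)" by simp
    have "ennreal q * ennreal (1/q) = 1" using q by (simp add: ennreal_mult'[symmetric])
    then show ?thesis unfolding * by (simp add: mult.assoc[symmetric])
  qed
  also have "(\<integral>\<^sup>+u. ennreal (indicator (log_strip I) u * ((norm (p (exp u)))\<^sup>2 * exp (-2 * Re u))) \<partial>lborel) =
    (\<Sum>n. ennreal (2 * pi * (norm (fps_nth P n))\<^sup>2) * (\<integral>\<^sup>+x. ennreal (exp ((2 * real n + -2) * x)) * indicator I x \<partial>lborel))"
    using I0 by (intro nn_integral_log_strip[OF Pexp]) (auto simp: I_def)
  finally have up: "ennreal q * (\<Sum>n. ennreal (2 * pi * (norm (fps_nth P n))\<^sup>2) * (\<integral>\<^sup>+x. ennreal (exp ((2 * real n + -2) * x)) * indicator I x \<partial>lborel)) \<le> ennreal (pi * R\<^sup>2)" .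
  have low: "ennreal q * ennreal (pi * ((1 / s\<^sup>2 - 1 / r\<^sup>2) + (\<Sum>n\<le>N. real n * (norm (fps_nth B n))\<^sup>2 * (r ^ (2 * n) - s ^ (2 * n))))) \<le> ennreal q * (\<Sum>n. ennreal (2 * pi * (norm (fps_nth P n))\<^sup>2) * (\<integral>\<^sup>+x. ennreal (exp ((2 * real n + -2) * x)) * indicator I x \<partial>lborel))"
  proof (rule mult_left_mono)
    \<comment> \<open>\<open>t n\<close> is the contribution of coefficient n of \<open>P\<close>:
      the pole for n = 0, nothing for n = 1, and m B_m for n = m + 1, hence the shift by one against
      \<open>B\<close>.\<close>
    define t where "t n = (if n = 0 then pi * (1 / s\<^sup>2 - 1 / r\<^sup>2) else pi * (real (n - 1) * (norm (fps_nth B (n - 1)))\<^sup>2 * (r ^ (2 * (n - 1)) - s ^ (2 * (n - 1)))))" for n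
    have lnsr: "ln s \<le> ln r" using sr by simp
    have tn: "ennreal (t n) = ennreal (2 * pi * (norm (fps_nth P n))\<^sup>2) * (\<integral>\<^sup>+x. ennreal (exp ((2 * real n + -2) * x)) * indicator I x \<partial>lborel)"
      and t0: "t n \<ge> 0" for n
    proof -
      consider "n = 0" | "n = 1" | m where "n = Suc m" "m > 0" by (cases n; cases "n - 1") auto
      then have "ennreal (t n) = ennreal (2 * pi * (norm (fps_nth P n))\<^sup>2) * (\<integral>\<^sup>+x. ennreal (exp ((2 * real n + -2) * x)) * indicator I x \<partial>lborel) \<and> t n \<ge> 0"
      proof cases
        case 1
        have e: "exp (- (2 * ln x)) = 1 / x\<^sup>2" if "x > 0" for x :: real
          using that by (simp add: exp_minus exp_double divide_inverse)
        have le: "1 / r\<^sup>2 \<le> 1 / s\<^sup>2" using sr by (intro divide_left_mono power_mono) auto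
        have "(\<integral>\<^sup>+x. ennreal (exp (-2 * x)) * indicator I x \<partial>lborel) = ennreal ((1 / s\<^sup>2 - 1 / r\<^sup>2) / 2)"
          unfolding I_def using nn_integral_exp_interval[OF _ lnsr, of "-2"] sr
          by (simp add: e minus_divide_left)
        then show ?thesis
          using 1 le by (simp add: t_def P_def ennreal_mult'[symmetric])
      next
        case 2
        have "fps_nth P 1 = 0" by (simp add: P_def fps_X_power_mult_nth)
        then show ?thesis using 2 by (simp add: t_def)
      next
        case (3 m)
        have e: "exp (2 * real m * ln x) = x ^ (2 * m)" if "x > 0" for x :: real
          using that exp_of_nat_mult[of "2 * m" "ln x"] by simp
        have le: "s ^ (2 * m) \<le> r ^ (2 * m)" using sr by (intro power_mono) auto
        have "fps_nth P n = of_nat m * fps_nth B m"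
          using 3 by (simp add: P_def fps_X_power_mult_nth of_nat_diff del: of_nat_Suc flip: of_nat_Suc)
        then have Pn: "(norm (fps_nth P n))\<^sup>2 = (real m)\<^sup>2 * (norm (fps_nth B m))\<^sup>2"
          by (simp add: norm_mult power_mult_distrib)
        have "(2 * real n + -2) = 2 * real m" using 3 by simp
        then have "(\<integral>\<^sup>+x. ennreal (exp ((2 * real n + -2) * x)) * indicator I x \<partial>lborel) = ennreal ((r ^ (2 * m) - s ^ (2 * m)) / (2 * real m))"
          unfolding I_def using nn_integral_exp_interval[OF _ lnsr, of "2 * real m"] sr 3 by (simp add: e)
        then have "ennreal (2 * pi * (norm (fps_nth P n))\<^sup>2) * (\<integral>\<^sup>+x. ennreal (exp ((2 * real n + -2) * x)) * indicator I x \<partial>lborel) =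
           ennreal (2 * pi * ((real m)\<^sup>2 * (norm (fps_nth B m))\<^sup>2) * ((r ^ (2 * m) - s ^ (2 * m)) / (2 * real m)))"
          unfolding Pn by (simp only: ennreal_mult' flip: ) (use le in \<open>simp add: ennreal_mult'[symmetric]\<close>)
        also have "2 * pi * ((real m)\<^sup>2 * (norm (fps_nth B m))\<^sup>2) * ((r ^ (2 * m) - s ^ (2 * m)) / (2 * real m)) = t n"
          using 3 by (simp add: t_def power2_eq_square)
        finally show ?thesis using 3 le by (auto simp: t_def intro!: mult_nonneg_nonneg)
      qed
      then show "ennreal (t n) = ennreal (2 * pi * (norm (fps_nth P n))\<^sup>2) * (\<integral>\<^sup>+x. ennreal (exp ((2 * real n + -2) * x)) * indicator I x \<partial>lborel)"
        and "t n \<ge> 0" by auto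
    qed
    have "pi * ((1 / s\<^sup>2 - 1 / r\<^sup>2) + (\<Sum>n\<le>N. real n * (norm (fps_nth B n))\<^sup>2 * (r ^ (2 * n) - s ^ (2 * n)))) = (\<Sum>n<Suc (Suc N). t n)"
      unfolding sum.lessThan_Suc_shift lessThan_Suc_atMost[symmetric] by (simp add: t_def distrib_left sum_distrib_left)
    then have "ennreal (pi * ((1 / s\<^sup>2 - 1 / r\<^sup>2) + (\<Sum>n\<le>N. real n * (norm (fps_nth B n))\<^sup>2 * (r ^ (2 * n) - s ^ (2 * n))))) = (\<Sum>n<Suc (Suc N). ennreal (t n))"
      using t0 by (simp only: sum_ennreal)
    also have "\<dots> \<le> (\<Sum>n. ennreal (t n))" by (rule sum_le_suminf) auto
    finally show "ennreal (pi * ((1 / s\<^sup>2 - 1 / r\<^sup>2) + (\<Sum>n\<le>N. real n * (norm (fps_nth B n))\<^sup>2 * (r ^ (2 * n) - s ^ (2 * n))))) \<le>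
      (\<Sum>n. ennreal (2 * pi * (norm (fps_nth P n))\<^sup>2) * (\<integral>\<^sup>+x. ennreal (exp ((2 * real n + -2) * x)) * indicator I x \<partial>lborel))"
      by (simp only: tn)
  qed simp
  from order_trans[OF low up] have "ennreal (q * (pi * ((1 / s\<^sup>2 - 1 / r\<^sup>2) + (\<Sum>n\<le>N. real n * (norm (fps_nth B n))\<^sup>2 * (r ^ (2 * n) - s ^ (2 * n)))))) \<le> ennreal (pi * R\<^sup>2)"
    using q by (simp add: ennreal_mult')
  then have "q * (pi * ((1 / s\<^sup>2 - 1 / r\<^sup>2) + (\<Sum>n\<le>N. real n * (norm (fps_nth B n))\<^sup>2 * (r ^ (2 * n) - s ^ (2 * n))))) \<le> pi * R\<^sup>2"
    by (simp add: ennreal_le_iff)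
  then have "pi * (q * ((1 / s\<^sup>2 - 1 / r\<^sup>2) + (\<Sum>n\<le>N. real n * (norm (fps_nth B n))\<^sup>2 * (r ^ (2 * n) - s ^ (2 * n))))) \<le> pi * R\<^sup>2"
    by (simp only: mult_ac)
  then show ?thesis by (simp add: q_def)
qed

text \<open>Shifting twice writes g - B_1 z as z^2 v, and v is bounded on a compact disc.\<close>

lemma disc_expansion_second_order:
  assumes B: "disc_expansion g B" and B0: "fps_nth B 0 = 0" and r: "0 \<le> r" "r < 1"
  obtains C where "C \<ge> 0" "\<And>z. norm z \<le> r \<Longrightarrow> norm (g z - fps_nth B 1 * z) \<le> C * (norm z)\<^sup>2"
proof -
  obtain u where u: "disc_expansion u (fps_shift 1 B)" and gu: "\<And>z. norm z < 1 \<Longrightarrow> g z = fps_nth B 0 + z * u z"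
    by (rule disc_expansion_shift[OF B]) blast
  obtain v where v: "disc_expansion v (fps_shift 1 (fps_shift 1 B))"
    and uv: "\<And>z. norm z < 1 \<Longrightarrow> u z = fps_nth (fps_shift 1 B) 0 + z * v z"
    by (rule disc_expansion_shift[OF u]) blast
  have cv: "continuous_on unit_disc v" using v by (simp add: disc_expansion_def holomorphic_on_imp_continuous_on)
  have "continuous_on (cball 0 r) v"
    by (rule continuous_on_subset[OF cv]) (use r in auto)
  then have "bounded (v ` cball 0 r)"
    by (rule compact_imp_bounded[OF compact_continuous_image]) simp
  then obtain C where "\<forall>y\<in>v ` cball 0 r. norm y \<le> C" unfolding bounded_iff by blast
  then have C: "\<And>z. z \<in> cball 0 r \<Longrightarrow> norm (v z) \<le> C" by blast
  have C0: "C \<ge> 0" by (rule order_trans[OF norm_ge_zero C[of 0]]) (use r in simp)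
  show ?thesis
  proof (rule that[OF C0])
    fix z :: complex assume z: "norm z \<le> r"
    have "g z - fps_nth B 1 * z = z\<^sup>2 * v z"
    proof -
      have "g z = z * u z" "u z = fps_nth B 1 + z * v z" using gu[of z] uv[of z] z r B0 by simp_all
      then show ?thesis by (simp only:) (simp add: power2_eq_square algebra_simps)
    qed
    then have "norm (g z - fps_nth B 1 * z) = (norm z)\<^sup>2 * norm (v z)" by (simp add: norm_mult norm_power)
    also have "\<dots> \<le> (norm z)\<^sup>2 * C" using C z by (intro mult_left_mono) auto
    finally show "norm (g z - fps_nth B 1 * z) \<le> C * (norm z)\<^sup>2" by (simp add: mult.commute)
  qed
qed

lemma norm_diff4:
  fixes a b c d e :: "'a::real_normed_vector"
  shows "norm (a - b - c - d - e) \<le> norm a + norm b + norm c + norm d + norm e"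
proof -
  have "norm (a - b - c - d - e) \<le> norm (a - b - c - d) + norm e" by (rule norm_triangle_ineq4)
  moreover have "norm (a - b - c - d) \<le> norm (a - b - c) + norm d" by (rule norm_triangle_ineq4)
  moreover have "norm (a - b - c) \<le> norm (a - b) + norm c" by (rule norm_triangle_ineq4)
  moreover have "norm (a - b) \<le> norm a + norm b" by (rule norm_triangle_ineq4)
  ultimately show ?thesis by linarith
qed

text \<open>For \<rho> \<le> 2 s the drop of 1/\<rho> below 1/s outweighs the \<beta> term, leaving
  only the D term; beyond 2 s the term 1/\<rho> is at most half of 1/s, and the other terms fit into
  the rest. An error of order s^2 is essential, since squaring the radius multiplies it by
  2/s.\<close>

lemma circle_image_radius_bound:
  fixes s \<rho> \<beta> D :: real
  assumes s: "0 < s" "s < \<rho>" "\<rho> < 1" and nn: "\<beta> \<ge> 0" "D \<ge> 0"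
    and small: "4 * \<beta> * s\<^sup>2 \<le> 1" "2 * s * (\<beta> + D) \<le> 1"
  shows "1 / \<rho> + \<beta> * (\<rho> - s\<^sup>2 / \<rho>) + D * \<rho>\<^sup>2 \<le> 1 / s + 4 * D * s\<^sup>2"
proof (cases "\<rho> \<le> 2 * s")
  case True
  have "(\<rho> - s) * ((\<rho> + s) / \<rho>) = (\<rho> * \<rho> - s\<^sup>2) / \<rho>" by (simp add: algebra_simps power2_eq_square)
  then have "\<rho> - s\<^sup>2 / \<rho> = (\<rho> - s) * ((\<rho> + s) / \<rho>)" using s by (simp add: diff_divide_distrib)
  also have "\<dots> \<le> (\<rho> - s) * 2" using s by (intro mult_left_mono) (auto simp: pos_divide_le_eq)
  finally have "\<beta> * (\<rho> - s\<^sup>2 / \<rho>) \<le> \<beta> * ((\<rho> - s) * 2)" using nn by (intro mult_left_mono) auto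
  moreover have "1 / s - 1 / \<rho> \<ge> \<beta> * ((\<rho> - s) * 2)"
  proof -
    have "2 * \<beta> * (s * \<rho>) \<le> 2 * \<beta> * (s * (2 * s))" using True s nn by (intro mult_left_mono) auto
    also have "\<dots> \<le> 1" using small(1) by (simp add: power2_eq_square)
    finally have "(\<rho> - s) * (2 * \<beta> * (s * \<rho>)) \<le> (\<rho> - s) * 1" using s by (intro mult_left_mono) auto
    moreover have "1 / s - 1 / \<rho> = (\<rho> - s) / (s * \<rho>)" using s by (simp add: diff_divide_distrib)
    moreover have "(\<rho> - s) * (2 * \<beta>) * (s * \<rho>) \<le> \<rho> - s \<Longrightarrow> (\<rho> - s) * (2 * \<beta>) \<le> (\<rho> - s) / (s * \<rho>)"
      using s by (simp add: pos_le_divide_eq)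
    ultimately show ?thesis by (simp only: mult_ac mult_1)
  qed
  moreover have "D * \<rho>\<^sup>2 \<le> D * (2 * s)\<^sup>2" using True s nn by (intro mult_left_mono power_mono) auto
  moreover have "D * (2 * s)\<^sup>2 = 4 * D * s\<^sup>2" by (simp add: power2_eq_square)
  ultimately show ?thesis by linarith
next
  case False
  have "1 / \<rho> \<le> 1 / (2 * s)" using False s by (intro divide_left_mono) auto
  moreover have "\<beta> * (\<rho> - s\<^sup>2 / \<rho>) \<le> \<beta> * 1" 
  proof (rule mult_left_mono)
    have "0 \<le> s\<^sup>2 / \<rho>" using s by simp
    then show "\<rho> - s\<^sup>2 / \<rho> \<le> 1" using s by linarith
  qed (use nn in auto)
  moreover have "D * \<rho>\<^sup>2 \<le> D * 1" using s nn by (intro mult_left_mono power_le_one) auto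
  moreover have "\<beta> + D \<le> 1 / (2 * s)" using small(2) s by (simp add: pos_le_divide_eq mult.commute)
  moreover have "1 / s = 2 * (1 / (2 * s))" using s by simp
  moreover have "0 \<le> 4 * D * s\<^sup>2" using nn by simp
  ultimately show ?thesis by linarith
qed

text \<open>The image of the circle of radius \<open>s\<close> under \<open>1/z - g z\<close> is nearly an ellipse; adding \<open>c\<close> times the
  conjugate with \<open>c = b s^2\<close>, \<open>b = g'(0)\<close>, makes it a disc up to higher order in \<open>s\<close>, so that the area it encloses can
  be bounded by that of a disc and \<open>s\<close> can tend to \<open>0\<close>.\<close>
lemma area_theorem_radius:
  assumes B: "disc_expansion g B" and B0: "fps_nth B 0 = 0"
    and inj: "inj_on (\<lambda>z. 1 / z - g z) (unit_disc - {0})" and r: "0 < r" "r < 1"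
  shows "(\<Sum>n\<le>N. real n * (norm (fps_nth B n))\<^sup>2 * r ^ (2 * n)) \<le> 1 / r\<^sup>2"
proof -
  define b where "b = fps_nth B 1"
  define \<beta> where "\<beta> = norm b"
  obtain C where C: "C \<ge> 0" "\<And>z. norm z \<le> r \<Longrightarrow> norm (g z - b * z) \<le> C * (norm z)\<^sup>2"
    using disc_expansion_second_order[OF B B0, of r] r unfolding b_def by auto
  define D where "D = C * (1 + \<beta>)"
  define E where "E = \<beta>\<^sup>2 + 4 * D"
  have \<beta>: "\<beta> \<ge> 0" "D \<ge> 0" using C by (auto simp: \<beta>_def D_def)
  \<comment> \<open>\<open>X\<close> is the part of the area inequality that stays bounded as s
    tends to 0; the term 1/s^2 cancels against the square of the radius.\<close>
  define X where "X s = - (1 / r\<^sup>2) + (\<Sum>n\<le>N. real n * (norm (fps_nth B n))\<^sup>2 * (r ^ (2 * n) - s ^ (2 * n)))" for s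
  have step: "X s \<le> 2 * E * s + E\<^sup>2 * s ^ 4 + \<beta>\<^sup>2 * s\<^sup>2 + \<beta>\<^sup>2 * s ^ 4 * X s"
    if s: "0 < s" "s < r" and small: "4 * \<beta> * s\<^sup>2 \<le> 1" "2 * s * (\<beta> + D) \<le> 1" for s
  proof -
    define c where "c = b * of_real (s\<^sup>2)"
    have nc: "norm c = \<beta> * s\<^sup>2" by (simp add: c_def norm_mult \<beta>_def norm_power)
    have c1: "norm c < 1" using small(1) unfolding nc by simp
    have s1: "s\<^sup>2 \<le> 1" using s r by (simp add: power_le_one)
    have "(1 - (norm c)\<^sup>2) * ((1 / s\<^sup>2 - 1 / r\<^sup>2) + (\<Sum>n\<le>N. real n * (norm (fps_nth B n))\<^sup>2 * (r ^ (2 * n) - s ^ (2 * n)))) \<le> (1 / s + E * s\<^sup>2)\<^sup>2"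
    proof (rule area_inequality_annulus[OF B inj s r(2) c1])
      fix z :: complex assume z: "s < norm z" "norm z < r"
      define \<rho> where "\<rho> = norm z"
      have \<rho>: "s < \<rho>" "\<rho> < r" "\<rho> < 1" "0 < \<rho>" using z s r by (auto simp: \<rho>_def)
      define e where "e = g z - b * z"
      have e: "norm e \<le> C * \<rho>\<^sup>2" using C(2)[of z] z by (simp add: e_def \<rho>_def)
      have z0: "z \<noteq> 0" using \<rho> by (auto simp: \<rho>_def)
      have inv: "cnj (1 / z) = z / of_real (\<rho>\<^sup>2)"
        using z0 by (simp only: \<rho>_def complex_norm_square) (simp add: field_simps)
      \<comment> \<open>Since cnj (1/z) = z / \<rho>^2, the added term c cnj (1/z) reduces - b z to
        - b z (1 - s^2 / \<rho>^2), which vanishes on the inner circle.\<close>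
      have "(1 / z - g z) + c * cnj (1 / z - g z) =
        1 / z - b * z * of_real (1 - s\<^sup>2 / \<rho>\<^sup>2) - c * cnj (b * z) - e - c * cnj e"
        using z0 by (simp add: e_def algebra_simps inv[simplified] c_def)
      also have "norm \<dots> \<le> norm (1 / z) + norm (b * z * of_real (1 - s\<^sup>2 / \<rho>\<^sup>2)) + norm (c * cnj (b * z)) + norm e + norm (c * cnj e)"
        by (rule norm_diff4)
      also have "\<dots> \<le> 1 / \<rho> + \<beta> * (\<rho> - s\<^sup>2 / \<rho>) + \<beta>\<^sup>2 * s\<^sup>2 + C * \<rho>\<^sup>2 + \<beta> * C * \<rho>\<^sup>2"
      proof (intro add_mono)
        show "norm (1 / z) \<le> 1 / \<rho>" by (simp add: \<rho>_def norm_divide)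
        have "s\<^sup>2 / \<rho>\<^sup>2 \<le> 1" using \<rho> s by (simp add: power_mono)
        then have "norm (b * z * of_real (1 - s\<^sup>2 / \<rho>\<^sup>2)) = \<beta> * \<rho> * (1 - s\<^sup>2 / \<rho>\<^sup>2)"
          unfolding norm_mult norm_of_real by (simp add: \<beta>_def \<rho>_def)
        also have "\<dots> = \<beta> * (\<rho> - s\<^sup>2 / \<rho>)" using \<rho> by (simp add: field_simps power2_eq_square)
        finally show "norm (b * z * of_real (1 - s\<^sup>2 / \<rho>\<^sup>2)) \<le> \<beta> * (\<rho> - s\<^sup>2 / \<rho>)" by simp
        have "norm (c * cnj (b * z)) = \<beta>\<^sup>2 * s\<^sup>2 * \<rho>"
          by (simp add: norm_mult nc \<beta>_def \<rho>_def power2_eq_square)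
        also have "\<dots> \<le> \<beta>\<^sup>2 * s\<^sup>2 * 1" using \<rho> by (intro mult_left_mono) auto
        finally show "norm (c * cnj (b * z)) \<le> \<beta>\<^sup>2 * s\<^sup>2" by simp
        show "norm e \<le> C * \<rho>\<^sup>2" by (rule e)
        have "norm (c * cnj e) = \<beta> * s\<^sup>2 * norm e" by (simp add: norm_mult nc)
        also have "\<dots> \<le> \<beta> * 1 * (C * \<rho>\<^sup>2)" using e s1 \<beta> by (intro mult_mono) auto
        finally show "norm (c * cnj e) \<le> \<beta> * C * \<rho>\<^sup>2" by simp
      qed
      also have "\<dots> = (1 / \<rho> + \<beta> * (\<rho> - s\<^sup>2 / \<rho>) + D * \<rho>\<^sup>2) + \<beta>\<^sup>2 * s\<^sup>2"
        by (simp add: D_def algebra_simps)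
      also have "\<dots> \<le> (1 / s + 4 * D * s\<^sup>2) + \<beta>\<^sup>2 * s\<^sup>2"
        using circle_image_radius_bound[OF s(1) \<rho>(1,3) \<beta> small] by simp
      also have "\<dots> = 1 / s + E * s\<^sup>2" by (simp add: E_def algebra_simps)
      finally show "norm ((1 / z - g z) + c * cnj (1 / z - g z)) \<le> 1 / s + E * s\<^sup>2" .
    qed
    then have "(1 - \<beta>\<^sup>2 * s ^ 4) * (1 / s\<^sup>2 + X s) \<le> (1 / s + E * s\<^sup>2)\<^sup>2"
      by (simp add: nc X_def power_mult_distrib algebra_simps)
    moreover have "(1 - \<beta>\<^sup>2 * s ^ 4) * (1 / s\<^sup>2 + X s) = 1 / s\<^sup>2 + X s - \<beta>\<^sup>2 * s\<^sup>2 - \<beta>\<^sup>2 * s ^ 4 * X s"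
      using s by (simp add: field_simps power2_eq_square power4_eq_xxxx)
    moreover have "(1 / s + E * s\<^sup>2)\<^sup>2 = 1 / s\<^sup>2 + 2 * E * s + E\<^sup>2 * s ^ 4"
      using s by (simp add: field_simps power2_eq_square power4_eq_xxxx)
    ultimately show ?thesis by linarith
  qed
  have lim1: "(X \<longlongrightarrow> X 0) (at_right 0)"
    unfolding X_def by (intro tendsto_intros)
  have lim2: "((\<lambda>s. 2 * E * s + E\<^sup>2 * s ^ 4 + \<beta>\<^sup>2 * s\<^sup>2 + \<beta>\<^sup>2 * s ^ 4 * X s) \<longlongrightarrow> 2 * E * 0 + E\<^sup>2 * 0 ^ 4 + \<beta>\<^sup>2 * 0\<^sup>2 + \<beta>\<^sup>2 * 0 ^ 4 * X 0) (at_right 0)"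
    by (intro tendsto_intros lim1)
  have ev: "eventually (\<lambda>s. X s \<le> 2 * E * s + E\<^sup>2 * s ^ 4 + \<beta>\<^sup>2 * s\<^sup>2 + \<beta>\<^sup>2 * s ^ 4 * X s) (at_right 0)"
  proof -
    have "((\<lambda>s. 4 * \<beta> * s\<^sup>2) \<longlongrightarrow> 4 * \<beta> * 0\<^sup>2) (at_right (0::real))" by (intro tendsto_intros)
    then have "eventually (\<lambda>s. 4 * \<beta> * s\<^sup>2 < 1) (at_right (0::real))" by (rule order_tendstoD) simp
    moreover have "((\<lambda>s. 2 * s * (\<beta> + D)) \<longlongrightarrow> 2 * 0 * (\<beta> + D)) (at_right (0::real))" by (intro tendsto_intros)
    then have "eventually (\<lambda>s. 2 * s * (\<beta> + D) < 1) (at_right (0::real))" by (rule order_tendstoD) simp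
    moreover have "eventually (\<lambda>s. s \<in> {0<..<r}) (at_right (0::real))" by (rule eventually_at_right_real[OF r(1)])
    ultimately show ?thesis by eventually_elim (rule step; simp)
  qed
  have "X 0 \<le> 2 * E * 0 + E\<^sup>2 * 0 ^ 4 + \<beta>\<^sup>2 * 0\<^sup>2 + \<beta>\<^sup>2 * 0 ^ 4 * X 0"
    by (rule tendsto_le[OF _ lim2 lim1 ev]) simp
  then have "X 0 \<le> 0" by simp
  moreover have "X 0 = - (1 / r\<^sup>2) + (\<Sum>n\<le>N. real n * (norm (fps_nth B n))\<^sup>2 * r ^ (2 * n))"
    unfolding X_def by (intro arg_cong2[where f = "(+)"] sum.cong refl) (auto simp: power_0_left)
  ultimately show ?thesis by simp
qed

text \<open>Gronwall's theorem, by letting the outer radius tend to 1 in a finite sum.\<close>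

theorem area_theorem:
  assumes B: "disc_expansion g B" and B0: "fps_nth B 0 = 0"
    and inj: "inj_on (\<lambda>z. 1 / z - g z) (unit_disc - {0})"
  shows "(\<Sum>n\<le>N. real n * (norm (fps_nth B n))\<^sup>2) \<le> 1"
proof -
  have "((\<lambda>r. \<Sum>n\<le>N. real n * (norm (fps_nth B n))\<^sup>2 * r ^ (2 * n)) \<longlongrightarrow> (\<Sum>n\<le>N. real n * (norm (fps_nth B n))\<^sup>2 * 1 ^ (2 * n))) (at_left 1)"
    by (intro tendsto_intros)
  moreover have "((\<lambda>r. 1 / r\<^sup>2) \<longlongrightarrow> 1 / 1\<^sup>2) (at_left (1::real))" by (intro tendsto_intros) auto
  moreover have "eventually (\<lambda>r. (\<Sum>n\<le>N. real n * (norm (fps_nth B n))\<^sup>2 * r ^ (2 * n)) \<le> 1 / r\<^sup>2) (at_left (1::real))"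
    by (rule eventually_mono[OF eventually_at_left_real[of 0 1]]) (auto intro: area_theorem_radius[OF assms])
  ultimately have "(\<Sum>n\<le>N. real n * (norm (fps_nth B n))\<^sup>2 * 1 ^ (2 * n)) \<le> 1 / 1\<^sup>2"
    by (intro tendsto_le[of "at_left (1::real)"]) auto
  then show ?thesis by simp
qed

section \<open>The area functional as a power series\<close>

lemma exp_image_log_strip:
  assumes "r > 0"
  shows "exp ` log_strip {..<ln r} = {z \<in> ball 0 r. Im z \<noteq> 0 \<or> Re z < 0}"
proof (intro equalityI subsetI)
  fix z assume "z \<in> exp ` log_strip {..<ln r}"
  then obtain u where u: "z = exp u" "Re u < ln r" "0 < Im u" "Im u < 2 * pi" by (auto simp: log_strip_def)
  have "exp (Re u) < exp (ln r)" using u by simp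
  moreover have "Re z < 0" if "Im z = 0"
  proof -
    have "sin (Im u) = 0" using that u by (simp add: Im_exp)
    then have "Im u = pi"
    proof -
      obtain i :: int where i: "Im u = of_int i * pi" using \<open>sin (Im u) = 0\<close> by (auto simp: sin_zero_iff_int2)
      then have "0 < of_int i * pi" "of_int i * pi < 2 * pi" using u by auto
      then have "0 < (of_int i :: real)" "(of_int i :: real) < 2" by (auto simp: zero_less_mult_iff)
      then have "i = 1" by linarith
      then show ?thesis using i by simp
    qed
    then show ?thesis using u by (simp add: Re_exp)
  qed
  ultimately show "z \<in> {z \<in> ball 0 r. Im z \<noteq> 0 \<or> Re z < 0}" using u assms by auto
next
  fix z assume z: "z \<in> {z \<in> ball 0 r. Im z \<noteq> 0 \<or> Re z < 0}"
  then have z0: "z \<noteq> 0" by auto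
  have nz: "norm z < r" using z by simp
  \<comment> \<open>The logarithm with its cut along the positive axis, so that its imaginary part
    lies strictly between 0 and 2 \<pi> off the cut.\<close>
  define v where "v = Ln (- z) + \<i> * of_real pi"
  have "exp v = z" using z0 by (simp add: v_def exp_add)
  moreover have "Re v < ln r" using z0 nz by (simp add: v_def assms)
  moreover have "0 < Im v" "Im v < 2 * pi"
  proof -
    have "- pi < Im (Ln (- z))" using mpi_less_Im_Ln[of "- z"] z0 by simp
    then show "0 < Im v" by (simp add: v_def)
    have "Im (Ln (- z)) \<noteq> pi"
    proof
      assume "Im (Ln (- z)) = pi"
      then have "Im (- z) = 0" "Re (- z) < 0" using Im_Ln_eq_pi[of "- z"] z0 by auto
      then show False using z by auto
    qed
    moreover have "Im (Ln (- z)) \<le> pi" using Im_Ln_le_pi[of "- z"] z0 by simp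
    ultimately show "Im v < 2 * pi" by (simp add: v_def)
  qed
  ultimately show "z \<in> exp ` log_strip {..<ln r}" by (intro image_eqI[of _ _ v]) (auto simp: log_strip_def)
qed

text \<open>With z = exp u the slit disc becomes a half-strip. The value is computed as a
  nonnegative integral, whose finiteness then provides the summability of the series.\<close>

lemma area_functional_series:
  assumes A: "disc_expansion h A" and r: "0 \<le> r" "r < 1"
  shows "(\<lambda>n. pi * (real n * (norm (fps_nth A n))\<^sup>2 * r ^ (2 * n))) sums area_functional r h"
proof (cases "r = 0")
  \<comment> \<open>The coordinate \<open>ln r\<close> needs r > 0; for r = 0 the ball is empty and
    both sides are 0.\<close>
  case True
  have "(\<lambda>n. pi * (real n * (norm (fps_nth A n))\<^sup>2 * r ^ (2 * n))) = (\<lambda>n. 0)"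
    using True by (auto simp: fun_eq_iff power_0_left)
  then show ?thesis using True by (simp add: area_functional_def set_lebesgue_integral_def)
next
  case False
  with r have r: "0 < r" "r < 1" by auto
  define f where "f z = (norm (deriv h z))\<^sup>2" for z
  have h': "disc_expansion (deriv h) (fps_deriv A)" by (rule disc_expansion_deriv[OF A])
  define S where "S = log_strip {..<ln r}"
  define T where "T = exp ` S"
  have T: "T = {z \<in> ball 0 r. Im z \<noteq> 0 \<or> Re z < 0}" unfolding T_def S_def by (rule exp_image_log_strip[OF r(1)])
  have opS: "open S" unfolding S_def by (rule open_log_strip) simp
  have opT: "open T" unfolding T_def
    by (rule invariance_of_domain[OF _ opS]) (auto intro!: continuous_intros simp: S_def inj_on_exp_log_strip)
  have contf: "continuous_on unit_disc f"
    unfolding f_def using h' by (intro continuous_intros) (simp add: disc_expansion_def holomorphic_on_imp_continuous_on)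
  have subs: "T \<subseteq> ball 0 r" "ball 0 r \<subseteq> cball (0::complex) r" "cball 0 r \<subseteq> unit_disc" using r by (auto simp: T)
  have int: "set_integrable lborel (cball 0 r) f"
    unfolding set_integrable_def
    by (rule borel_integrable_compact) (use continuous_on_subset[OF contf] subs in auto)
  have intb: "set_integrable lborel (ball 0 r) f" by (rule set_integrable_subset[OF int]) (use subs in auto)
  have intT: "set_integrable lborel T f" by (rule set_integrable_subset[OF intb]) (use subs opT in auto)
  have eqT: "area_functional r h = (LINT z:T|lborel. f z)"
  proof -
    \<comment> \<open>The slit that separates \<open>T\<close> from the full disc lies on the real
      axis, a null set.\<close>
    have "negligible {z::complex. z \<bullet> \<i> = 0}" by (rule negligible_standard_hyperplane) (simp add: Basis_complex_def)
    then have "{z::complex. Im z = 0} \<in> null_sets lebesgue" by (simp add: negligible_iff_null_sets)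
    moreover have "{z::complex. Im z = 0} \<in> sets lborel"
    proof -
      have "closed {z::complex. Im z = 0}" by (intro closed_Collect_eq continuous_intros)
      then show ?thesis by simp
    qed
    ultimately have "{z::complex. Im z = 0} \<in> null_sets lborel" by (simp add: null_sets_completion_iff)
    then have AE: "AE z in lborel. z \<notin> {z::complex. Im z = 0}" by (rule AE_not_in)
    have m: "(\<lambda>z. indicat_real (ball 0 r) z *\<^sub>R f z) \<in> borel_measurable lborel"
        "(\<lambda>z. indicat_real T z *\<^sub>R f z) \<in> borel_measurable lborel"
      using intb intT unfolding set_integrable_def by auto
    show ?thesis
      unfolding area_functional_def f_def[symmetric] set_lebesgue_integral_def
      by (rule integral_cong_AE[OF m], rule AE_mp[OF AE], rule AE_I2) (auto simp: T indicator_def)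
  qed
  define J :: "complex \<Rightarrow> real" where "J u = (norm (exp u))\<^sup>2" for u
  have contS: "continuous_on S (\<lambda>u. J u * f (exp u))"
  proof -
    have "exp ` S \<subseteq> unit_disc" using subs unfolding T_def by blast
    then have "continuous_on S (\<lambda>u. f (exp u))"
      by (rule continuous_on_compose2[OF contf continuous_on_exp[OF continuous_on_id]])
    then show ?thesis unfolding J_def by (intro continuous_intros)
  qed
  have Jm: "(\<lambda>z. indicator S z * (J z * f (exp z))) \<in> borel_measurable borel"
    using borel_measurable_continuous_on_indicator[OF _ contS] opS by simp
  have fm: "(\<lambda>w. indicator T w * f w) \<in> borel_measurable borel"
  proof -
    have "T \<subseteq> unit_disc" using subs by blast
    then show ?thesis
      using borel_measurable_continuous_on_indicator[OF _ continuous_on_subset[OF contf], of T] opT by simp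
  qed
  have der: "(exp has_derivative (*) (exp u)) (at u within S)" for u :: complex
    using DERIV_exp[of u] by (simp add: has_field_derivative_def has_derivative_at_withinI)
  have Jeq: "J u = \<bar>Re (exp u * 1) * Im (exp u * \<i>) - Im (exp u * 1) * Re (exp u * \<i>)\<bar>" for u
    unfolding J_def cmod_power2 by (simp add: power2_eq_square)
  have cv1: "set_integrable lborel S (\<lambda>u. J u * f (exp u))"
    by (rule change_of_variables_complex(1)[where g = exp and g' = "\<lambda>u. (*) (exp u)"])
       (use opS opT fm Jm intT inj_on_exp_log_strip der Jeq in \<open>auto simp: T_def S_def\<close>)
  have cv2: "(LINT u:S|lborel. J u * f (exp u)) = (LINT z:T|lborel. f z)"
    unfolding T_def by (rule change_of_variables_complex(2)[where g = exp and g' = "\<lambda>u. (*) (exp u)"])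
       (use opS opT fm Jm intT inj_on_exp_log_strip der Jeq in \<open>auto simp: T_def S_def\<close>)
  have nneg: "area_functional r h \<ge> 0"
    unfolding area_functional_def set_lebesgue_integral_def by (intro integral_nonneg_AE AE_I2) simp
  define t where "t n = pi * (real n * (norm (fps_nth A n))\<^sup>2 * r ^ (2 * n))" for n
  have t0: "t n \<ge> 0" for n using r by (simp add: t_def)
  have "ennreal (area_functional r h) = ennreal (integral\<^sup>L lborel (\<lambda>u. indicator S u *\<^sub>R (J u * f (exp u))))"
    using cv2 eqT by (simp add: set_lebesgue_integral_def)
  also have "\<dots> = (\<integral>\<^sup>+u. ennreal (indicator S u *\<^sub>R (J u * f (exp u))) \<partial>lborel)"
    using cv1 unfolding set_integrable_def
    by (intro nn_integral_eq_integral[symmetric] AE_I2) (auto simp: J_def f_def)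
  also have "\<dots> = (\<integral>\<^sup>+u. ennreal (indicator (log_strip {..<ln r}) u * ((norm (deriv h (exp u)))\<^sup>2 * exp (2 * Re u))) \<partial>lborel)"
    by (intro nn_integral_cong) (simp add: S_def J_def f_def mult.commute flip: exp_double)
  also have "\<dots> = (\<Sum>n. ennreal (2 * pi * (norm (fps_nth (fps_deriv A) n))\<^sup>2) * (\<integral>\<^sup>+x. ennreal (exp ((2 * real n + 2) * x)) * indicator {..<ln r} x \<partial>lborel))"
    using r by (intro nn_integral_log_strip[OF h']) (auto intro: less_trans[of _ "ln r"])
  also have "\<dots> = (\<Sum>n. ennreal (t (Suc n)))"
  proof (rule suminf_cong)
    fix n
    have "exp ((2 * real n + 2) * ln r) = r ^ (2 * Suc n)"
      using r exp_of_nat_mult[of "2 * Suc n" "ln r"] by (simp add: algebra_simps)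
    then have "(\<integral>\<^sup>+x. ennreal (exp ((2 * real n + 2) * x)) * indicator {..<ln r} x \<partial>lborel) = ennreal (r ^ (2 * Suc n) / (2 * real n + 2))"
      using nn_integral_exp_lessThan[of "2 * real n + 2" "ln r"] by simp
    then have "ennreal (2 * pi * (norm (fps_nth (fps_deriv A) n))\<^sup>2) * (\<integral>\<^sup>+x. ennreal (exp ((2 * real n + 2) * x)) * indicator {..<ln r} x \<partial>lborel) =
       ennreal (2 * pi * (norm (fps_nth (fps_deriv A) n))\<^sup>2 * (r ^ (2 * Suc n) / (2 * real n + 2)))"
      by (simp only: ennreal_mult' mult_nonneg_nonneg zero_le_power2 pi_ge_zero zero_le_numeral)
    also have "2 * pi * (norm (fps_nth (fps_deriv A) n))\<^sup>2 * (r ^ (2 * Suc n) / (2 * real n + 2)) = t (Suc n)"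
    proof -
      have "(norm (fps_nth (fps_deriv A) n))\<^sup>2 = (real (Suc n))\<^sup>2 * (norm (fps_nth A (Suc n)))\<^sup>2"
        by (simp add: norm_mult power_mult_distrib del: of_nat_Suc)
      moreover have "2 * real n + 2 = 2 * real (Suc n)" by simp
      ultimately show ?thesis unfolding t_def by (simp add: power2_eq_square del: of_nat_Suc)
    qed
    finally show "ennreal (2 * pi * (norm (fps_nth (fps_deriv A) n))\<^sup>2) * (\<integral>\<^sup>+x. ennreal (exp ((2 * real n + 2) * x)) * indicator {..<ln r} x \<partial>lborel) = ennreal (t (Suc n))" .
  qed
  finally have eq: "(\<Sum>n. ennreal (t (Suc n))) = ennreal (area_functional r h)" by simp
  then have sm: "summable (\<lambda>n. t (Suc n))"
    using t0 by (intro summable_suminf_not_top) auto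
  then have "ennreal (\<Sum>n. t (Suc n)) = ennreal (area_functional r h)"
    using eq t0 by (subst suminf_ennreal2[symmetric]) auto
  then have "(\<Sum>n. t (Suc n)) = area_functional r h"
    using nneg t0 suminf_nonneg[OF sm] by simp
  then have "(\<lambda>n. t (Suc n)) sums area_functional r h" using sm by (simp add: sums_iff)
  then have "t sums (area_functional r h + t 0)" by (rule sums_Suc)
  then show ?thesis by (simp add: t_def[abs_def])
qed

section \<open>Schlicht functions\<close>

definition schlicht :: "(complex \<Rightarrow> complex) \<Rightarrow> complex fps \<Rightarrow> bool" where
  "schlicht f A \<longleftrightarrow> disc_expansion f A \<and> inj_on f unit_disc \<and> fps_nth A 0 = 0 \<and> fps_nth A 1 = 1"

text \<open>f / z has no zero, by injectivity away from 0 and by f'(0) = 1 at 0, so its reciprocal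
  has a holomorphic square root on the disc. For the Koebe function p = 1 - z.\<close>

lemma schlicht_inverse_square:
  assumes "schlicht f A"
  obtains p P where "disc_expansion p P" "fps_nth P 0 = 1" "\<And>z. norm z < 1 \<Longrightarrow> p z \<noteq> 0"
    "\<And>z. norm z < 1 \<Longrightarrow> f z = z / (p z)\<^sup>2"
proof -
  have A: "disc_expansion f A" and inj: "inj_on f unit_disc" and A01: "fps_nth A 0 = 0" "fps_nth A 1 = 1"
    using assms by (auto simp: schlicht_def)
  obtain q where q: "disc_expansion q (fps_shift 1 A)" and fq: "\<And>z. norm z < 1 \<Longrightarrow> f z = fps_nth A 0 + z * q z"
    by (rule disc_expansion_shift[OF A]) blast
  have f0: "f 0 = 0" using disc_expansion_at_0[OF A] A01 by simp
  have q0: "q 0 = 1" using disc_expansion_at_0[OF q] A01 by simp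
  have qnz: "q z \<noteq> 0" if z: "z \<in> unit_disc" for z
  proof (cases "z = 0")
    case False
    then have "f z \<noteq> f 0" using inj_onD[OF inj, of z 0] z by auto
    then show ?thesis using fq[of z] z f0 A01 by auto
  qed (simp add: q0)
  have holq: "q holomorphic_on unit_disc" using q by (simp add: disc_expansion_def)
  have holi: "(\<lambda>z. 1 / q z) holomorphic_on unit_disc"
    by (intro holomorphic_on_divide holq holomorphic_on_const) (rule qnz)
  obtain p0 where p0: "p0 holomorphic_on unit_disc" "\<And>z. z \<in> unit_disc \<Longrightarrow> 1 / q z = (p0 z)\<^sup>2"
    by (rule contractible_imp_holomorphic_sqrt[OF holi convex_imp_contractible[OF convex_ball]]) (use qnz in auto)
  have p00: "(p0 0)\<^sup>2 = 1" using p0(2)[of 0] q0 by simp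
  \<comment> \<open>The factor \<open>p0 0\<close> is 1 or -1 and selects the branch with p 0 =
    1.\<close>
  define p where "p z = p0 0 * p0 z" for z
  have holp: "p holomorphic_on unit_disc" unfolding p_def by (intro holomorphic_intros p0)
  have P: "disc_expansion p (fps_expansion p 0)" by (rule disc_expansion_fps_expansion[OF holp])
  have p2: "(p z)\<^sup>2 = 1 / q z" if "z \<in> unit_disc" for z
    using p0(2)[OF that] p00 by (simp add: p_def power_mult_distrib)
  show ?thesis
  proof (rule that[OF P])
    have "p 0 = 1" using p00 by (simp add: p_def power2_eq_square)
    then show "fps_nth (fps_expansion p 0) 0 = 1" using disc_expansion_at_0[OF P] by simp
    fix z :: complex assume z: "norm z < 1"
    then have zd: "z \<in> unit_disc" by simp
    have "(p z)\<^sup>2 \<noteq> 0" unfolding p2[OF zd] using qnz[OF zd] by simp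
    then show "p z \<noteq> 0" by simp
    show "f z = z / (p z)\<^sup>2" unfolding p2[OF zd] using fq[OF z] A01 by simp
  qed
qed

lemma schlicht_inverse_square_coeff:
  assumes "schlicht f A" and P: "disc_expansion p P" and P0: "fps_nth P 0 = 1" and pnz: "\<And>z. norm z < 1 \<Longrightarrow> p z \<noteq> 0"
    and fp: "\<And>z. norm z < 1 \<Longrightarrow> f z = z / (p z)\<^sup>2"
  shows "fps_nth A 2 = - 2 * fps_nth P 1"
proof -
  have A: "disc_expansion f A" and A01: "fps_nth A 0 = 0" "fps_nth A 1 = 1"
    using assms(1) by (auto simp: schlicht_def)
  have "disc_expansion (\<lambda>z. f z * (p z * p z)) (A * (P * P))"
    by (intro disc_expansion_mult A P)
  moreover have "disc_expansion (\<lambda>z. f z * (p z * p z)) fps_X"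
    by (rule disc_expansion_cong[OF disc_expansion_X]) (use pnz fp in \<open>auto simp: power2_eq_square\<close>)
  ultimately have "A * (P * P) = fps_X" by (rule disc_expansion_unique)
  then have "fps_nth (A * (P * P)) 2 = 0" by simp
  moreover have "{0..2::nat} = {0, 1, 2}" "{0..1::nat} = {0, 1}" by auto
  ultimately have "fps_nth A 2 + 2 * fps_nth P 1 = 0"
    using A01 P0 by (simp add: fps_mult_nth numeral_2_eq_2 algebra_simps)
  then show ?thesis by (simp add: add_eq_0_iff)
qed

text \<open>The area theorem is applied to the odd function p(z^2) / z = 1/z - g z, the reciprocal
  of a square root of f(z^2). Equal values at x and y give x^2 = y^2, and oddness together with p
  \<noteq> 0 excludes x = - y. Only odd powers occur in g, whence the weights 2 k + 1.\<close>

lemma schlicht_area: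
  assumes f: "schlicht f A" and P: "disc_expansion p P" and P0: "fps_nth P 0 = 1" and pnz: "\<And>z. norm z < 1 \<Longrightarrow> p z \<noteq> 0"
    and fp: "\<And>z. norm z < 1 \<Longrightarrow> f z = z / (p z)\<^sup>2"
  shows "(\<Sum>k\<le>N. real (2 * k + 1) * (norm (fps_nth P (Suc k)))\<^sup>2) \<le> 1"
proof -
  have inj: "inj_on f unit_disc" using f by (simp add: schlicht_def)
  obtain u where u: "disc_expansion u (fps_shift 1 P)" and pu: "\<And>z. norm z < 1 \<Longrightarrow> p z = fps_nth P 0 + z * u z"
    by (rule disc_expansion_shift[OF P]) blast
  define g where "g z = - (z * u (z ^ 2))" for z
  define B where "B = - (fps_X * fps_compose (fps_shift 1 P) (fps_X ^ 2))"
  have sq: "z ^ 2 \<in> unit_disc" if "z \<in> unit_disc" for z :: complex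
    using that by (simp add: norm_power power_less_one_iff)
  have "disc_expansion (\<lambda>z. u (z ^ 2)) (fps_compose (fps_shift 1 P) (fps_X ^ 2))"
    by (rule disc_expansion_compose[OF u disc_expansion_power[OF disc_expansion_X]]) (use sq in \<open>auto simp: image_subset_iff\<close>)
  then have "disc_expansion (\<lambda>z. 0 - z * u (z ^ 2)) (fps_const 0 - fps_X * fps_compose (fps_shift 1 P) (fps_X ^ 2))"
    by (intro disc_expansion_diff disc_expansion_const disc_expansion_mult disc_expansion_X)
  then have B: "disc_expansion g B" by (simp add: g_def[abs_def] B_def)
  have B0: "fps_nth B 0 = 0" by (simp add: B_def)
  have Bk: "fps_nth B (2 * k + 1) = - fps_nth P (Suc k)" for k
    by (simp add: B_def fps_nth_compose_X_power)
  have G: "1 / z - g z = p (z ^ 2) / z" if "z \<in> unit_disc - {0}" for z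
    using pu[of "z ^ 2"] sq[of z] that P0 by (simp add: g_def field_simps power2_eq_square)
  have fG: "f (z ^ 2) = 1 / (1 / z - g z) ^ 2" if "z \<in> unit_disc - {0}" for z
    using fp[of "z ^ 2"] sq[of z] that unfolding G[OF that] by (simp add: power_divide)
  have "inj_on (\<lambda>z. 1 / z - g z) (unit_disc - {0})"
  proof (rule inj_onI)
    fix x y assume xy: "x \<in> unit_disc - {0}" "y \<in> unit_disc - {0}" "1 / x - g x = 1 / y - g y"
    have "f (x ^ 2) = f (y ^ 2)" unfolding fG[OF xy(1)] fG[OF xy(2)] xy(3) ..
    then have "x ^ 2 = y ^ 2" using inj_onD[OF inj] sq xy by blast
    then have "x = y \<or> x = - y" by (simp add: power2_eq_iff)
    moreover have "x \<noteq> - y"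
    proof
      assume "x = - y"
      then have "p (y ^ 2) / y = - (p (y ^ 2) / y)" using xy(3) unfolding G[OF xy(1)] G[OF xy(2)] by simp
      then have "p (y ^ 2) / y = 0" by simp
      then show False using pnz[of "y ^ 2"] sq[of y] xy by auto
    qed
    ultimately show "x = y" by blast
  qed
  note area = area_theorem[OF B B0 this, of "2 * N + 1"]
  have "(\<Sum>k\<le>N. real (2 * k + 1) * (norm (fps_nth P (Suc k)))\<^sup>2) = (\<Sum>n\<in>(\<lambda>k. 2 * k + 1) ` {..N}. real n * (norm (fps_nth B n))\<^sup>2)"
  proof -
    have "norm (fps_nth B (Suc (2 * k))) = norm (fps_nth P (Suc k))" for k
      using Bk[of k] by simp
    then show ?thesis by (subst sum.reindex) (auto simp: inj_on_def)
  qed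
  also have "\<dots> \<le> (\<Sum>n\<le>2 * N + 1. real n * (norm (fps_nth B n))\<^sup>2)"
    by (rule sum_mono2) auto
  finally show ?thesis using area by linarith
qed

text \<open>The term k = 0 of \<open>schlicht_area\<close>, since a_2 = - 2 P_1.\<close>

theorem bieberbach_second_coeff:
  assumes "schlicht f A"
  shows "norm (fps_nth A 2) \<le> 2"
proof -
  obtain p P where p: "disc_expansion p P" "fps_nth P 0 = 1" "\<And>z. norm z < 1 \<Longrightarrow> p z \<noteq> 0"
    "\<And>z. norm z < 1 \<Longrightarrow> f z = z / (p z)\<^sup>2"
    using schlicht_inverse_square[OF assms] by blast
  have "(norm (fps_nth P 1))\<^sup>2 \<le> 1" using schlicht_area[OF assms p, of 0] by simp
  then have "norm (fps_nth P 1) \<le> 1" by (simp add: power_le_one_iff abs_square_le_1)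
  then show ?thesis using schlicht_inverse_square_coeff[OF assms p] by (simp add: norm_mult)
qed

text \<open>f / (1 - f / \<omega>) is again schlicht, with second coefficient a_2 + 1 /
  \<omega>.\<close>

lemma schlicht_omitted_value:
  assumes f: "schlicht f A" and om: "\<omega> \<notin> f ` unit_disc"
  shows "norm (fps_nth A 2 + 1 / \<omega>) \<le> 2"
proof -
  have A: "disc_expansion f A" and inj: "inj_on f unit_disc" and A01: "fps_nth A 0 = 0" "fps_nth A 1 = 1"
    using f by (auto simp: schlicht_def)
  have f0: "f 0 = 0" using disc_expansion_at_0[OF A] A01 by simp
  have om0: "\<omega> \<noteq> 0" using om f0 by (metis centre_in_ball image_eqI zero_less_one)
  have nz: "1 - f z / \<omega> \<noteq> 0" if "z \<in> unit_disc" for z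
    using om om0 that by (auto simp: field_simps)
  define F where "F z = f z / (1 - f z / \<omega>)" for z
  have holF: "F holomorphic_on unit_disc"
    unfolding F_def using A nz by (intro holomorphic_intros) (auto simp: disc_expansion_def)
  define C where "C = fps_expansion F 0"
  have C: "disc_expansion F C" unfolding C_def by (rule disc_expansion_fps_expansion[OF holF])
  have injF: "inj_on F unit_disc"
  proof (rule inj_onI)
    fix x y assume xy: "x \<in> unit_disc" "y \<in> unit_disc" "F x = F y"
    then have "f x * (1 - f y / \<omega>) = f y * (1 - f x / \<omega>)" using nz by (simp add: F_def frac_eq_eq)
    then have "f x = f y" by (simp add: algebra_simps)
    then show "x = y" using inj xy by (auto dest: inj_onD)
  qed
  have "disc_expansion (\<lambda>z. F z * (1 - (1 / \<omega>) * f z)) (C * (fps_const 1 - fps_const (1 / \<omega>) * A))"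
    by (intro disc_expansion_mult disc_expansion_diff disc_expansion_const A C)
  moreover have "disc_expansion (\<lambda>z. F z * (1 - (1 / \<omega>) * f z)) A"
    by (rule disc_expansion_cong[OF A]) (use nz in \<open>simp add: F_def\<close>)
  ultimately have eq: "C * (fps_const 1 - fps_const (1 / \<omega>) * A) = A" by (rule disc_expansion_unique)
  have C0: "fps_nth C 0 = 0" using disc_expansion_at_0[OF C] f0 by (simp add: F_def)
  have s: "{0..1::nat} = {0, 1}" "{0..2::nat} = {0, 1, 2}" by auto
  have "fps_nth (C * (fps_const 1 - fps_const (1 / \<omega>) * A)) 1 = 1" unfolding eq using A01 by simp
  then have C1: "fps_nth C 1 = 1" unfolding fps_mult_nth s using C0 A01 by simp
  have "fps_nth (C * (fps_const 1 - fps_const (1 / \<omega>) * A)) 2 = fps_nth A 2" unfolding eq ..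
  then have "fps_nth C 2 - 1 / \<omega> = fps_nth A 2"
    unfolding fps_mult_nth s using C0 C1 A01 by (simp add: numeral_2_eq_2)
  then have "fps_nth C 2 = fps_nth A 2 + 1 / \<omega>" by (simp add: diff_eq_eq)
  moreover have "schlicht F C" using C injF C0 C1 by (simp add: schlicht_def)
  ultimately show ?thesis using bieberbach_second_coeff[of F C] by simp
qed

lemma schlicht_normalization:
  assumes hol: "\<phi> holomorphic_on unit_disc" and inj: "inj_on \<phi> unit_disc"
  shows "deriv \<phi> 0 \<noteq> 0" and
    "schlicht (\<lambda>z. (\<phi> z - \<phi> 0) / deriv \<phi> 0) (fps_const (1 / deriv \<phi> 0) * (fps_expansion \<phi> 0 - fps_const (\<phi> 0)))"
proof -
  show d: "deriv \<phi> 0 \<noteq> 0" by (rule holomorphic_injective_imp_regular[OF hol _ inj]) auto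
  have E: "disc_expansion \<phi> (fps_expansion \<phi> 0)" by (rule disc_expansion_fps_expansion[OF hol])
  have c: "fps_nth (fps_expansion \<phi> 0) 0 = \<phi> 0" "fps_nth (fps_expansion \<phi> 0) 1 = deriv \<phi> 0"
    by (simp_all add: fps_expansion_def)
  have "disc_expansion (\<lambda>z. (1 / deriv \<phi> 0) * (\<phi> z - \<phi> 0)) (fps_const (1 / deriv \<phi> 0) * (fps_expansion \<phi> 0 - fps_const (\<phi> 0)))"
    by (intro disc_expansion_mult disc_expansion_diff disc_expansion_const E)
  moreover have "inj_on (\<lambda>z. (\<phi> z - \<phi> 0) / deriv \<phi> 0) unit_disc"
    using inj d by (auto simp: inj_on_def)
  ultimately show "schlicht (\<lambda>z. (\<phi> z - \<phi> 0) / deriv \<phi> 0) (fps_const (1 / deriv \<phi> 0) * (fps_expansion \<phi> 0 - fps_const (\<phi> 0)))"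
    using c d by (simp add: schlicht_def)
qed

section \<open>Distortion and growth along the positive radius\<close>

lemma univalent_second_derivative:
  assumes hol: "\<phi> holomorphic_on unit_disc" and inj: "inj_on \<phi> unit_disc"
  shows "norm (deriv (deriv \<phi>) 0 / deriv \<phi> 0) \<le> 4"
proof -
  note n = schlicht_normalization[OF hol inj]
  have "fps_nth (fps_const (1 / deriv \<phi> 0) * (fps_expansion \<phi> 0 - fps_const (\<phi> 0))) 2 = (deriv (deriv \<phi>) 0 / deriv \<phi> 0) / 2"
    by (simp add: fps_expansion_def numeral_2_eq_2)
  then have "norm ((deriv (deriv \<phi>) 0 / deriv \<phi> 0) / 2) \<le> 2"
    using bieberbach_second_coeff[OF n(2)] by simp
  then have "norm (deriv (deriv \<phi>) 0 / deriv \<phi> 0) / 2 \<le> 2"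
    by (simp only: norm_divide norm_numeral)
  then show ?thesis by simp
qed

lemma disc_automorphism_real:
  fixes x :: real and z :: complex
  assumes x: "0 \<le> x" "x < 1" and z: "norm z < 1"
  shows "1 + of_real x * z \<noteq> 0" and "norm ((z + of_real x) / (1 + of_real x * z)) < 1"
proof -
  have "norm (of_real x * z) < 1"
    using x z mult_strict_mono'[of x 1 "norm z" 1] by (simp add: norm_mult)
  then show nz: "1 + of_real x * z \<noteq> 0" by (metis add_eq_0_iff norm_minus_cancel norm_one less_irrefl)
  have "(norm (1 + of_real x * z))\<^sup>2 - (norm (z + of_real x))\<^sup>2 = (1 - x\<^sup>2) * (1 - (norm z)\<^sup>2)"
    unfolding cmod_power2 by (simp add: power2_eq_square algebra_simps)
  moreover have "x\<^sup>2 < 1" "(norm z)\<^sup>2 < 1" using x z by (simp_all add: power_less_one_iff abs_square_less_1)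
  ultimately have "(norm (z + of_real x))\<^sup>2 < (norm (1 + of_real x * z))\<^sup>2"
    by (smt (verit) mult_pos_pos)
  then have "norm (z + of_real x) < norm (1 + of_real x * z)" by (rule power2_less_imp_less) simp
  then show "norm ((z + of_real x) / (1 + of_real x * z)) < 1"
    using nz by (simp add: norm_divide divide_less_eq)
qed

text \<open>The bound on the second coefficient is moved from 0 to x by composing with the disc
  automorphism that sends 0 to x. Real x suffices because the later comparisons with the Koebe
  function take place on the positive axis.\<close>

lemma univalent_pre_schwarzian:
  fixes x :: real and f :: "complex \<Rightarrow> complex"
  assumes hol: "f holomorphic_on unit_disc" and inj: "inj_on f unit_disc" and x: "0 \<le> x" "x < 1"
  shows "norm ((1 - x\<^sup>2) * deriv (deriv f) (of_real x) / deriv f (of_real x) - 2 * x) \<le> 4"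
proof -
  define m where "m z = (z + of_real x) / (1 + of_real x * z)" for z :: complex
  define c where "c = complex_of_real (1 - x\<^sup>2)"
  have m: "m z \<in> unit_disc" "1 + of_real x * z \<noteq> 0" if "z \<in> unit_disc" for z
    using disc_automorphism_real[OF x, of z] that by (auto simp: m_def)
  have c0: "c \<noteq> 0" using x by (simp add: c_def abs_square_eq_1 power2_eq_1_iff flip: of_real_power of_real_diff)
  have xd: "complex_of_real x \<in> unit_disc" using x by simp
  have dm: "(m has_field_derivative c / (1 + of_real x * z)\<^sup>2) (at z)" if "z \<in> unit_disc" for z
    unfolding m_def using m(2)[OF that]
    by (auto intro!: derivative_eq_intros simp: c_def power2_eq_square field_simps)
  have holm: "m holomorphic_on unit_disc"
    unfolding m_def using m(2) by (intro holomorphic_intros) auto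
  have hol': "(\<lambda>z. f (m z)) holomorphic_on unit_disc"
    using holomorphic_on_compose_gen[OF holm hol] m(1) by (auto simp: o_def image_subset_iff)
  have inj': "inj_on (\<lambda>z. f (m z)) unit_disc"
  proof (rule inj_onI)
    fix u v assume uv: "u \<in> unit_disc" "v \<in> unit_disc" "f (m u) = f (m v)"
    then have "m u = m v" using inj m(1) by (auto dest: inj_onD)
    then have "(u + of_real x) * (1 + of_real x * v) = (v + of_real x) * (1 + of_real x * u)"
      using m(2) uv by (simp add: m_def frac_eq_eq)
    then have "(u - v) * c = 0" by (simp add: c_def algebra_simps power2_eq_square)
    then show "u = v" using c0 by simp
  qed
  have derf: "(f has_field_derivative deriv f w) (at w)" if "w \<in> unit_disc" for w
    by (rule holomorphic_derivI[OF hol open_ball that])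
  have derf': "(deriv f has_field_derivative deriv (deriv f) w) (at w)" if "w \<in> unit_disc" for w
    by (rule holomorphic_derivI[OF holomorphic_deriv[OF hol open_ball] open_ball that])
  define D where "D z = deriv f (m z) * (c / (1 + of_real x * z)\<^sup>2)" for z
  have d1: "deriv (\<lambda>z. f (m z)) z = D z" if "z \<in> unit_disc" for z
    unfolding D_def by (rule DERIV_imp_deriv, rule DERIV_chain2[OF derf[OF m(1)[OF that]] dm[OF that]])
  have m0: "m 0 = of_real x" by (simp add: m_def)
  have e1: "((\<lambda>z. c / (1 + of_real x * z)\<^sup>2) has_field_derivative - 2 * of_real x * c) (at 0)"
    by (auto intro!: derivative_eq_intros)
  have e2: "((\<lambda>z. deriv f (m z)) has_field_derivative deriv (deriv f) (m 0) * c) (at 0)"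
    using DERIV_chain2[OF derf'[OF m(1)] dm, of 0] by simp
  have "(D has_field_derivative (deriv (deriv f) (m 0) * c) * (c / (1 + of_real x * 0)\<^sup>2) + (- 2 * of_real x * c) * deriv f (m 0)) (at 0)"
    unfolding D_def by (rule DERIV_mult[OF e2 e1])
  then have "deriv D 0 = deriv (deriv f) (of_real x) * c * c - 2 * of_real x * c * deriv f (of_real x)"
    by (intro DERIV_imp_deriv) (simp add: m0 algebra_simps)
  moreover have "deriv (deriv (\<lambda>z. f (m z))) 0 = deriv D 0"
    by (rule deriv_cong_ev) (auto intro!: eventually_nhds_in_open[of unit_disc, THEN eventually_mono] d1)
  moreover have "deriv (\<lambda>z. f (m z)) 0 = deriv f (of_real x) * c"
    using d1[of 0] by (simp add: D_def m0)
  moreover have fx: "deriv f (of_real x) \<noteq> 0"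
    by (rule holomorphic_injective_imp_regular[OF hol open_ball inj xd])
  ultimately have "deriv (deriv (\<lambda>z. f (m z))) 0 / deriv (\<lambda>z. f (m z)) 0 = c * deriv (deriv f) (of_real x) / deriv f (of_real x) - 2 * of_real x"
    using c0 by (simp add: field_simps)
  then show ?thesis using univalent_second_derivative[OF hol' inj'] by (simp add: c_def)
qed

lemma univalent_second_derivative_real:
  fixes x :: real and f :: "complex \<Rightarrow> complex"
  assumes hol: "f holomorphic_on unit_disc" and inj: "inj_on f unit_disc" and x: "0 \<le> x" "x < 1"
  shows "norm (deriv (deriv f) (of_real x) / deriv f (of_real x)) \<le> (4 + 2 * x) / (1 - x\<^sup>2)"
proof -
  have q: "1 - x\<^sup>2 > 0" using x by (simp add: abs_square_less_1)
  define q where "q = deriv (deriv f) (of_real x) / deriv f (of_real x)"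
  have "norm (of_real (1 - x\<^sup>2) * q - of_real (2 * x)) \<le> 4"
    using univalent_pre_schwarzian[OF assms] by (simp add: q_def)
  moreover have "norm (of_real (1 - x\<^sup>2) * q) \<le> norm (of_real (1 - x\<^sup>2) * q - of_real (2 * x)) + norm (complex_of_real (2 * x))"
    by (metis diff_add_cancel norm_triangle_ineq)
  ultimately have "(1 - x\<^sup>2) * norm q \<le> 4 + 2 * x"
    using q x unfolding norm_mult norm_of_real by simp
  then show ?thesis using q by (simp add: q_def pos_le_divide_eq mult.commute)
qed

text \<open>\<open>k\<close> is the reciprocal of the derivative of the Koebe function, with
  logarithmic derivative -(4 + 2 t) / (1 - t^2). By \<open>univalent_second_derivative_real\<close>
  the product |f'| k does not increase from its value 1 at 0; it is squared so that real and
  imaginary parts can be differentiated directly.\<close>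

lemma schlicht_deriv_real_bound:
  fixes x :: real
  assumes f: "schlicht f A" and x: "0 \<le> x" "x < 1"
  shows "norm (deriv f (of_real x)) \<le> (1 + x) / (1 - x) ^ 3"
proof -
  have A: "disc_expansion f A" and inj: "inj_on f unit_disc" and A01: "fps_nth A 0 = 0" "fps_nth A 1 = 1"
    using f by (auto simp: schlicht_def)
  have hol: "f holomorphic_on unit_disc" using A by (simp add: disc_expansion_def)
  have f1: "deriv f 0 = 1" using disc_expansion_at_0[OF disc_expansion_deriv[OF A]] A01 by simp
  define k where "k t = (1 - t) ^ 3 / (1 + t)" for t :: real
  define \<Lambda> where "\<Lambda> t = (norm (deriv f (of_real t)))\<^sup>2 * (k t)\<^sup>2" for t :: real
  have "\<Lambda> x \<le> \<Lambda> 0"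
  proof (rule DERIV_nonpos_imp_nonincreasing[OF x(1)])
    fix t assume t: "0 \<le> t" "t \<le> x"
    then have t1: "t < 1" using x by simp
    have td: "complex_of_real t \<in> unit_disc" using t t1 by simp
    define a where "a = deriv f (of_real t)"
    define b where "b = deriv (deriv f) (of_real t)"
    have a0: "a \<noteq> 0" unfolding a_def by (rule holomorphic_injective_imp_regular[OF hol open_ball inj td])
    have "(deriv f has_field_derivative b) (at (of_real t))"
      unfolding b_def by (rule holomorphic_derivI[OF holomorphic_deriv[OF hol open_ball] open_ball td])
    then have v: "((\<lambda>t. deriv f (of_real t)) has_vector_derivative b) (at t)"
      by (rule has_vector_derivative_real_field)
    have Re: "((\<lambda>t. Re (deriv f (of_real t))) has_real_derivative Re b) (at t)"
      and Im: "((\<lambda>t. Im (deriv f (of_real t))) has_real_derivative Im b) (at t)"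
      using bounded_linear.has_vector_derivative[OF bounded_linear_Re v] bounded_linear.has_vector_derivative[OF bounded_linear_Im v]
      by (simp_all add: has_real_derivative_iff_has_vector_derivative)
    have N: "((\<lambda>t. (norm (deriv f (of_real t)))\<^sup>2) has_real_derivative 2 * (Re a * Re b + Im a * Im b)) (at t)"
      unfolding cmod_power2
      by (rule DERIV_cong[OF DERIV_add[OF DERIV_power[OF Re] DERIV_power[OF Im]]]) (simp add: a_def algebra_simps)
    have k: "(k has_real_derivative - (4 + 2 * t) / (1 - t\<^sup>2) * k t) (at t)"
    proof -
      have nz: "1 + t \<noteq> 0" "1 - t \<noteq> 0" "1 - t\<^sup>2 = (1 - t) * (1 + t)"
        using t t1 by (auto simp: algebra_simps power2_eq_square)
      have "(k has_real_derivative (3 * (1 - t)\<^sup>2 * (0 - 1) * (1 + t) - (1 - t) ^ 3 * (0 + 1)) / ((1 + t) * (1 + t))) (at t)"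
        unfolding k_def using nz by (auto intro!: derivative_eq_intros simp: algebra_simps power2_eq_square)
      also have "(3 * (1 - t)\<^sup>2 * (0 - 1) * (1 + t) - (1 - t) ^ 3 * (0 + 1)) / ((1 + t) * (1 + t)) = - (4 + 2 * t) / (1 - t\<^sup>2) * k t"
      proof -
        have "(3 * (1 - t)\<^sup>2 * (0 - 1) * (1 + t) - (1 - t) ^ 3 * (0 + 1)) = - (4 + 2 * t) * (1 - t)\<^sup>2"
          by algebra
        then show ?thesis using nz by (simp add: k_def power3_eq_cube power2_eq_square)
      qed
      finally show ?thesis .
    qed
    have k2: "((\<lambda>t. (k t)\<^sup>2) has_real_derivative - 2 * ((4 + 2 * t) / (1 - t\<^sup>2)) * (k t)\<^sup>2) (at t)"
      by (rule DERIV_cong[OF DERIV_power[OF k]]) (simp add: power2_eq_square)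
    have \<Lambda>': "(\<Lambda> has_real_derivative 2 * (Re a * Re b + Im a * Im b) * (k t)\<^sup>2 + (- 2 * ((4 + 2 * t) / (1 - t\<^sup>2)) * (k t)\<^sup>2) * (norm a)\<^sup>2) (at t)"
      using DERIV_mult[OF N k2] unfolding \<Lambda>_def a_def .
    have "Re a * Re b + Im a * Im b = Re (b * cnj a)" by (simp add: algebra_simps)
    also have "\<dots> \<le> norm (b * cnj a)" by (rule complex_Re_le_cmod)
    also have "\<dots> = norm (b / a) * (norm a)\<^sup>2" using a0 by (simp add: norm_mult norm_divide power2_eq_square)
    also have "\<dots> \<le> (4 + 2 * t) / (1 - t\<^sup>2) * (norm a)\<^sup>2"
      using univalent_second_derivative_real[OF hol inj t(1) t1] by (intro mult_right_mono) (auto simp: a_def b_def)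
    finally have "2 * (Re a * Re b + Im a * Im b) * (k t)\<^sup>2 \<le> 2 * ((4 + 2 * t) / (1 - t\<^sup>2) * (norm a)\<^sup>2) * (k t)\<^sup>2"
      by (intro mult_right_mono mult_left_mono) auto
    then have "2 * (Re a * Re b + Im a * Im b) * (k t)\<^sup>2 + (- 2 * ((4 + 2 * t) / (1 - t\<^sup>2)) * (k t)\<^sup>2) * (norm a)\<^sup>2 \<le> 0"
    proof -
      have "(- 2 * w * (k t)\<^sup>2) * (norm a)\<^sup>2 = - (2 * (w * (norm a)\<^sup>2) * (k t)\<^sup>2)" for w by simp
      from this[of "(4 + 2 * t) / (1 - t\<^sup>2)"] show ?thesis
        using \<open>2 * (Re a * Re b + Im a * Im b) * (k t)\<^sup>2 \<le> _\<close> by linarith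
    qed
    then show "\<exists>y. (\<Lambda> has_real_derivative y) (at t) \<and> y \<le> 0" using \<Lambda>' by blast
  qed
  moreover have "\<Lambda> 0 = 1" by (simp add: \<Lambda>_def k_def f1)
  ultimately have "(norm (deriv f (of_real x)) * k x)\<^sup>2 \<le> 1"
    by (simp only: \<Lambda>_def power_mult_distrib)
  moreover have kx: "k x > 0" using x by (simp add: k_def)
  ultimately have "norm (deriv f (of_real x)) * k x \<le> 1"
    by (simp add: abs_square_le_1)
  then have "norm (deriv f (of_real x)) \<le> 1 / k x" using kx by (simp add: pos_le_divide_eq)
  then show ?thesis by (simp add: k_def)
qed

lemma schlicht_growth_real:
  fixes x :: real
  assumes f: "schlicht f A" and x: "0 \<le> x" "x < 1"
  shows "norm (f (of_real x)) \<le> x / (1 - x)\<^sup>2"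
proof (cases "x = 0")
  \<comment> \<open>The mean value estimate used for x > 0 needs a nondegenerate interval.\<close>
  case True
  then show ?thesis using f disc_expansion_at_0[of f A] by (simp add: schlicht_def)
next
  case False
  have A: "disc_expansion f A" and A0: "fps_nth A 0 = 0"
    using f by (auto simp: schlicht_def)
  have hol: "f holomorphic_on unit_disc" using A by (simp add: disc_expansion_def)
  have f0: "f 0 = 0" using disc_expansion_at_0[OF A] A0 by simp
  define k where "k t = t / (1 - t)\<^sup>2" for t :: real
  have dk: "(k has_real_derivative (1 + t) / (1 - t) ^ 3) (at t)" if "t < 1" for t
  proof -
    have nz: "1 - t \<noteq> 0" using that by simp
    have "((\<lambda>t. (1 - t)\<^sup>2) has_real_derivative 2 * (1 - t) * (0 - 1)) (at t)"
      by (auto intro!: derivative_eq_intros)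
    from DERIV_divide[OF DERIV_ident this]
    have "(k has_real_derivative (1 * (1 - t)\<^sup>2 - t * (2 * (1 - t) * (0 - 1))) / ((1 - t)\<^sup>2 * (1 - t)\<^sup>2)) (at t)"
      unfolding k_def using nz by simp
    also have "(1 * (1 - t)\<^sup>2 - t * (2 * (1 - t) * (0 - 1))) / ((1 - t)\<^sup>2 * (1 - t)\<^sup>2) = (1 + t) / (1 - t) ^ 3"
    proof -
      have "(1 * (1 - t)\<^sup>2 - t * (2 * (1 - t) * (0 - 1))) = (1 + t) * (1 - t)" by algebra
      then show ?thesis using nz by (simp add: power2_eq_square power3_eq_cube)
    qed
    finally show ?thesis .
  qed
  have df: "((\<lambda>t. f (of_real t)) has_vector_derivative deriv f (of_real t)) (at t)" if "0 \<le> t" "t < 1" for t :: real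
    by (rule has_vector_derivative_real_field[OF holomorphic_derivI[OF hol open_ball]]) (use that in simp)
  have "norm (f (of_real x) - f (of_real 0)) \<le> k x - k 0"
  proof (rule differentiable_bound_general)
    show "0 < x" using False x by simp
    have "continuous (at t) (\<lambda>t. f (of_real t))" if "t \<in> {0..x}" for t
      by (rule has_vector_derivative_continuous[OF df]) (use that x in auto)
    then show "continuous_on {0..x} (\<lambda>t. f (of_real t))"
      by (simp add: continuous_at_imp_continuous_on)
    have "isCont k t" if "t \<in> {0..x}" for t
      by (rule DERIV_isCont[OF dk]) (use that x in auto)
    then show "continuous_on {0..x} k" by (simp add: continuous_at_imp_continuous_on)
    fix t assume t: "0 < t" "t < x"
    show "((\<lambda>t. f (of_real t)) has_vector_derivative deriv f (of_real t)) (at t)" using t x by (intro df) auto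
    show "(k has_vector_derivative (1 + t) / (1 - t) ^ 3) (at t)"
      using dk[of t] t x by (simp add: has_real_derivative_iff_has_vector_derivative)
    show "norm (deriv f (of_real t)) \<le> (1 + t) / (1 - t) ^ 3"
      using t x by (intro schlicht_deriv_real_bound[OF f]) auto
  qed
  then show ?thesis using f0 by (simp add: k_def)
qed

text \<open>The product of two bounds that are both equalities for the Koebe function, so the right
  side is its second derivative.\<close>

lemma schlicht_second_deriv_real_bound:
  fixes x :: real
  assumes f: "schlicht f A" and x: "0 \<le> x" "x < 1"
  shows "norm (deriv (deriv f) (of_real x)) \<le> (4 + 2 * x) / (1 - x) ^ 4"
proof -
  have A: "disc_expansion f A" and inj: "inj_on f unit_disc" using f by (auto simp: schlicht_def)
  have hol: "f holomorphic_on unit_disc" using A by (simp add: disc_expansion_def)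
  have xd: "complex_of_real x \<in> unit_disc" using x by simp
  have f0: "deriv f (of_real x) \<noteq> 0" by (rule holomorphic_injective_imp_regular[OF hol open_ball inj xd])
  have "norm (deriv (deriv f) (of_real x)) = norm (deriv (deriv f) (of_real x) / deriv f (of_real x)) * norm (deriv f (of_real x))"
    using f0 by (simp add: norm_divide)
  also have "\<dots> \<le> (4 + 2 * x) / (1 - x\<^sup>2) * ((1 + x) / (1 - x) ^ 3)"
    using x by (intro mult_mono univalent_second_derivative_real[OF hol inj] schlicht_deriv_real_bound[OF f] divide_nonneg_nonneg)
       (auto simp: power_le_one)
  also have "\<dots> = (4 + 2 * x) / (1 - x) ^ 4"
  proof -
    have "1 - x\<^sup>2 = (1 - x) * (1 + x)" "(1 - x) ^ 4 = (1 - x) * (1 - x) ^ 3"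
      by (simp_all add: algebra_simps power2_eq_square eval_nat_numeral)
    then show ?thesis using x by simp
  qed
  finally show ?thesis .
qed

section \<open>Coefficient sums near the Koebe function\<close>

lemma disc_expansion_square_reciprocal:
  "disc_expansion (\<lambda>z. 1 / (1 - z)\<^sup>2) (Abs_fps (\<lambda>n. of_nat (Suc n)))"
  by (rule disc_expansionI) (use geometric_deriv_sums in blast)

lemma sums_koebe:
  fixes x :: real
  assumes "\<bar>x\<bar> < 1"
  shows "(\<lambda>n. real (Suc n) * x ^ Suc n) sums (x / (1 - x)\<^sup>2)"
proof -
  have "(\<lambda>n. real (Suc n) * x ^ n) sums (1 / (1 - x)\<^sup>2)"
    using geometric_deriv_sums[of x] assms by simp
  from sums_mult[OF this, of x] show ?thesis by (simp add: mult_ac)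
qed

lemma sums_cubes:
  fixes x :: real
  assumes "\<bar>x\<bar> < 1"
  shows "(\<lambda>n. real (Suc n) ^ 3 * x ^ Suc n) sums (x * (1 + 4 * x + x\<^sup>2) / (1 - x) ^ 4)"
proof -
  define g where "g z = 1 / (1 - z)\<^sup>2" for z :: complex
  define Gf where "Gf = Abs_fps (\<lambda>n. of_nat (Suc n) :: complex)"
  have G: "disc_expansion g Gf" unfolding g_def Gf_def by (rule disc_expansion_square_reciprocal)
  have nz: "1 - z \<noteq> 0" if "z \<in> unit_disc" for z :: complex using that by auto
  have d1: "(g has_field_derivative 2 / (1 - z) ^ 3) (at z)" if "z \<in> unit_disc" for z
  proof -
    have "((\<lambda>z. (1 - z)\<^sup>2) has_field_derivative 2 * (1 - z) * (0 - 1)) (at z)"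
      by (auto intro!: derivative_eq_intros)
    from DERIV_divide[OF DERIV_const this, of 1]
    have "(g has_field_derivative (0 * (1 - z)\<^sup>2 - 1 * (2 * (1 - z) * (0 - 1))) / ((1 - z)\<^sup>2 * (1 - z)\<^sup>2)) (at z)"
      unfolding g_def using nz[OF that] by simp
    moreover have "(0 * u\<^sup>2 - 1 * (2 * u * (0 - 1))) / (u\<^sup>2 * u\<^sup>2) = 2 / u ^ 3" if "u \<noteq> 0" for u :: complex
      using that by (simp add: power2_eq_square power3_eq_cube)
    ultimately show ?thesis using nz[OF that] by metis
  qed
  have d2: "((\<lambda>z. 2 / (1 - z) ^ 3) has_field_derivative 6 / (1 - z) ^ 4) (at z)" if "z \<in> unit_disc" for z :: complex
  proof -
    have "((\<lambda>z. (1 - z) ^ 3) has_field_derivative 3 * (1 - z)\<^sup>2 * (0 - 1)) (at z)"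
      by (auto intro!: derivative_eq_intros)
    from DERIV_divide[OF DERIV_const this, of 2]
    have "((\<lambda>z. 2 / (1 - z) ^ 3) has_field_derivative (0 * (1 - z) ^ 3 - 2 * (3 * (1 - z)\<^sup>2 * (0 - 1))) / ((1 - z) ^ 3 * (1 - z) ^ 3)) (at z)"
      using nz[OF that] by simp
    moreover have "(0 * u ^ 3 - 2 * (3 * u\<^sup>2 * (0 - 1))) / (u ^ 3 * u ^ 3) = 6 / u ^ 4" if "u \<noteq> 0" for u :: complex
      using that by (simp add: eval_nat_numeral)
    ultimately show ?thesis using nz[OF that] by metis
  qed
  have G1: "disc_expansion (\<lambda>z. 2 / (1 - z) ^ 3) (fps_deriv Gf)"
    by (rule disc_expansion_cong[OF disc_expansion_deriv[OF G]]) (use DERIV_imp_deriv[OF d1] in simp)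
  have G2: "disc_expansion (\<lambda>z. 6 / (1 - z) ^ 4) (fps_deriv (fps_deriv Gf))"
    by (rule disc_expansion_cong[OF disc_expansion_deriv[OF G1]]) (use DERIV_imp_deriv[OF d2] in simp)
  \<comment> \<open>(n+1)^3 = (n+1)(n+2)(n+3) - 3 (n+1)(n+2) + (n+1), so the cubes are the
    coefficients of g'' - 3 g' + g.\<close>
  define H where "H = fps_deriv (fps_deriv Gf) - fps_const 3 * fps_deriv Gf + Gf"
  have H: "disc_expansion (\<lambda>z. 6 / (1 - z) ^ 4 - 3 * (2 / (1 - z) ^ 3) + g z) H"
    unfolding H_def by (intro disc_expansion_add disc_expansion_diff disc_expansion_mult disc_expansion_const G G1 G2)
  have Hn: "fps_nth H n = of_real (real (Suc n) ^ 3)" for n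
  proof -
    have "fps_nth H n = of_nat (Suc n) * (of_nat (Suc (Suc n)) * of_nat (Suc (Suc (Suc n)))) - 3 * (of_nat (Suc n) * of_nat (Suc (Suc n))) + of_nat (Suc n)"
      by (simp add: H_def Gf_def del: of_nat_Suc)
    also have "\<dots> = of_real (real (Suc n) ^ 3)" by (simp add: algebra_simps power3_eq_cube)
    finally show ?thesis .
  qed
  have xd: "norm (complex_of_real x) < 1" using assms by simp
  have "(\<lambda>n. fps_nth H n * of_real x ^ n) sums (6 / (1 - of_real x) ^ 4 - 3 * (2 / (1 - of_real x) ^ 3) + g (of_real x))"
    by (rule disc_expansion_sums[OF H xd])
  then have "(\<lambda>n. complex_of_real (real (Suc n) ^ 3 * x ^ n)) sums of_real (6 / (1 - x) ^ 4 - 3 * (2 / (1 - x) ^ 3) + 1 / (1 - x)\<^sup>2)"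
    by (simp add: Hn g_def del: of_nat_Suc)
  then have "(\<lambda>n. real (Suc n) ^ 3 * x ^ n) sums (6 / (1 - x) ^ 4 - 3 * (2 / (1 - x) ^ 3) + 1 / (1 - x)\<^sup>2)"
    by (simp only: sums_of_real_iff)
  also have "6 / (1 - x) ^ 4 - 3 * (2 / (1 - x) ^ 3) + 1 / (1 - x)\<^sup>2 = (1 + 4 * x + x\<^sup>2) / (1 - x) ^ 4"
  proof -
    define u where "u = 1 - x"
    have u: "u \<noteq> 0" "x = 1 - u" using assms by (auto simp: u_def)
    have "6 / u ^ 4 - 3 * (2 / u ^ 3) + 1 / u\<^sup>2 = (6 - 6 * u + u\<^sup>2) / u ^ 4"
      using u(1) by (simp add: add_divide_distrib diff_divide_distrib eval_nat_numeral)
    also have "6 - 6 * u + u\<^sup>2 = 1 + 4 * x + x\<^sup>2" unfolding u(2) by algebra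
    finally show ?thesis by (simp add: u_def)
  qed
  finally have "(\<lambda>n. real (Suc n) ^ 3 * x ^ n) sums ((1 + 4 * x + x\<^sup>2) / (1 - x) ^ 4)" .
  from sums_mult[OF this, of x] show ?thesis by (simp add: mult_ac)
qed

text \<open>The normalisation \<open>A 2 = 2 b\<close> with \<open>0 \<le> b\<close> is obtained from a general schlicht function by a rotation.\<close>
locale schlicht_near_koebe =
  fixes f :: "complex \<Rightarrow> complex" and A :: "complex fps" and b :: real
  assumes f: "schlicht f A" and b: "0 \<le> b" "fps_nth A 2 = of_real (2 * b)"
begin

text \<open>Indexed like the coefficients of f / z: \<open>deviation n\<close> belongs to the power
  n + 1 of f.\<close>

definition "deviation n = fps_nth A (Suc n) - of_nat (Suc n)"

lemma b_le_1: "b \<le> 1"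
  using bieberbach_second_coeff[OF f] b by simp

lemma expansion: "disc_expansion f A" "fps_nth A 0 = 0" "fps_nth A 1 = 1"
  using f by (auto simp: schlicht_def)

lemma inverse_square_root:
  obtains p P where "disc_expansion p P" "fps_nth P 0 = 1" "\<And>z. norm z < 1 \<Longrightarrow> p z \<noteq> 0"
    "\<And>z. norm z < 1 \<Longrightarrow> f z = z / (p z)\<^sup>2" "fps_nth P 1 = of_real (- b)"
    "\<And>N. (\<Sum>k\<le>N. real (2 * k + 1) * (norm (fps_nth P (Suc k)))\<^sup>2) \<le> 1"
proof -
  obtain p P where p: "disc_expansion p P" "fps_nth P 0 = 1" "\<And>z. norm z < 1 \<Longrightarrow> p z \<noteq> 0"
    "\<And>z. norm z < 1 \<Longrightarrow> f z = z / (p z)\<^sup>2"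
    by (rule schlicht_inverse_square[OF f]) blast
  have "fps_nth P 1 = of_real (- b)"
    using schlicht_inverse_square_coeff[OF f p] b by simp
  moreover have "(\<Sum>k\<le>N. real (2 * k + 1) * (norm (fps_nth P (Suc k)))\<^sup>2) \<le> 1" for N
    by (rule schlicht_area[OF f p(1,2)]) (use p(3,4) in auto)
  ultimately show ?thesis using that p by blast
qed

lemma shift_expansion:
  assumes p: "disc_expansion p P" "fps_nth P 0 = 1" "\<And>z. norm z < 1 \<Longrightarrow> p z \<noteq> 0"
    "\<And>z. norm z < 1 \<Longrightarrow> f z = z / (p z)\<^sup>2"
  shows "disc_expansion (\<lambda>z. 1 / (p z)\<^sup>2) (fps_shift 1 A)"
proof -
  obtain q where q: "disc_expansion q (fps_shift 1 A)" and fq: "\<And>z. norm z < 1 \<Longrightarrow> f z = fps_nth A 0 + z * q z"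
    by (rule disc_expansion_shift[OF expansion(1)]) blast
  have "1 / (p z)\<^sup>2 = q z" if "z \<in> unit_disc" for z
  proof (cases "z = 0")
    case True
    then show ?thesis using disc_expansion_at_0[OF q] disc_expansion_at_0[OF p(1)] p(2) expansion by simp
  next
    case False
    have "z * (1 / (p z)\<^sup>2) = z * q z" using fq[of z] p(4)[of z] that expansion by simp
    then show ?thesis using False by (simp only: mult_cancel_left) simp
  qed
  then show ?thesis by (intro disc_expansion_cong[OF q]) auto
qed

text \<open>Cauchy-Schwarz against the weights 2 k + 1 of the area theorem: the squared sum is at
  most the sum of \<rho>^(2k+2) / (2k+1), of which the first term is kept and the rest is majorised
  by a geometric series with denominator 3.\<close>

lemma majorant_bound:
  fixes P :: "complex fps"
  assumes area: "\<And>N. (\<Sum>k\<le>N. real (2 * k + 1) * (norm (fps_nth P (Suc k)))\<^sup>2) \<le> 1"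
    and \<rho>: "0 \<le> \<rho>" "\<rho> < 1" and m: "0 \<le> m" "\<rho>\<^sup>2 * (1 + \<rho>\<^sup>2 / (3 * (1 - \<rho>\<^sup>2))) \<le> m\<^sup>2"
  shows "(\<Sum>k\<le>N. norm (fps_nth P (Suc k)) * \<rho> ^ Suc k) \<le> m"
proof -
  define x where "x = \<rho>\<^sup>2"
  have x: "0 \<le> x" "x < 1" using \<rho> by (simp_all add: x_def power_less_one_iff abs_square_less_1)
  define u where "u k = sqrt (real (2 * k + 1)) * norm (fps_nth P (Suc k))" for k
  define v where "v k = \<rho> ^ Suc k / sqrt (real (2 * k + 1))" for k
  have "(\<Sum>k\<le>N. norm (fps_nth P (Suc k)) * \<rho> ^ Suc k) = (\<Sum>k\<le>N. u k * v k)"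
    by (intro sum.cong refl) (simp add: u_def v_def)
  then have "(\<Sum>k\<le>N. norm (fps_nth P (Suc k)) * \<rho> ^ Suc k)\<^sup>2 = (\<Sum>k\<le>N. u k * v k)\<^sup>2" by simp
  also have "\<dots> \<le> (\<Sum>k\<le>N. (u k)\<^sup>2) * (\<Sum>k\<le>N. (v k)\<^sup>2)" by (rule Cauchy_Schwarz_ineq_sum)
  also have "\<dots> \<le> 1 * (\<Sum>k\<le>N. (v k)\<^sup>2)"
    using area[of N] by (intro mult_right_mono sum_nonneg) (auto simp: u_def power_mult_distrib)
  also have "1 * (\<Sum>k\<le>N. (v k)\<^sup>2) = x + (\<Sum>k<N. (v (Suc k))\<^sup>2)"
    by (simp add: sum.atMost_shift v_def x_def)
  also have "(\<Sum>k<N. (v (Suc k))\<^sup>2) \<le> (\<Sum>k<N. x ^ 2 / 3 * x ^ k)"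
  proof (rule sum_mono)
    fix k
    have "(v (Suc k))\<^sup>2 = x ^ (k + 2) / real (2 * k + 3)"
    proof -
      have "(\<rho> ^ Suc (Suc k))\<^sup>2 = x ^ (k + 2)"
        unfolding x_def by (simp only: power_mult[symmetric]) (simp add: mult.commute)
      then show ?thesis by (simp only: v_def power_divide) simp
    qed
    also have "\<dots> \<le> x ^ (k + 2) / 3" using x by (intro divide_left_mono) auto
    finally show "(v (Suc k))\<^sup>2 \<le> x ^ 2 / 3 * x ^ k" by (simp add: power_add power2_eq_square mult_ac)
  qed
  also have "\<dots> = x ^ 2 / 3 * (\<Sum>k<N. x ^ k)" by (simp only: sum_distrib_left)
  also have "\<dots> \<le> x ^ 2 / 3 * (1 / (1 - x))"
  proof (rule mult_left_mono)
    have "(\<Sum>k<N. x ^ k) \<le> (\<Sum>k. x ^ k)" using x by (intro sum_le_suminf summable_geometric) auto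
    then show "(\<Sum>k<N. x ^ k) \<le> 1 / (1 - x)" using x by (simp add: suminf_geometric)
  qed (use x in auto)
  also have "x + x ^ 2 / 3 * (1 / (1 - x)) = x * (1 + x / (3 * (1 - x)))"
    by (simp add: algebra_simps power2_eq_square)
  also have "\<dots> \<le> m\<^sup>2" using m by (simp add: x_def)
  finally show ?thesis using m(1) by (rule_tac power2_le_imp_le) auto
qed

lemma norm_inverse_square_root_ge:
  fixes P :: "complex fps"
  assumes P: "disc_expansion p P" and P0: "fps_nth P 0 = 1" and z: "norm z = \<rho>" "\<rho> < 1"
    and maj: "\<And>N. (\<Sum>k\<le>N. norm (fps_nth P (Suc k)) * \<rho> ^ Suc k) \<le> m"
  shows "1 - m \<le> norm (p z)"
proof -
  have "(\<lambda>n. fps_nth P (Suc n) * z ^ Suc n) sums (p z - 1)"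
    using disc_expansion_sums[OF P, of z] z sums_Suc_iff[of "\<lambda>n. fps_nth P n * z ^ n" "p z - 1"] P0 by simp
  then have "(\<lambda>N. norm (\<Sum>n<N. fps_nth P (Suc n) * z ^ Suc n)) \<longlonglongrightarrow> norm (p z - 1)"
    unfolding sums_def by (rule tendsto_norm)
  moreover have "norm (\<Sum>n<N. fps_nth P (Suc n) * z ^ Suc n) \<le> m" for N
  proof -
    have "norm (\<Sum>n<N. fps_nth P (Suc n) * z ^ Suc n) \<le> (\<Sum>n<N. norm (fps_nth P (Suc n)) * \<rho> ^ Suc n)"
      by (rule order_trans[OF norm_sum]) (simp add: norm_mult norm_power z)
    also have "\<dots> \<le> (\<Sum>n\<le>N. norm (fps_nth P (Suc n)) * \<rho> ^ Suc n)"
    proof (rule sum_mono2)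
      have "0 \<le> \<rho>" using z(1) by auto
      then show "0 \<le> norm (fps_nth P (Suc n)) * \<rho> ^ Suc n" for n by simp
    qed auto
    finally show ?thesis using maj[of N] by simp
  qed
  ultimately have "norm (p z - 1) \<le> m" by (intro LIMSEQ_le_const2) auto
  then show ?thesis using norm_triangle_ineq2[of 1 "1 - p z"] by (simp add: norm_minus_commute)
qed

text \<open>On |z| = \<rho> the difference 1/p^2 - 1/(1-z)^2 factors as (1/p) (1/(1-z)) (1/p +
  1/(1-z)) (1 - z - p). The first three factors are bounded by C. The last has the coefficients b -
  1 and - P_n for n \<ge> 2, whose square sum is controlled because P_1 = - b uses up b^2 of the
  total 1 in the area theorem. The bound vanishes at b = 1, the Koebe case.\<close>

lemma deviation_l2:
  assumes \<rho>: "0 \<le> \<rho>" "\<rho> \<le> B" "B < 1" and m: "0 \<le> m" "m < 1" "\<rho>\<^sup>2 * (1 + \<rho>\<^sup>2 / (3 * (1 - \<rho>\<^sup>2))) \<le> m\<^sup>2"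
    and C: "1 / (1 - m) * (1 / (1 - B)) * (1 / (1 - m) + 1 / (1 - B)) \<le> C"
  shows "summable (\<lambda>n. (norm (deviation n))\<^sup>2 * \<rho> ^ (2 * n))"
    and "(\<Sum>n. (norm (deviation n))\<^sup>2 * \<rho> ^ (2 * n)) \<le> C\<^sup>2 * ((1 - b)\<^sup>2 * \<rho>\<^sup>2 + (1 - b\<^sup>2) * \<rho> ^ 4 / 3)"
proof -
  obtain p P where p: "disc_expansion p P" "fps_nth P 0 = 1" "\<And>z. norm z < 1 \<Longrightarrow> p z \<noteq> 0"
    "\<And>z. norm z < 1 \<Longrightarrow> f z = z / (p z)\<^sup>2" and P1: "fps_nth P 1 = of_real (- b)"
    and area: "\<And>N. (\<Sum>k\<le>N. real (2 * k + 1) * (norm (fps_nth P (Suc k)))\<^sup>2) \<le> 1"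
    by (rule inverse_square_root) blast
  have \<rho>1: "\<rho> < 1" using \<rho> by simp
  define D where "D = fps_shift 1 A - Abs_fps (\<lambda>n. of_nat (Suc n))"
  have D: "disc_expansion (\<lambda>z. 1 / (p z)\<^sup>2 - 1 / (1 - z)\<^sup>2) D"
    unfolding D_def by (intro disc_expansion_diff shift_expansion[OF p] disc_expansion_square_reciprocal)
  have Dn: "fps_nth D n = deviation n" for n by (simp add: D_def deviation_def)
  define E where "E = fps_const 1 - fps_X - P"
  have E: "disc_expansion (\<lambda>z. 1 - z - p z) E"
    unfolding E_def by (intro disc_expansion_diff disc_expansion_const disc_expansion_X p)
  have En: "fps_nth E 0 = 0" "fps_nth E 1 = of_real (b - 1)" "fps_nth E (Suc (Suc n)) = - fps_nth P (Suc (Suc n))" for n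
    using p(2) P1 by (simp_all add: E_def fps_X_nth)
  show "summable (\<lambda>n. (norm (deviation n))\<^sup>2 * \<rho> ^ (2 * n))"
    using parseval(2)[OF D \<rho>(1) \<rho>1] by (simp add: Dn)
  have maj: "(\<Sum>k\<le>N. norm (fps_nth P (Suc k)) * \<rho> ^ Suc k) \<le> m" for N
    by (rule majorant_bound[OF area \<rho>(1) \<rho>1 m(1,3)])
  have "(\<Sum>n. (norm (fps_nth D n))\<^sup>2 * \<rho> ^ (2 * n)) \<le> C\<^sup>2 * (\<Sum>n. (norm (fps_nth E n))\<^sup>2 * \<rho> ^ (2 * n))"
  proof (rule parseval_mono[OF D E \<rho>(1) \<rho>1])
    fix z :: complex assume z: "norm z = \<rho>"
    have pz: "1 - m \<le> norm (p z)" by (rule norm_inverse_square_root_ge[OF p(1,2) z \<rho>1 maj])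
    have pnz: "p z \<noteq> 0" using p(3)[of z] z \<rho>1 by simp
    have z1: "1 - B \<le> norm (1 - z)" using norm_triangle_ineq2[of 1 z] z \<rho> by simp
    have znz: "1 - z \<noteq> 0" using z \<rho>1 by auto
    have a: "norm (1 / p z) \<le> 1 / (1 - m)"
      unfolding norm_divide norm_one using pz m pnz by (intro divide_left_mono mult_pos_pos) auto
    have c: "norm (1 / (1 - z)) \<le> 1 / (1 - B)"
      unfolding norm_divide norm_one using z1 \<rho> znz by (intro divide_left_mono mult_pos_pos) auto
    have "1 / (p z)\<^sup>2 - 1 / (1 - z)\<^sup>2 = (1 / p z) * (1 / (1 - z)) * (1 / p z + 1 / (1 - z)) * (1 - z - p z)"
    proof -
      define s where "s = 1 / p z"
      define t where "t = 1 / (1 - z)"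
      have st: "s * p z = 1" "t * (1 - z) = 1" using pnz znz by (simp_all add: s_def t_def)
      have "s * t * (s + t) * (1 - z - p z) = s * (s + t) * (t * (1 - z)) - t * (s + t) * (s * p z)" by algebra
      also have "\<dots> = s\<^sup>2 - t\<^sup>2" unfolding st by algebra
      finally show ?thesis by (simp add: s_def t_def power_divide)
    qed
    then have "norm (1 / (p z)\<^sup>2 - 1 / (1 - z)\<^sup>2) = norm (1 / p z) * norm (1 / (1 - z)) * norm (1 / p z + 1 / (1 - z)) * norm (1 - z - p z)"
      by (simp only: norm_mult)
    also have "\<dots> \<le> C * norm (1 - z - p z)"
    proof (rule mult_right_mono)
      have "norm (1 / p z) * norm (1 / (1 - z)) * norm (1 / p z + 1 / (1 - z)) \<le> 1 / (1 - m) * (1 / (1 - B)) * (1 / (1 - m) + 1 / (1 - B))"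
        using a c m \<rho> by (intro mult_mono order_trans[OF norm_triangle_ineq] add_mono mult_nonneg_nonneg) auto
      then show "norm (1 / p z) * norm (1 / (1 - z)) * norm (1 / p z + 1 / (1 - z)) \<le> C" using C by simp
    qed simp
    finally show "norm (1 / (p z)\<^sup>2 - 1 / (1 - z)\<^sup>2) \<le> C * norm (1 - z - p z)" .
  qed
  also have "(\<Sum>n. (norm (fps_nth E n))\<^sup>2 * \<rho> ^ (2 * n)) \<le> (1 - b)\<^sup>2 * \<rho>\<^sup>2 + (1 - b\<^sup>2) * \<rho> ^ 4 / 3"
  proof (rule suminf_le_const[OF parseval(2)[OF E \<rho>(1) \<rho>1]])
    fix N
    have "(\<Sum>n<N. (norm (fps_nth E n))\<^sup>2 * \<rho> ^ (2 * n)) \<le> (\<Sum>n<Suc (Suc N). (norm (fps_nth E n))\<^sup>2 * \<rho> ^ (2 * n))"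
      using \<rho> by (intro sum_mono2) auto
    also have "\<dots> = (1 - b)\<^sup>2 * \<rho>\<^sup>2 + (\<Sum>n<N. (norm (fps_nth P (Suc (Suc n))))\<^sup>2 * \<rho> ^ (2 * Suc (Suc n)))"
    proof -
      have "(norm (fps_nth E 1))\<^sup>2 = (1 - b)\<^sup>2" unfolding En norm_of_real by (simp add: power2_commute)
      then show ?thesis
        unfolding sum.lessThan_Suc_shift using En by (simp add: numeral_2_eq_2)
    qed
    \<comment> \<open>From index 2 on, \<rho>^(2n) \<le> \<rho>^4, and the weight in the area
      theorem is at least 3.\<close>
    also have "(\<Sum>n<N. (norm (fps_nth P (Suc (Suc n))))\<^sup>2 * \<rho> ^ (2 * Suc (Suc n))) \<le> (\<Sum>n<N. (real (2 * Suc n + 1) * (norm (fps_nth P (Suc (Suc n))))\<^sup>2) * (\<rho> ^ 4 / 3))"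
    proof (rule sum_mono)
      fix n
      have "\<rho> ^ (2 * Suc (Suc n)) \<le> \<rho> ^ 4" using \<rho> by (intro power_decreasing) auto
      then have "(norm (fps_nth P (Suc (Suc n))))\<^sup>2 * \<rho> ^ (2 * Suc (Suc n)) \<le> (norm (fps_nth P (Suc (Suc n))))\<^sup>2 * \<rho> ^ 4"
        by (intro mult_left_mono) auto
      also have "\<dots> = (3 * (norm (fps_nth P (Suc (Suc n))))\<^sup>2) * (\<rho> ^ 4 / 3)" by simp
      also have "\<dots> \<le> (real (2 * Suc n + 1) * (norm (fps_nth P (Suc (Suc n))))\<^sup>2) * (\<rho> ^ 4 / 3)"
        using \<rho> by (intro mult_right_mono) auto
      finally show "(norm (fps_nth P (Suc (Suc n))))\<^sup>2 * \<rho> ^ (2 * Suc (Suc n)) \<le> (real (2 * Suc n + 1) * (norm (fps_nth P (Suc (Suc n))))\<^sup>2) * (\<rho> ^ 4 / 3)" .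
    qed
    also have "\<dots> = (\<Sum>n<N. real (2 * Suc n + 1) * (norm (fps_nth P (Suc (Suc n))))\<^sup>2) * (\<rho> ^ 4 / 3)"
      by (simp only: sum_distrib_right)
    also have "\<dots> \<le> (1 - b\<^sup>2) * (\<rho> ^ 4 / 3)"
    proof (rule mult_right_mono)
      have "b\<^sup>2 + (\<Sum>n<N. real (2 * Suc n + 1) * (norm (fps_nth P (Suc (Suc n))))\<^sup>2) \<le> 1"
      proof -
        have "(norm (fps_nth P (Suc 0)))\<^sup>2 = b\<^sup>2" using P1 by simp
        then show ?thesis using area[of N] unfolding sum.atMost_shift by simp
      qed
      then show "(\<Sum>n<N. real (2 * Suc n + 1) * (norm (fps_nth P (Suc (Suc n))))\<^sup>2) \<le> 1 - b\<^sup>2" by linarith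
    qed (use \<rho> in auto)
    finally show "(\<Sum>n<N. (norm (fps_nth E n))\<^sup>2 * \<rho> ^ (2 * n)) \<le> (1 - b)\<^sup>2 * \<rho>\<^sup>2 + (1 - b\<^sup>2) * \<rho> ^ 4 / 3" by simp
  qed
  then have "C\<^sup>2 * (\<Sum>n. (norm (fps_nth E n))\<^sup>2 * \<rho> ^ (2 * n)) \<le> C\<^sup>2 * ((1 - b)\<^sup>2 * \<rho>\<^sup>2 + (1 - b\<^sup>2) * \<rho> ^ 4 / 3)"
    by (rule mult_left_mono) simp
  finally show "(\<Sum>n. (norm (deviation n))\<^sup>2 * \<rho> ^ (2 * n)) \<le> C\<^sup>2 * ((1 - b)\<^sup>2 * \<rho>\<^sup>2 + (1 - b\<^sup>2) * \<rho> ^ 4 / 3)"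
    by (simp only: Dn)
qed

lemma deviation_0: "deviation 0 = 0"
  using expansion by (simp add: deviation_def)

lemma norm_coeff_square:
  "(norm (fps_nth A (Suc n)))\<^sup>2 = (real (Suc n))\<^sup>2 + 2 * real (Suc n) * Re (deviation n) + (norm (deviation n))\<^sup>2"
proof -
  have "fps_nth A (Suc n) = of_real (real (Suc n)) + deviation n" by (simp add: deviation_def)
  then show ?thesis unfolding cmod_power2 by (simp add: power2_eq_square algebra_simps)
qed

text \<open>The linear term of the majorant estimate; \<open>schlicht_growth_real\<close> makes its
  value nonpositive.\<close>

lemma sums_Re_deviation:
  assumes x: "0 \<le> x" "x < 1"
  shows "(\<lambda>n. Re (deviation n) * x ^ Suc n) sums (Re (f (of_real x)) - x / (1 - x)\<^sup>2)"
proof -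
  have "(\<lambda>n. fps_nth A n * of_real x ^ n) sums f (of_real x)"
    by (rule disc_expansion_sums[OF expansion(1)]) (use x in simp)
  then have "(\<lambda>n. fps_nth A (Suc n) * of_real x ^ Suc n) sums f (of_real x)"
    using sums_Suc_iff[of "\<lambda>n. fps_nth A n * of_real x ^ n" "f (of_real x)"] expansion by simp
  then have "(\<lambda>n. Re (fps_nth A (Suc n) * of_real x ^ Suc n)) sums Re (f (of_real x))" by (rule sums_Re)
  moreover have "(\<lambda>n. real (Suc n) * x ^ Suc n) sums (x / (1 - x)\<^sup>2)" using x by (intro sums_koebe) auto
  ultimately have "(\<lambda>n. Re (fps_nth A (Suc n) * of_real x ^ Suc n) - real (Suc n) * x ^ Suc n) sums (Re (f (of_real x)) - x / (1 - x)\<^sup>2)"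
    by (rule sums_diff)
  moreover have "Re (fps_nth A (Suc n) * of_real x ^ Suc n) - real (Suc n) * x ^ Suc n = Re (deviation n) * x ^ Suc n" for n
    by (simp add: deviation_def algebra_simps del: power_Suc flip: of_real_power)
  ultimately show ?thesis by (simp only:)
qed

text \<open>Applying z d/dz twice to f gives \<open>F\<close>, with coefficients n^2 a_n. The sharp
  bounds for f' and f'' on the positive axis add up to exactly the Koebe value, so the linear term
  of the area estimate has the right sign.\<close>

lemma sums_Re_deviation_squares:
  assumes x: "0 \<le> x" "x < 1"
  obtains S where "(\<lambda>n. (real (Suc n))\<^sup>2 * Re (deviation n) * x ^ Suc n) sums S" "S \<le> 0"
proof -
  define F where "F z = z * (deriv f z + z * deriv (deriv f) z)" for z
  define C where "C = fps_X * (fps_deriv A + fps_X * fps_deriv (fps_deriv A))"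
  have C: "disc_expansion F C" unfolding F_def C_def
    by (intro disc_expansion_mult disc_expansion_add disc_expansion_X disc_expansion_deriv expansion)
  have Cn: "fps_nth C (Suc n) = of_real ((real (Suc n))\<^sup>2) * fps_nth A (Suc n)" for n
    by (cases n) (simp_all add: C_def power2_eq_square algebra_simps)
  have "(\<lambda>n. fps_nth C n * of_real x ^ n) sums F (of_real x)"
    by (rule disc_expansion_sums[OF C]) (use x in simp)
  moreover have "fps_nth C 0 = 0" by (simp add: C_def)
  ultimately have "(\<lambda>n. fps_nth C (Suc n) * of_real x ^ Suc n) sums F (of_real x)"
    using sums_Suc_iff[of "\<lambda>n. fps_nth C n * of_real x ^ n" "F (of_real x)"] by simp
  then have "(\<lambda>n. Re (fps_nth C (Suc n) * of_real x ^ Suc n)) sums Re (F (of_real x))" by (rule sums_Re)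
  moreover have "(\<lambda>n. real (Suc n) ^ 3 * x ^ Suc n) sums (x * (1 + 4 * x + x\<^sup>2) / (1 - x) ^ 4)"
    using x by (intro sums_cubes) auto
  ultimately have "(\<lambda>n. Re (fps_nth C (Suc n) * of_real x ^ Suc n) - real (Suc n) ^ 3 * x ^ Suc n) sums (Re (F (of_real x)) - x * (1 + 4 * x + x\<^sup>2) / (1 - x) ^ 4)"
    by (rule sums_diff)
  moreover have "Re (fps_nth C (Suc n) * of_real x ^ Suc n) - real (Suc n) ^ 3 * x ^ Suc n = (real (Suc n))\<^sup>2 * Re (deviation n) * x ^ Suc n" for n
    unfolding Cn by (simp add: deviation_def power2_eq_square power3_eq_cube algebra_simps del: power_Suc of_nat_Suc flip: of_real_power of_real_mult)
  ultimately have "(\<lambda>n. (real (Suc n))\<^sup>2 * Re (deviation n) * x ^ Suc n) sums (Re (F (of_real x)) - x * (1 + 4 * x + x\<^sup>2) / (1 - x) ^ 4)"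
    by (simp only:)
  moreover have "Re (F (of_real x)) \<le> x * (1 + 4 * x + x\<^sup>2) / (1 - x) ^ 4"
  proof -
    have "Re (F (of_real x)) \<le> norm (F (of_real x))" by (rule complex_Re_le_cmod)
    also have "\<dots> \<le> x * ((1 + x) / (1 - x) ^ 3 + x * ((4 + 2 * x) / (1 - x) ^ 4))"
    proof -
      have "norm (F (of_real x)) = x * norm (deriv f (of_real x) + of_real x * deriv (deriv f) (of_real x))"
        using x by (simp add: F_def norm_mult)
      also have "norm (deriv f (of_real x) + of_real x * deriv (deriv f) (of_real x)) \<le> norm (deriv f (of_real x)) + x * norm (deriv (deriv f) (of_real x))"
        using norm_triangle_ineq[of "deriv f (of_real x)" "of_real x * deriv (deriv f) (of_real x)"] x by (simp add: norm_mult)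
      also have "\<dots> \<le> (1 + x) / (1 - x) ^ 3 + x * ((4 + 2 * x) / (1 - x) ^ 4)"
        using x by (intro add_mono mult_left_mono schlicht_deriv_real_bound[OF f] schlicht_second_deriv_real_bound[OF f]) auto
      finally show ?thesis using x by (simp add: mult_left_mono)
    qed
    also have "(1 + x) / (1 - x) ^ 3 + x * ((4 + 2 * x) / (1 - x) ^ 4) = (1 + 4 * x + x\<^sup>2) / (1 - x) ^ 4"
    proof -
      have "(1 + x) / (1 - x) ^ 3 = ((1 + x) * (1 - x)) / (1 - x) ^ 4" using x by (simp add: eval_nat_numeral)
      then have "(1 + x) / (1 - x) ^ 3 + x * ((4 + 2 * x) / (1 - x) ^ 4) = (1 + x) * (1 - x) / (1 - x) ^ 4 + x * (4 + 2 * x) / (1 - x) ^ 4"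
        by (simp only: times_divide_eq_right)
      also have "\<dots> = ((1 + x) * (1 - x) + x * (4 + 2 * x)) / (1 - x) ^ 4"
        by (rule add_divide_distrib[symmetric])
      also have "(1 + x) * (1 - x) + x * (4 + 2 * x) = 1 + 4 * x + x\<^sup>2" by algebra
      finally show ?thesis .
    qed
    finally show ?thesis by simp
  qed
  ultimately show ?thesis using that by auto
qed

text \<open>The constant \<open>0.1716\<close> is an upper bound for \<open>3 - 2 \<surd>2\<close>, the root \<open>r\<^sub>0\<close> for \<open>K = 1\<close> and \<open>\<mu> = 0\<close>.\<close>
lemma area_estimate:
  assumes \<alpha>: "0 < \<alpha>" "\<alpha> \<le> 1" "2 * \<alpha> - 1 \<le> b" and x: "0 \<le> x" "x \<le> 1716 / 10000"
  shows "\<alpha>\<^sup>2 * (\<Sum>n. real (Suc n) * (norm (fps_nth A (Suc n)))\<^sup>2 * (x\<^sup>2) ^ Suc n) \<le> x\<^sup>2 * (1 + 4 * x\<^sup>2 + (x\<^sup>2)\<^sup>2) / (1 - x\<^sup>2) ^ 4"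
    and "summable (\<lambda>n. real (Suc n) * (norm (fps_nth A (Suc n)))\<^sup>2 * (x\<^sup>2) ^ Suc n)"
proof -
  define y where "y = x\<^sup>2"
  have y: "0 \<le> y" "y \<le> 2945 / 100000"
  proof -
    have "x\<^sup>2 \<le> (1716 / 10000)\<^sup>2" using x by (intro power_mono) auto
    then show "y \<le> 2945 / 100000" by (simp add: y_def power2_eq_square)
  qed (simp add: y_def)
  \<comment> \<open>The radius is enlarged by the factor sqrt 2 so that 2^n absorbs the weight n + 1
    in \<open>Ele\<close>.\<close>
  define \<rho> where "\<rho> = sqrt (2 * y)"
  have \<rho>2: "\<rho>\<^sup>2 = 2 * y" using y by (simp add: \<rho>_def)
  have \<rho>: "0 \<le> \<rho>" "\<rho> \<le> 2427 / 10000"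
  proof -
    have "\<rho>\<^sup>2 \<le> (2427 / 10000)\<^sup>2" unfolding \<rho>2 using y by (simp add: power2_eq_square)
    then show "\<rho> \<le> 2427 / 10000" by (rule power2_le_imp_le) simp
  qed (simp add: \<rho>_def y)
  \<comment> \<open>Numerical bounds at the largest admissible y: \<open>m\<close> for the majorant
    of 1 - p on the circle |z| = \<rho>, \<open>B\<close> for \<rho> itself, \<open>C\<close> for
    the product of the three factors in \<open>deviation_l2\<close>.\<close>
  define m :: real where "m = 2453 / 10000"
  define B :: real where "B = 2427 / 10000"
  define C :: real where "C = 463 / 100"
  have mm: "\<rho>\<^sup>2 * (1 + \<rho>\<^sup>2 / (3 * (1 - \<rho>\<^sup>2))) \<le> m\<^sup>2"
  proof -
    have "\<rho>\<^sup>2 / (3 * (1 - \<rho>\<^sup>2)) \<le> (5890 / 100000) / (3 * (1 - 5890 / 100000))"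
      unfolding \<rho>2 using y by (intro frac_le) auto
    then have "\<rho>\<^sup>2 * (1 + \<rho>\<^sup>2 / (3 * (1 - \<rho>\<^sup>2))) \<le> (5890 / 100000) * (1 + (5890 / 100000) / (3 * (1 - 5890 / 100000)))"
      unfolding \<rho>2 using y by (intro mult_mono add_mono) auto
    also have "\<dots> \<le> m\<^sup>2" by (simp add: m_def power2_eq_square)
    finally show ?thesis .
  qed
  have CC: "1 / (1 - m) * (1 / (1 - B)) * (1 / (1 - m) + 1 / (1 - B)) \<le> C"
    by (simp add: m_def B_def C_def)
  note dev = deviation_l2[OF \<rho>(1) \<rho>(2)[folded B_def] _ _ _ mm CC]
  have sm: "summable (\<lambda>n. (norm (deviation n))\<^sup>2 * \<rho> ^ (2 * n))"
    and le: "(\<Sum>n. (norm (deviation n))\<^sup>2 * \<rho> ^ (2 * n)) \<le> C\<^sup>2 * ((1 - b)\<^sup>2 * \<rho>\<^sup>2 + (1 - b\<^sup>2) * \<rho> ^ 4 / 3)"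
    by (rule dev; simp add: B_def m_def)+
  define E where "E n = real (Suc n) * (norm (deviation n))\<^sup>2 * y ^ Suc n" for n
  have E0: "E n \<ge> 0" for n using y by (simp add: E_def)
  have Ele: "E n \<le> y * ((norm (deviation n))\<^sup>2 * \<rho> ^ (2 * n))" for n
  proof -
    have "real (Suc n) \<le> 2 ^ n" by (induction n) auto
    then have "real (Suc n) * y ^ n \<le> 2 ^ n * y ^ n" using y by (intro mult_right_mono) auto
    also have "\<dots> = \<rho> ^ (2 * n)" unfolding power_mult \<rho>2 by (simp add: power_mult_distrib)
    finally have "(real (Suc n) * y ^ n) * (y * (norm (deviation n))\<^sup>2) \<le> \<rho> ^ (2 * n) * (y * (norm (deviation n))\<^sup>2)"
      using y by (intro mult_right_mono) auto
    then show ?thesis by (simp add: E_def mult_ac)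
  qed
  have smE: "summable E"
    by (rule summable_comparison_test'[OF summable_mult[OF sm, of y], of 0]) (use E0 Ele in auto)
  have "suminf E \<le> y * (\<Sum>n. (norm (deviation n))\<^sup>2 * \<rho> ^ (2 * n))"
    unfolding suminf_mult[OF sm, symmetric] by (rule suminf_le[OF Ele smE summable_mult[OF sm]])
  also have "\<dots> \<le> y * (C\<^sup>2 * ((1 - b)\<^sup>2 * \<rho>\<^sup>2 + (1 - b\<^sup>2) * \<rho> ^ 4 / 3))"
    using le y by (intro mult_left_mono) auto
  finally have sE: "suminf E \<le> y * (C\<^sup>2 * ((1 - b)\<^sup>2 * \<rho>\<^sup>2 + (1 - b\<^sup>2) * \<rho> ^ 4 / 3))" .
  define t where "t = 1 - b"
  have t: "0 \<le> t" "t \<le> 1" "t \<le> 2 * (1 - \<alpha>)" using b_le_1 b \<alpha> by (auto simp: t_def)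
  have "\<alpha>\<^sup>2 * suminf E \<le> (1 - \<alpha>\<^sup>2) * y"
  proof -
    \<comment> \<open>With t = 1 - b and \<rho>^2 = 2 y, the bound on the square sum becomes t times
      an expression affine in t; 127/100 bounds 2 C^2 y, and 4/100 bounds 4 y / 3.\<close>
    define c where "c = t * (127 / 100 * (t + 4 / 100))"
    have bt: "b = 1 - t" by (simp add: t_def)
    have \<rho>4: "\<rho> ^ 4 = 4 * y\<^sup>2"
    proof -
      have "\<rho> ^ 4 = (\<rho>\<^sup>2)\<^sup>2" by simp
      then show ?thesis by (simp only: \<rho>2 power_mult_distrib) simp
    qed
    have "C\<^sup>2 * ((1 - b)\<^sup>2 * \<rho>\<^sup>2 + (1 - b\<^sup>2) * \<rho> ^ 4 / 3) \<le> c"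
    proof -
      have "C\<^sup>2 * ((1 - b)\<^sup>2 * \<rho>\<^sup>2 + (1 - b\<^sup>2) * \<rho> ^ 4 / 3) = t * (2 * C\<^sup>2 * y * (t + (2 - t) * (2 / 3) * y))"
        unfolding \<rho>2 \<rho>4 bt by algebra
      also have "\<dots> \<le> t * (127 / 100 * (t + 4 / 100))"
      proof (intro mult_left_mono mult_mono add_left_mono)
        show "2 * C\<^sup>2 * y \<le> 127 / 100" using y by (simp add: C_def power2_eq_square)
        have "(2 - t) * (2 / 3) * y \<le> 2 * (2 / 3) * (2945 / 100000)"
          using y t by (intro mult_mono) auto
        also have "2 * (2 / 3) * (2945 / 100000) \<le> (4 / 100 :: real)" by simp
        finally show "(2 - t) * (2 / 3) * y \<le> 4 / 100" .
        show "0 \<le> t + (2 - t) * (2 / 3) * y" using y t by simp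
      qed (use t in auto)
      finally show ?thesis by (simp add: c_def)
    qed
    then have "y * (C\<^sup>2 * ((1 - b)\<^sup>2 * \<rho>\<^sup>2 + (1 - b\<^sup>2) * \<rho> ^ 4 / 3)) \<le> y * c"
      using y(1) by (rule mult_left_mono)
    with sE have "suminf E \<le> y * c" by linarith
    then have "\<alpha>\<^sup>2 * suminf E \<le> \<alpha>\<^sup>2 * (y * c)" by (intro mult_left_mono) auto
    also have "\<alpha>\<^sup>2 * (y * c) = (\<alpha>\<^sup>2 * c) * y" by simp
    also have "\<dots> \<le> (1 - \<alpha>\<^sup>2) * y"
    proof (rule mult_right_mono[OF _ y(1)])
      have c0: "0 \<le> c" using t by (simp add: c_def)
      \<comment> \<open>t \<le> 2 (1 - \<alpha>) means \<alpha> \<le> 1 - t/2, so the claim reduces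
        to an inequality between polynomials in t.\<close>
      have a2: "\<alpha>\<^sup>2 \<le> (1 - t / 2)\<^sup>2" using \<alpha> t by (intro power_mono) auto
      have tt: "t * t \<le> t" using t mult_left_le_one_le[of t t] by simp
      have "(1 - t / 2)\<^sup>2 = 1 - t + t * t / 4" by (simp add: power2_eq_square algebra_simps)
      with tt a2 have a3: "\<alpha>\<^sup>2 \<le> 1 - t * (3 / 4)" and a4: "t * (1 - t / 4) \<le> 1 - \<alpha>\<^sup>2"
        by (simp_all add: algebra_simps)
      have "\<alpha>\<^sup>2 * c \<le> (1 - t * (3 / 4)) * c" by (rule mult_right_mono[OF a3 c0])
      also have "\<dots> = t * ((1 - t * (3 / 4)) * (127 / 100 * (t + 4 / 100)))" by (simp add: c_def)
      also have "\<dots> \<le> t * (1 - t / 4)"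
      proof (rule mult_left_mono[OF _ t(1)])
        have "0 \<le> (t - 78 / 100)\<^sup>2" by simp
        also have "(t - 78 / 100)\<^sup>2 = t * t - 156 / 100 * t + 6084 / 10000" by algebra
        finally have "0 \<le> t * t - 156 / 100 * t + 6084 / 10000" .
        moreover have "(1 - t * (3 / 4)) * (127 / 100 * (t + 4 / 100)) =
          508 / 10000 + 12319 / 10000 * t - 9525 / 10000 * (t * t)"
          by algebra
        ultimately show "(1 - t * (3 / 4)) * (127 / 100 * (t + 4 / 100)) \<le> 1 - t / 4"
          using t(1) by argo
      qed
      finally show "\<alpha>\<^sup>2 * c \<le> 1 - \<alpha>\<^sup>2" using a4 by linarith
    qed
    finally show ?thesis .
  qed
  obtain S where S: "(\<lambda>n. (real (Suc n))\<^sup>2 * Re (deviation n) * y ^ Suc n) sums S" "S \<le> 0"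
    by (rule sums_Re_deviation_squares[of y]) (use y in auto)
  define K where "K = y * (1 + 4 * y + y\<^sup>2) / (1 - y) ^ 4"
  have K: "(\<lambda>n. real (Suc n) ^ 3 * y ^ Suc n) sums K"
    unfolding K_def using y by (intro sums_cubes) auto
  have Kge: "y \<le> K"
  proof -
    have "(1 - y) ^ 4 \<le> 1" "0 < (1 - y) ^ 4" using y by (auto intro: power_le_one)
    moreover have "1 \<le> 1 + 4 * y + y\<^sup>2" using y by simp
    ultimately have "1 \<le> (1 + 4 * y + y\<^sup>2) / (1 - y) ^ 4" by (simp add: pos_le_divide_eq)
    then have "y * 1 \<le> y * ((1 + 4 * y + y\<^sup>2) / (1 - y) ^ 4)" using y by (intro mult_left_mono) auto
    then show ?thesis by (simp add: K_def)
  qed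
  have "(\<lambda>n. real (Suc n) ^ 3 * y ^ Suc n + 2 * ((real (Suc n))\<^sup>2 * Re (deviation n) * y ^ Suc n) + E n) sums (K + 2 * S + suminf E)"
    by (intro sums_add sums_mult K S summable_sums smE)
  moreover have "real (Suc n) ^ 3 * y ^ Suc n + 2 * ((real (Suc n))\<^sup>2 * Re (deviation n) * y ^ Suc n) + E n = real (Suc n) * (norm (fps_nth A (Suc n)))\<^sup>2 * y ^ Suc n" for n
  proof -
    have "c ^ 3 * Y + 2 * (c\<^sup>2 * R * Y) + c * N * Y = c * (c\<^sup>2 + 2 * c * R + N) * Y" for c Y R N :: real by algebra
    then show ?thesis unfolding E_def norm_coeff_square by (simp only:)
  qed
  ultimately have sums: "(\<lambda>n. real (Suc n) * (norm (fps_nth A (Suc n)))\<^sup>2 * y ^ Suc n) sums (K + 2 * S + suminf E)"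
    by (simp only:)
  then show "summable (\<lambda>n. real (Suc n) * (norm (fps_nth A (Suc n)))\<^sup>2 * (x\<^sup>2) ^ Suc n)"
    unfolding y_def by (rule sums_summable)
  \<comment> \<open>The nonpositive linear term S is dropped, and the share (1 - \<alpha>^2) K freed
    by the factor \<alpha>^2 pays for the quadratic term because y \<le> K.\<close>
  have "\<alpha>\<^sup>2 * (K + 2 * S + suminf E) \<le> \<alpha>\<^sup>2 * (K + suminf E)"
    using S(2) by (intro mult_left_mono) auto
  also have "\<dots> \<le> \<alpha>\<^sup>2 * K + (1 - \<alpha>\<^sup>2) * y" using \<open>\<alpha>\<^sup>2 * suminf E \<le> (1 - \<alpha>\<^sup>2) * y\<close> by (simp add: distrib_left)
  also have "\<dots> \<le> \<alpha>\<^sup>2 * K + (1 - \<alpha>\<^sup>2) * K"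
    using Kge \<alpha> by (intro add_left_mono mult_left_mono) (auto simp: power_le_one)
  also have "\<dots> = K" by (simp add: left_diff_distrib)
  finally show "\<alpha>\<^sup>2 * (\<Sum>n. real (Suc n) * (norm (fps_nth A (Suc n)))\<^sup>2 * (x\<^sup>2) ^ Suc n) \<le> x\<^sup>2 * (1 + 4 * x\<^sup>2 + (x\<^sup>2)\<^sup>2) / (1 - x\<^sup>2) ^ 4"
    using sums_unique[OF sums] unfolding K_def y_def by simp
qed

text \<open>First powers are reached through 2 \<alpha> |a_n| \<le> \<alpha>^2 |a_n|^2 / n + n, an
  equality for the Koebe coefficients at \<alpha> = 1. Dividing the expansion of |a_n|^2 by n leaves
  the linear term 2 Re (a_n - n), which the growth theorem controls. The circle now has radius sqrt
  x, larger than in the area estimate, so the constants are worse, and \<alpha> is restricted to a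
  neighbourhood of 1.\<close>

lemma majorant_estimate_near:
  assumes \<alpha>: "99 / 100 \<le> \<alpha>" "\<alpha> \<le> 1" "2 * \<alpha> - 1 \<le> b" and x: "0 \<le> x" "x \<le> 1716 / 10000"
  shows "\<alpha> * (\<Sum>n. norm (fps_nth A (Suc n)) * x ^ Suc n) \<le> x / (1 - x)\<^sup>2"
proof -
  define \<rho> where "\<rho> = sqrt x"
  have \<rho>2: "\<rho>\<^sup>2 = x" using x by (simp add: \<rho>_def)
  have \<rho>: "0 \<le> \<rho>" "\<rho> \<le> 41425 / 100000"
  proof -
    have "\<rho>\<^sup>2 \<le> (41425 / 100000)\<^sup>2" unfolding \<rho>2 using x by (simp add: power2_eq_square)
    then show "\<rho> \<le> 41425 / 100000" by (rule power2_le_imp_le) simp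
  qed (simp add: \<rho>_def x)
  \<comment> \<open>The same three bounds as in \<open>area_estimate\<close>, now for \<rho>^2 = x
    \<le> 0.1716.\<close>
  define m :: real where "m = 4285 / 10000"
  define B :: real where "B = 41425 / 100000"
  define C :: real where "C = 10335 / 1000"
  have mm: "\<rho>\<^sup>2 * (1 + \<rho>\<^sup>2 / (3 * (1 - \<rho>\<^sup>2))) \<le> m\<^sup>2"
  proof -
    have "\<rho>\<^sup>2 / (3 * (1 - \<rho>\<^sup>2)) \<le> (1716 / 10000) / (3 * (1 - 1716 / 10000))"
      unfolding \<rho>2 using x by (intro frac_le) auto
    then have "\<rho>\<^sup>2 * (1 + \<rho>\<^sup>2 / (3 * (1 - \<rho>\<^sup>2))) \<le> (1716 / 10000) * (1 + (1716 / 10000) / (3 * (1 - 1716 / 10000)))"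
      unfolding \<rho>2 using x by (intro mult_mono add_mono) auto
    also have "\<dots> \<le> m\<^sup>2" by (simp add: m_def power2_eq_square)
    finally show ?thesis .
  qed
  have CC: "1 / (1 - m) * (1 / (1 - B)) * (1 / (1 - m) + 1 / (1 - B)) \<le> C"
    by (simp add: m_def B_def C_def)
  note dev = deviation_l2[OF \<rho>(1) \<rho>(2)[folded B_def] _ _ _ mm CC]
  have sm: "summable (\<lambda>n. (norm (deviation n))\<^sup>2 * \<rho> ^ (2 * n))"
    and le: "(\<Sum>n. (norm (deviation n))\<^sup>2 * \<rho> ^ (2 * n)) \<le> C\<^sup>2 * ((1 - b)\<^sup>2 * \<rho>\<^sup>2 + (1 - b\<^sup>2) * \<rho> ^ 4 / 3)"
    by (rule dev; simp add: B_def m_def)+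
  define E where "E n = (norm (deviation n))\<^sup>2 / real (Suc n) * x ^ Suc n" for n
  have E0: "E n \<ge> 0" for n using x by (simp add: E_def)
  \<comment> \<open>\<open>deviation 0\<close> vanishes, so every nonzero term has a denominator of
    at least 2.\<close>
  have Ele: "E n \<le> x / 2 * ((norm (deviation n))\<^sup>2 * \<rho> ^ (2 * n))" for n
  proof (cases n)
    case 0
    then show ?thesis by (simp add: E_def deviation_0)
  next
    case (Suc k)
    have "(norm (deviation n))\<^sup>2 / real (Suc n) \<le> (norm (deviation n))\<^sup>2 / 2"
      using Suc by (intro divide_left_mono) auto
    then have "E n \<le> (norm (deviation n))\<^sup>2 / 2 * x ^ Suc n"
      unfolding E_def using x by (intro mult_right_mono) auto
    then show ?thesis unfolding power_mult \<rho>2 by (simp add: mult_ac)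
  qed
  have smE: "summable E"
    by (rule summable_comparison_test'[OF summable_mult[OF sm, of "x / 2"], of 0]) (use E0 Ele in auto)
  have "suminf E \<le> x / 2 * (\<Sum>n. (norm (deviation n))\<^sup>2 * \<rho> ^ (2 * n))"
    unfolding suminf_mult[OF sm, symmetric] by (rule suminf_le[OF Ele smE summable_mult[OF sm]])
  also have "\<dots> \<le> x / 2 * (C\<^sup>2 * ((1 - b)\<^sup>2 * \<rho>\<^sup>2 + (1 - b\<^sup>2) * \<rho> ^ 4 / 3))"
    using le x by (intro mult_left_mono) auto
  finally have sE: "suminf E \<le> x / 2 * (C\<^sup>2 * ((1 - b)\<^sup>2 * \<rho>\<^sup>2 + (1 - b\<^sup>2) * \<rho> ^ 4 / 3))" .
  define \<delta> where "\<delta> = 1 - \<alpha>"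
  have \<delta>: "0 \<le> \<delta>" "\<delta> \<le> 1 / 100" using \<alpha> by (auto simp: \<delta>_def)
  define k where "k = x / (1 - x)\<^sup>2"
  have kge: "x * (1 + 2 * x) \<le> k"
  proof -
    have "(1 + 2 * x) * (1 - x)\<^sup>2 = 1 - x\<^sup>2 * (3 - 2 * x)" by algebra
    also have "\<dots> \<le> 1" using x by simp
    finally have "1 + 2 * x \<le> 1 / (1 - x)\<^sup>2" using x by (simp add: pos_le_divide_eq)
    then have "x * (1 + 2 * x) \<le> x * (1 / (1 - x)\<^sup>2)" using x by (intro mult_left_mono) auto
    then show ?thesis by (simp add: k_def)
  qed
  have k0: "k \<ge> 0" using x by (simp add: k_def)
  have Ek: "\<alpha>\<^sup>2 * suminf E \<le> (1 - \<alpha>\<^sup>2) * k"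
  proof -
    \<comment> \<open>All quantities are compared as multiples of \<delta>: (1 - b)^2 \<le> 0.04
      \<delta> and 1 - b^2 \<le> 4 \<delta> on the left, 1 - \<alpha>^2 \<ge> 1.99 \<delta> on the
      right.\<close>
    have b1: "1 - b \<le> 2 * \<delta>" "0 \<le> 1 - b" using \<alpha> b_le_1 by (auto simp: \<delta>_def)
    have "(1 - b)\<^sup>2 \<le> (2 * \<delta>)\<^sup>2" using b1 by (intro power_mono) auto
    also have "\<dots> = 4 * (\<delta> * \<delta>)" by (simp add: power2_eq_square)
    also have "\<dots> \<le> 4 * (\<delta> * (1 / 100))" using \<delta> by (intro mult_left_mono) auto
    finally have bb: "(1 - b)\<^sup>2 \<le> \<delta> * (4 / 100)" by simp
    have "1 - b\<^sup>2 = (1 - b) * (1 + b)" by (simp add: power2_eq_square algebra_simps)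
    also have "\<dots> \<le> (2 * \<delta>) * 2" using b1 b \<delta> b_le_1 by (intro mult_mono) auto
    finally have bc: "1 - b\<^sup>2 \<le> \<delta> * 4" by simp
    have \<rho>4: "\<rho> ^ 4 = x\<^sup>2"
    proof -
      have "\<rho> ^ 4 = (\<rho>\<^sup>2)\<^sup>2" by simp
      then show ?thesis by (simp only: \<rho>2)
    qed
    have "(1 - b)\<^sup>2 * \<rho>\<^sup>2 + (1 - b\<^sup>2) * \<rho> ^ 4 / 3 \<le> \<delta> * (4 / 100) * x + \<delta> * 4 * x\<^sup>2 / 3"
      unfolding \<rho>2 \<rho>4 using bb bc x by (intro add_mono mult_right_mono divide_right_mono) auto
    then have "x / 2 * (C\<^sup>2 * ((1 - b)\<^sup>2 * \<rho>\<^sup>2 + (1 - b\<^sup>2) * \<rho> ^ 4 / 3)) \<le> x / 2 * (C\<^sup>2 * (\<delta> * (4 / 100) * x + \<delta> * 4 * x\<^sup>2 / 3))"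
      using x by (intro mult_left_mono) auto
    with sE have "suminf E \<le> x / 2 * (C\<^sup>2 * (\<delta> * (4 / 100) * x + \<delta> * 4 * x\<^sup>2 / 3))" by linarith
    also have "\<dots> = (\<delta> * x) * (C\<^sup>2 / 2 * (4 / 100 * x + 4 / 3 * x\<^sup>2))" by (simp add: algebra_simps)
    also have "\<dots> \<le> (\<delta> * x) * (199 / 100 * (1 + 2 * x))"
    proof (rule mult_left_mono)
      have "C\<^sup>2 / 2 \<le> 5341 / 100" by (simp add: C_def power2_eq_square)
      then have "C\<^sup>2 / 2 * (4 / 100 * x + 4 / 3 * x\<^sup>2) \<le> 5341 / 100 * (4 / 100 * x + 4 / 3 * x\<^sup>2)"
        using x by (intro mult_right_mono) auto
      also have "\<dots> \<le> 199 / 100 * (1 + 2 * x)"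
      proof -
        have "x\<^sup>2 \<le> x * (1716 / 10000)" unfolding power2_eq_square using x by (intro mult_left_mono) auto
        then show ?thesis using x by simp
      qed
      finally show "C\<^sup>2 / 2 * (4 / 100 * x + 4 / 3 * x\<^sup>2) \<le> 199 / 100 * (1 + 2 * x)" .
    qed (use \<delta> x in auto)
    also have "\<dots> = (\<delta> * (199 / 100)) * (x * (1 + 2 * x))" by simp
    also have "\<dots> \<le> (1 - \<alpha>\<^sup>2) * k"
    proof (rule mult_mono[OF _ kge])
      have "1 - \<alpha>\<^sup>2 = \<delta> * (2 - \<delta>)" by (simp add: \<delta>_def power2_eq_square algebra_simps)
      moreover have "\<delta> * (199 / 100) \<le> \<delta> * (2 - \<delta>)" using \<delta> by (intro mult_left_mono) auto
      ultimately show "\<delta> * (199 / 100) \<le> 1 - \<alpha>\<^sup>2" by simp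
    qed (use \<alpha> x in \<open>auto simp: power_le_one\<close>)
    finally have *: "suminf E \<le> (1 - \<alpha>\<^sup>2) * k" .
    have "\<alpha>\<^sup>2 * suminf E \<le> 1 * suminf E"
      using \<alpha> suminf_nonneg[OF smE] E0 by (intro mult_right_mono) (auto simp: power_le_one)
    with * show ?thesis by simp
  qed
  have x1: "x < 1" using x by simp
  have R: "(\<lambda>n. Re (deviation n) * x ^ Suc n) sums (Re (f (of_real x)) - k)"
    unfolding k_def by (rule sums_Re_deviation[OF x(1) x1])
  have R0: "Re (f (of_real x)) - k \<le> 0"
    using schlicht_growth_real[OF f x(1) x1] complex_Re_le_cmod[of "f (of_real x)"] by (simp add: k_def)
  have N: "(\<lambda>n. real (Suc n) * x ^ Suc n) sums k" unfolding k_def using x by (intro sums_koebe) auto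
  \<comment> \<open>Half the right side of the inequality for 2 \<alpha> |a_n|, with |a_n|^2 / n
    expanded and multiplied by the power of x, so that its sum is known.\<close>
  define G where "G n = 1 / 2 * (\<alpha>\<^sup>2 * (real (Suc n) * x ^ Suc n + 2 * (Re (deviation n) * x ^ Suc n) + E n) + real (Suc n) * x ^ Suc n)" for n
  have G: "G sums (1 / 2 * (\<alpha>\<^sup>2 * (k + 2 * (Re (f (of_real x)) - k) + suminf E) + k))"
    unfolding G_def by (intro sums_mult sums_add N R summable_sums smE)
  have le: "\<alpha> * (norm (fps_nth A (Suc n)) * x ^ Suc n) \<le> G n" for n
  proof -
    define c where "c = real (Suc n)"
    define a where "a = norm (fps_nth A (Suc n))"
    have c: "c > 0" by (simp add: c_def)
    have "0 \<le> (\<alpha> * a - c)\<^sup>2" by simp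
    then have "2 * (\<alpha> * a) * c \<le> \<alpha>\<^sup>2 * a\<^sup>2 + c * c" by (simp add: power2_eq_square algebra_simps)
    then have "2 * (\<alpha> * a) \<le> (\<alpha>\<^sup>2 * a\<^sup>2 + c * c) / c" using c by (simp add: pos_le_divide_eq)
    also have "\<dots> = \<alpha>\<^sup>2 * (a\<^sup>2 / c) + c" using c by (simp add: add_divide_distrib)
    also have "a\<^sup>2 / c = c + 2 * Re (deviation n) + (norm (deviation n))\<^sup>2 / c"
      unfolding a_def norm_coeff_square c_def[symmetric] using c by (simp add: add_divide_distrib power2_eq_square)
    finally have "2 * (\<alpha> * a) * x ^ Suc n \<le> (\<alpha>\<^sup>2 * (c + 2 * Re (deviation n) + (norm (deviation n))\<^sup>2 / c) + c) * x ^ Suc n"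
      using x by (intro mult_right_mono) auto
    also have "\<dots> = 2 * G n" unfolding G_def E_def c_def[symmetric] by (simp add: algebra_simps del: power_Suc)
    finally show ?thesis by (simp add: a_def del: power_Suc)
  qed
  have smA: "summable (\<lambda>n. norm (fps_nth A (Suc n)) * x ^ Suc n)"
    using disc_expansion_abs_summable[OF expansion(1) x(1) x1] summable_Suc_iff[of "\<lambda>n. norm (fps_nth A n) * x ^ n"] by simp
  have "\<alpha> * (\<Sum>n. norm (fps_nth A (Suc n)) * x ^ Suc n) = (\<Sum>n. \<alpha> * (norm (fps_nth A (Suc n)) * x ^ Suc n))"
    by (rule suminf_mult[OF smA, symmetric])
  also have "\<dots> \<le> suminf G"
    by (rule suminf_le[OF le summable_mult[OF smA] sums_summable[OF G]])
  also have "\<dots> = 1 / 2 * (\<alpha>\<^sup>2 * (k + 2 * (Re (f (of_real x)) - k) + suminf E) + k)"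
    by (rule sums_unique[OF G, symmetric])
  also have "\<dots> \<le> 1 / 2 * (\<alpha>\<^sup>2 * (k + suminf E) + k)"
    using R0 by (intro mult_left_mono add_right_mono) auto
  also have "\<dots> \<le> k" using Ek by (simp add: algebra_simps)
  finally show ?thesis by (simp add: k_def)
qed

text \<open>No closeness to the Koebe function is needed here. From R = 1/p = 1 + (1 - p) R the
  majorant s of R satisfies s \<le> 1 + m s, so f = z R^2 has a majorant of at most x / (1 - m)^2.
  Since m exceeds x by less than one percent, the factor 99/100 makes up for it.\<close>

lemma majorant_estimate_far:
  assumes \<alpha>: "0 \<le> \<alpha>" "\<alpha> \<le> 99 / 100" and x: "0 \<le> x" "x \<le> 1716 / 10000"
  shows "\<alpha> * (\<Sum>n. norm (fps_nth A (Suc n)) * x ^ Suc n) \<le> x / (1 - x)\<^sup>2"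
proof -
  obtain p P where p: "disc_expansion p P" "fps_nth P 0 = 1" "\<And>z. norm z < 1 \<Longrightarrow> p z \<noteq> 0"
    "\<And>z. norm z < 1 \<Longrightarrow> f z = z / (p z)\<^sup>2"
    and area: "\<And>N. (\<Sum>k\<le>N. real (2 * k + 1) * (norm (fps_nth P (Suc k)))\<^sup>2) \<le> 1"
    by (rule inverse_square_root) blast
  have x1: "x < 1" using x by simp
  \<comment> \<open>1.006^2 exceeds 1 + 0.03 / (3 (1 - 0.03)), the correction factor of
    \<open>majorant_bound\<close> at x^2 = 0.03.\<close>
  define m where "m = 1006 / 1000 * x"
  have m: "0 \<le> m" "m < 1" using x by (auto simp: m_def)
  have mm: "x\<^sup>2 * (1 + x\<^sup>2 / (3 * (1 - x\<^sup>2))) \<le> m\<^sup>2"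
  proof -
    have "x\<^sup>2 \<le> (1716 / 10000)\<^sup>2" using x by (intro power_mono) auto
    then have y: "x\<^sup>2 \<le> 3 / 100" by (simp add: power2_eq_square)
    have "x\<^sup>2 / (3 * (1 - x\<^sup>2)) \<le> (3 / 100) / (3 * (1 - 3 / 100))"
      using y by (intro frac_le) auto
    then have "x\<^sup>2 * (1 + x\<^sup>2 / (3 * (1 - x\<^sup>2))) \<le> x\<^sup>2 * (1006 / 1000)\<^sup>2"
      by (intro mult_left_mono) (auto simp: power2_eq_square)
    also have "x\<^sup>2 * (1006 / 1000)\<^sup>2 = m\<^sup>2" unfolding m_def by (simp only: power_mult_distrib mult.commute)
    finally show ?thesis .
  qed
  have maj: "(\<Sum>k\<le>N. norm (fps_nth P (Suc k)) * x ^ Suc k) \<le> m" for N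
    by (rule majorant_bound[OF area x(1) x1 m(1) mm])
  have holr: "(\<lambda>z. 1 / p z) holomorphic_on unit_disc"
    using p(1,3) by (intro holomorphic_intros) (auto simp: disc_expansion_def)
  define R where "R = fps_expansion (\<lambda>z. 1 / p z) 0"
  have R: "disc_expansion (\<lambda>z. 1 / p z) R" unfolding R_def by (rule disc_expansion_fps_expansion[OF holr])
  have "disc_expansion (\<lambda>z. p z * (1 / p z)) (P * R)" by (rule disc_expansion_mult[OF p(1) R])
  moreover have "disc_expansion (\<lambda>z. p z * (1 / p z)) (fps_const 1)"
    by (rule disc_expansion_cong[OF disc_expansion_const]) (use p(3) in auto)
  ultimately have "P * R = fps_const 1" by (rule disc_expansion_unique)
  then have PR: "R = 1 + (1 - P) * R" by (simp add: left_diff_distrib)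
  define s where "s N = (\<Sum>n\<le>N. norm (fps_nth R n) * x ^ n)" for N
  have s0: "0 \<le> s N" for N unfolding s_def using x by (intro sum_nonneg) auto
  have s: "s N \<le> 1 / (1 - m)" for N
  proof -
    have "s N \<le> (\<Sum>n\<le>N. (if n = 0 then 1 else 0) + fps_nth (fps_majorant (1 - P) * fps_majorant R) n * x ^ n)"
      unfolding s_def
    proof (rule sum_mono)
      fix n
      have "norm (fps_nth R n) \<le> norm (fps_nth (1 :: complex fps) n) + norm (fps_nth ((1 - P) * R) n)"
        by (subst PR) (simp only: fps_add_nth norm_triangle_ineq)
      also have "\<dots> \<le> (if n = 0 then 1 else 0) + fps_nth (fps_majorant (1 - P) * fps_majorant R) n"
        by (intro add_mono norm_fps_mult_nth_le) auto
      finally have "norm (fps_nth R n) * x ^ n \<le> ((if n = 0 then 1 else 0) + fps_nth (fps_majorant (1 - P) * fps_majorant R) n) * x ^ n"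
        using x by (intro mult_right_mono) auto
      then show "norm (fps_nth R n) * x ^ n \<le> (if n = 0 then 1 else 0) + fps_nth (fps_majorant (1 - P) * fps_majorant R) n * x ^ n"
        by (cases n) (simp_all add: distrib_right)
    qed
    also have "\<dots> = 1 + (\<Sum>n\<le>N. fps_nth (fps_majorant (1 - P) * fps_majorant R) n * x ^ n)"
      by (simp add: sum.distrib)
    also have "\<dots> \<le> 1 + (\<Sum>n\<le>N. fps_nth (fps_majorant (1 - P)) n * x ^ n) * (\<Sum>n\<le>N. fps_nth (fps_majorant R) n * x ^ n)"
      using x by (intro add_left_mono fps_mult_partial_sum_le) auto
    also have "\<dots> \<le> 1 + m * s N"
    proof -
      have "(\<Sum>n\<le>N. fps_nth (fps_majorant (1 - P)) n * x ^ n) \<le> m"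
      proof (cases N)
        case 0 then show ?thesis using p(2) m by simp
      next
        case (Suc M)
        have "(\<Sum>n\<le>N. fps_nth (fps_majorant (1 - P)) n * x ^ n) = (\<Sum>k\<le>M. norm (fps_nth P (Suc k)) * x ^ Suc k)"
          unfolding Suc sum.atMost_Suc_shift using p(2) by simp
        then show ?thesis using maj[of M] by simp
      qed
      then show ?thesis using s0[of N] by (simp add: s_def mult_right_mono)
    qed
    finally have "s N * (1 - m) \<le> 1" by (simp add: algebra_simps)
    then show ?thesis using m by (simp add: pos_le_divide_eq)
  qed
  have "disc_expansion (\<lambda>z. 1 / (p z)\<^sup>2) (R * R)"
    using disc_expansion_mult[OF R R] by (simp add: power2_eq_square)
  then have A1: "fps_shift 1 A = R * R" using shift_expansion[OF p] disc_expansion_unique by blast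
  have part: "(\<Sum>n<N. norm (fps_nth A (Suc n)) * x ^ Suc n) \<le> x * (1 / (1 - m) * (1 / (1 - m)))" for N
  proof -
    have "(\<Sum>n<N. norm (fps_nth A (Suc n)) * x ^ Suc n) = x * (\<Sum>n<N. norm (fps_nth (R * R) n) * x ^ n)"
      unfolding A1[symmetric] by (simp add: sum_distrib_left mult_ac)
    also have "(\<Sum>n<N. norm (fps_nth (R * R) n) * x ^ n) \<le> (\<Sum>n\<le>N. norm (fps_nth (R * R) n) * x ^ n)"
      using x by (intro sum_mono2) auto
    also have "\<dots> \<le> (\<Sum>n\<le>N. fps_nth (fps_majorant R * fps_majorant R) n * x ^ n)"
      using x by (intro sum_mono mult_right_mono norm_fps_mult_nth_le) auto
    also have "\<dots> \<le> s N * s N"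
      using fps_mult_partial_sum_le[of "fps_majorant R" "fps_majorant R" x N] x by (simp add: s_def)
    also have "\<dots> \<le> 1 / (1 - m) * (1 / (1 - m))"
      using s[of N] s0[of N] m by (intro mult_mono) auto
    finally show ?thesis using x by (simp add: mult_left_mono)
  qed
  have smA: "summable (\<lambda>n. norm (fps_nth A (Suc n)) * x ^ Suc n)"
    using disc_expansion_abs_summable[OF expansion(1) x(1) x1] summable_Suc_iff[of "\<lambda>n. norm (fps_nth A n) * x ^ n"] by simp
  have "(\<Sum>n. norm (fps_nth A (Suc n)) * x ^ Suc n) \<le> x * (1 / (1 - m) * (1 / (1 - m)))"
    by (rule suminf_le_const[OF smA part])
  then have "\<alpha> * (\<Sum>n. norm (fps_nth A (Suc n)) * x ^ Suc n) \<le> (99 / 100) * (x * (1 / (1 - m) * (1 / (1 - m))))"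
    using \<alpha> x m by (intro mult_mono suminf_nonneg[OF smA]) auto
  also have "\<dots> \<le> x / (1 - x)\<^sup>2"
  proof -
    \<comment> \<open>The square of 995/1000 is above 99/100, and the inequality holds because x is
      below 5/11.\<close>
    have "995 / 1000 * (1 - x) \<le> 1 - m" using x by (simp add: m_def)
    then have "(995 / 1000 * (1 - x))\<^sup>2 \<le> (1 - m)\<^sup>2" using x by (intro power_mono) auto
    then have "(995 / 1000)\<^sup>2 * (1 - x)\<^sup>2 \<le> (1 - m)\<^sup>2" by (simp only: power_mult_distrib)
    moreover have "99 / 100 * (1 - x)\<^sup>2 \<le> (995 / 1000)\<^sup>2 * (1 - x)\<^sup>2"
      by (intro mult_right_mono) (simp_all add: power2_eq_square)
    ultimately have "99 / 100 * (1 - x)\<^sup>2 \<le> (1 - m)\<^sup>2" by linarith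
    then have "99 / 100 / (1 - m)\<^sup>2 \<le> 1 / (1 - x)\<^sup>2"
      using x m by (simp add: pos_divide_le_eq pos_le_divide_eq)
    then have "x * (99 / 100 / (1 - m)\<^sup>2) \<le> x * (1 / (1 - x)\<^sup>2)" using x by (intro mult_left_mono) auto
    then show ?thesis by (simp add: power2_eq_square)
  qed
  finally show ?thesis .
qed

end

section \<open>From normalised to arbitrary univalent functions\<close>

text \<open>The bound \<alpha> \<le> 1 obtained on the way is Koebe's quarter theorem. A rotation
  makes the second coefficient real and nonnegative without changing any modulus, and the first
  estimate is split at \<alpha> = 99/100.\<close>

lemma schlicht_estimates:
  assumes f: "schlicht f A" and om: "\<omega> \<notin> f ` unit_disc" and x: "0 \<le> x" "x \<le> 1716 / 10000"
  defines "\<alpha> \<equiv> 1 / (4 * norm \<omega>)"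
  shows "\<alpha> * (\<Sum>n. norm (fps_nth A (Suc n)) * x ^ Suc n) \<le> x / (1 - x)\<^sup>2"
    and "\<alpha>\<^sup>2 * (\<Sum>n. real (Suc n) * (norm (fps_nth A (Suc n)))\<^sup>2 * (x\<^sup>2) ^ Suc n) \<le> x\<^sup>2 * (1 + 4 * x\<^sup>2 + (x\<^sup>2)\<^sup>2) / (1 - x\<^sup>2) ^ 4"
    and "summable (\<lambda>n. real (Suc n) * (norm (fps_nth A (Suc n)))\<^sup>2 * (x\<^sup>2) ^ Suc n)"
proof -
  have A: "disc_expansion f A" and inj: "inj_on f unit_disc" and A01: "fps_nth A 0 = 0" "fps_nth A 1 = 1"
    using f by (auto simp: schlicht_def)
  have "f 0 = 0" using disc_expansion_at_0[OF A] A01 by simp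
  then have om0: "\<omega> \<noteq> 0" using om by (metis centre_in_ball image_eqI zero_less_one)
  define b where "b = norm (fps_nth A 2) / 2"
  have "norm (1 / \<omega>) \<le> norm (fps_nth A 2 + 1 / \<omega>) + norm (fps_nth A 2)"
    by (metis add_diff_cancel_left' norm_triangle_ineq4)
  then have \<alpha>b: "4 * \<alpha> \<le> 2 + 2 * b"
    using schlicht_omitted_value[OF f om] by (simp add: \<alpha>_def b_def norm_divide)
  have "b \<le> 1" using bieberbach_second_coeff[OF f] by (simp add: b_def)
  then have \<alpha>1: "\<alpha> \<le> 1" "2 * \<alpha> - 1 \<le> b" using \<alpha>b by linarith+
  have "0 < \<alpha>" using om0 by (simp add: \<alpha>_def)
  note \<alpha> = this \<alpha>1
  \<comment> \<open>\<open>sgn 0\<close> is 0 and would give no rotation, so c = 1 is used when the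
    second coefficient vanishes.\<close>
  define c where "c = (if fps_nth A 2 = 0 then 1 else cnj (sgn (fps_nth A 2)))"
  have c1: "norm c = 1" by (simp add: c_def norm_sgn)
  then have c0: "c \<noteq> 0" by auto
  have cA: "c * fps_nth A 2 = of_real (2 * b)"
  proof (cases "fps_nth A 2 = 0")
    case False
    have "cnj (sgn (fps_nth A 2)) * fps_nth A 2 = of_real (norm (fps_nth A 2))"
      using False complex_norm_square[of "fps_nth A 2"] by (simp add: sgn_eq field_simps power2_eq_square)
    then show ?thesis using False by (simp add: c_def b_def)
  qed (simp add: b_def)
  define g where "g z = inverse c * f (c * z)" for z
  define G where "G = fps_const (inverse c) * fps_compose A (fps_const c * fps_X)"
  have rot: "(\<lambda>z. c * z) ` unit_disc \<subseteq> unit_disc" using c1 by (auto simp: norm_mult)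
  have "disc_expansion (\<lambda>z. c * z) (fps_const c * fps_X)"
    by (intro disc_expansion_mult disc_expansion_const disc_expansion_X)
  then have "disc_expansion (\<lambda>z. f (c * z)) (fps_compose A (fps_const c * fps_X))"
    by (rule disc_expansion_compose[OF A]) (use rot in auto)
  then have G: "disc_expansion g G"
    unfolding g_def G_def by (intro disc_expansion_mult disc_expansion_const)
  have Gn: "fps_nth G n = inverse c * (c ^ n * fps_nth A n)" for n
    by (simp add: G_def fps_compose_linear)
  have "inj_on g unit_disc"
  proof (rule inj_onI)
    fix u v assume uv: "u \<in> unit_disc" "v \<in> unit_disc" "g u = g v"
    then have "f (c * u) = f (c * v)" using c0 by (simp add: g_def)
    then have "c * u = c * v" using inj_onD[OF inj] rot uv by blast
    then show "u = v" using c0 by simp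
  qed
  then have sg: "schlicht g G" using G A01 c0 by (simp add: schlicht_def Gn)
  have G2: "fps_nth G 2 = of_real (2 * b)"
  proof -
    have "inverse c * (c ^ 2 * fps_nth A 2) = (inverse c * c) * (c * fps_nth A 2)"
      by (simp add: power2_eq_square)
    then show ?thesis using c0 cA by (simp add: Gn)
  qed
  have nG: "norm (fps_nth G n) = norm (fps_nth A n)" for n
    by (simp add: Gn norm_mult norm_power norm_inverse c1)
  interpret schlicht_near_koebe g G b
    by standard (use sg G2 in \<open>auto simp: b_def\<close>)
  show "\<alpha> * (\<Sum>n. norm (fps_nth A (Suc n)) * x ^ Suc n) \<le> x / (1 - x)\<^sup>2"
  proof (cases "\<alpha> \<le> 99 / 100")
    case True
    then show ?thesis using majorant_estimate_far[OF _ _ x, of \<alpha>] \<alpha> by (simp add: nG)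
  next
    case False
    then show ?thesis using majorant_estimate_near[OF _ \<alpha>(2,3) x] by (simp add: nG)
  qed
  show "\<alpha>\<^sup>2 * (\<Sum>n. real (Suc n) * (norm (fps_nth A (Suc n)))\<^sup>2 * (x\<^sup>2) ^ Suc n) \<le> x\<^sup>2 * (1 + 4 * x\<^sup>2 + (x\<^sup>2)\<^sup>2) / (1 - x\<^sup>2) ^ 4"
    and "summable (\<lambda>n. real (Suc n) * (norm (fps_nth A (Suc n)))\<^sup>2 * (x\<^sup>2) ^ Suc n)"
    using area_estimate[OF \<alpha> x] by (simp_all only: nG)
qed

text \<open>Otherwise the inverse would be entire and bounded. This keeps the frontier nonempty:
  \<open>infdist\<close> to the empty set has the default value 0.\<close>

lemma univalent_image_neq_UNIV:
  assumes hol: "\<phi> holomorphic_on unit_disc" and inj: "inj_on \<phi> unit_disc"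
  shows "\<phi> ` unit_disc \<noteq> UNIV"
proof
  assume U: "\<phi> ` unit_disc = UNIV"
  obtain g where g: "g holomorphic_on (\<phi> ` unit_disc)" "\<And>z. z \<in> unit_disc \<Longrightarrow> g (\<phi> z) = z"
    by (rule holomorphic_has_inverse[OF hol open_ball inj]) blast
  have gd: "g w \<in> unit_disc" for w
  proof -
    have "w \<in> \<phi> ` unit_disc" using U by simp
    then obtain z where "z \<in> unit_disc" "w = \<phi> z" by blast
    then show ?thesis using g(2) by simp
  qed
  then have "range g \<subseteq> unit_disc" by blast
  then have "bounded (range g)" by (rule bounded_subset[OF bounded_ball])
  then obtain c where c: "\<And>w. g w = c"
    using Liouville_theorem[of g] g(1) U unfolding constant_on_def by auto
  have "g (\<phi> 0) = 0" "g (\<phi> (1/2)) = 1/2" by (intro g(2); simp)+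
  then show False using c by simp
qed

text \<open>A nearest boundary point exists because the frontier is closed, and it is omitted
  because the image is open.\<close>

lemma univalent_nearest_omitted:
  assumes hol: "\<phi> holomorphic_on unit_disc" and inj: "inj_on \<phi> unit_disc"
  obtains w where "w \<notin> \<phi> ` unit_disc" "norm (w - \<phi> 0) = infdist (\<phi> 0) (frontier (\<phi> ` unit_disc))"
proof -
  have op: "open (\<phi> ` unit_disc)" by (rule open_mapping_thm3[OF hol open_ball inj])
  have "frontier (\<phi> ` unit_disc) \<noteq> {}"
    using univalent_image_neq_UNIV[OF assms] by (auto simp: frontier_eq_empty)
  then obtain w where w: "w \<in> frontier (\<phi> ` unit_disc)" "infdist (\<phi> 0) (frontier (\<phi> ` unit_disc)) = dist (\<phi> 0) w"
    by (rule infdist_attains_inf[OF frontier_closed])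
  show ?thesis
  proof (rule that)
    show "w \<notin> \<phi> ` unit_disc" using w(1) op by (metis frontier_disjoint_eq disjoint_iff)
    show "norm (w - \<phi> 0) = infdist (\<phi> 0) (frontier (\<phi> ` unit_disc))"
      using w(2) by (simp add: dist_norm norm_minus_commute)
  qed
qed

text \<open>The omitted value nearest to \<phi> 0 becomes \<omega> after normalisation, so
  |\<omega>| |\<phi>'(0)| = d, and the factor \<alpha> in \<open>schlicht_estimates\<close> is
  exactly |\<phi>'(0)| / (4 d).\<close>

lemma univalent_estimates:
  assumes hol: "\<phi> holomorphic_on unit_disc" and inj: "inj_on \<phi> unit_disc" and \<Phi>: "disc_expansion \<phi> \<Phi>"
    and x: "0 \<le> x" "x \<le> 1716 / 10000"
  defines "d \<equiv> infdist (\<phi> 0) (frontier (\<phi> ` unit_disc))"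
  shows "(\<Sum>n<N. norm (fps_nth \<Phi> (Suc n)) * x ^ Suc n) \<le> 4 * d * (x / (1 - x)\<^sup>2)"
    and "(\<Sum>n<N. real (Suc n) * (norm (fps_nth \<Phi> (Suc n)))\<^sup>2 * (x\<^sup>2) ^ Suc n) \<le> 16 * d\<^sup>2 * (x\<^sup>2 * (1 + 4 * x\<^sup>2 + (x\<^sup>2)\<^sup>2) / (1 - x\<^sup>2) ^ 4)"
    and "d > 0"
proof -
  define c where "c = deriv \<phi> 0"
  define f where "f z = (\<phi> z - \<phi> 0) / c" for z
  define A where "A = fps_const (1 / c) * (fps_expansion \<phi> 0 - fps_const (\<phi> 0))"
  have c0: "c \<noteq> 0" and f: "schlicht f A"
    using schlicht_normalization[OF hol inj] unfolding c_def f_def A_def by auto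
  have "fps_expansion \<phi> 0 = \<Phi>" using disc_expansion_unique[OF disc_expansion_fps_expansion[OF hol] \<Phi>] .
  then have An: "fps_nth A (Suc n) = fps_nth \<Phi> (Suc n) / c" for n by (simp add: A_def)
  then have nA: "norm (fps_nth \<Phi> (Suc n)) = norm c * norm (fps_nth A (Suc n))" for n
    using c0 by (simp add: norm_divide)
  obtain w where w: "w \<notin> \<phi> ` unit_disc" "norm (w - \<phi> 0) = d"
    unfolding d_def by (rule univalent_nearest_omitted[OF hol inj])
  have "w \<noteq> \<phi> 0" using w(1) by (metis centre_in_ball image_eqI zero_less_one)
  then show d0: "d > 0" using w(2) by auto
  define \<omega> where "\<omega> = (w - \<phi> 0) / c"
  have om: "\<omega> \<notin> f ` unit_disc"
  proof
    assume "\<omega> \<in> f ` unit_disc"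
    then obtain z where "z \<in> unit_disc" "(w - \<phi> 0) / c = (\<phi> z - \<phi> 0) / c" by (auto simp: f_def \<omega>_def)
    then show False using w(1) c0 by auto
  qed
  define \<alpha> where "\<alpha> = 1 / (4 * norm \<omega>)"
  have \<alpha>: "norm c = 4 * d * \<alpha>" using d0 c0 w(2) by (simp add: \<alpha>_def \<omega>_def norm_divide)
  note est = schlicht_estimates[OF f om x, folded \<alpha>_def]
  have A: "disc_expansion f A" using f by (simp add: schlicht_def)
  have x1: "x < 1" using x by simp
  have smA: "summable (\<lambda>n. norm (fps_nth A (Suc n)) * x ^ Suc n)"
    using disc_expansion_abs_summable[OF A x(1) x1] summable_Suc_iff[of "\<lambda>n. norm (fps_nth A n) * x ^ n"] by simp
  have "(\<Sum>n<N. norm (fps_nth \<Phi> (Suc n)) * x ^ Suc n) = norm c * (\<Sum>n<N. norm (fps_nth A (Suc n)) * x ^ Suc n)"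
    unfolding nA sum_distrib_left mult.assoc ..
  also have "\<dots> \<le> norm c * (\<Sum>n. norm (fps_nth A (Suc n)) * x ^ Suc n)"
    using x by (intro mult_left_mono sum_le_suminf smA) auto
  also have "\<dots> = 4 * d * (\<alpha> * (\<Sum>n. norm (fps_nth A (Suc n)) * x ^ Suc n))"
    unfolding \<alpha> by (simp only: mult.assoc)
  also have "\<dots> \<le> 4 * d * (x / (1 - x)\<^sup>2)" using est(1) d0 by (intro mult_left_mono) auto
  finally show "(\<Sum>n<N. norm (fps_nth \<Phi> (Suc n)) * x ^ Suc n) \<le> 4 * d * (x / (1 - x)\<^sup>2)" .
  have "(\<Sum>n<N. real (Suc n) * (norm (fps_nth \<Phi> (Suc n)))\<^sup>2 * (x\<^sup>2) ^ Suc n) =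
    (norm c)\<^sup>2 * (\<Sum>n<N. real (Suc n) * (norm (fps_nth A (Suc n)))\<^sup>2 * (x\<^sup>2) ^ Suc n)"
    unfolding nA power_mult_distrib sum_distrib_left by (intro sum.cong refl) (simp only: mult_ac)
  also have "\<dots> \<le> (norm c)\<^sup>2 * (\<Sum>n. real (Suc n) * (norm (fps_nth A (Suc n)))\<^sup>2 * (x\<^sup>2) ^ Suc n)"
    using x by (intro mult_left_mono sum_le_suminf est(3)) auto
  also have "(norm c)\<^sup>2 = 16 * d\<^sup>2 * \<alpha>\<^sup>2" unfolding \<alpha> by (simp add: power_mult_distrib)
  also have "16 * d\<^sup>2 * \<alpha>\<^sup>2 * (\<Sum>n. real (Suc n) * (norm (fps_nth A (Suc n)))\<^sup>2 * (x\<^sup>2) ^ Suc n) =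
    16 * d\<^sup>2 * (\<alpha>\<^sup>2 * (\<Sum>n. real (Suc n) * (norm (fps_nth A (Suc n)))\<^sup>2 * (x\<^sup>2) ^ Suc n))"
    by (simp only: mult.assoc)
  also have "\<dots> \<le> 16 * d\<^sup>2 * (x\<^sup>2 * (1 + 4 * x\<^sup>2 + (x\<^sup>2)\<^sup>2) / (1 - x\<^sup>2) ^ 4)"
    using est(2) by (intro mult_left_mono) auto
  finally show "(\<Sum>n<N. real (Suc n) * (norm (fps_nth \<Phi> (Suc n)))\<^sup>2 * (x\<^sup>2) ^ Suc n) \<le> 16 * d\<^sup>2 * (x\<^sup>2 * (1 + 4 * x\<^sup>2 + (x\<^sup>2)\<^sup>2) / (1 - x\<^sup>2) ^ 4)" .
qed

section \<open>The radius equation and the Bohr inequality\<close>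

definition radius_fun :: "real \<Rightarrow> real \<Rightarrow> real \<Rightarrow> real" where
  "radius_fun K \<mu> r = (1 - r\<^sup>2)\<^sup>2 - (8 * K / (K + 1)) * r * (1 + r)\<^sup>2 - 4 * \<mu> * r * sqrt (r ^ 4 + 4 * r\<^sup>2 + 1)"

lemma radius_fun_strict_decreasing:
  assumes K: "K \<ge> 1" and \<mu>: "\<mu> \<ge> 0" and rs: "0 \<le> r" "r < s" "s \<le> 1"
  shows "radius_fun K \<mu> s < radius_fun K \<mu> r"
proof -
  have "r\<^sup>2 < s\<^sup>2" using rs by (intro power_strict_mono) auto
  moreover have "s\<^sup>2 \<le> 1" using rs by (simp add: power_le_one)
  ultimately have "(1 - s\<^sup>2)\<^sup>2 < (1 - r\<^sup>2)\<^sup>2" by (intro power_strict_mono) auto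
  moreover have "(8 * K / (K + 1)) * r * (1 + r)\<^sup>2 \<le> (8 * K / (K + 1)) * s * (1 + s)\<^sup>2"
    using K rs by (intro mult_mono power_mono) auto
  moreover have "4 * \<mu> * r * sqrt (r ^ 4 + 4 * r\<^sup>2 + 1) \<le> 4 * \<mu> * s * sqrt (s ^ 4 + 4 * s\<^sup>2 + 1)"
    using \<mu> rs by (intro mult_mono real_sqrt_le_mono add_mono power_mono) auto
  ultimately show ?thesis unfolding radius_fun_def by linarith
qed

lemma radius_fun_continuous: "isCont (radius_fun K \<mu>) r"
  unfolding radius_fun_def by (intro continuous_intros)

text \<open>The value at 0 is 1; at 1/3 it is negative already for K = 1 and \<mu> = 0, and larger
  parameters only lower it.\<close>

lemma radius_fun_root_unique:
  assumes K: "K \<ge> 1" and \<mu>: "\<mu> \<ge> 0"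
  shows "\<exists>!r. r \<in> {0<..<1/3} \<and> radius_fun K \<mu> r = 0"
proof -
  have 0: "radius_fun K \<mu> 0 = 1" by (simp add: radius_fun_def)
  have 1: "radius_fun K \<mu> (1/3) < 0"
  proof -
    have "4 \<le> 8 * K / (K + 1)" using K by (simp add: pos_le_divide_eq)
    then have "4 * (1/3) * (1 + 1/3)\<^sup>2 \<le> (8 * K / (K + 1)) * (1/3) * (1 + 1/3)\<^sup>2"
      by (intro mult_right_mono) auto
    moreover have "0 \<le> 4 * \<mu> * (1/3) * sqrt ((1/3) ^ 4 + 4 * (1/3)\<^sup>2 + 1)" using \<mu> by simp
    moreover have "(1 - (1/3)\<^sup>2)\<^sup>2 < 4 * (1/3) * (1 + 1/3 :: real)\<^sup>2" by (simp add: power2_eq_square)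
    ultimately show ?thesis unfolding radius_fun_def by linarith
  qed
  obtain r where r: "0 \<le> r" "r \<le> 1/3" "radius_fun K \<mu> r = 0"
    using IVT2[of "radius_fun K \<mu>" "1/3" 0 0] 0 1 radius_fun_continuous by auto
  have "r \<noteq> 0" using r(3) 0 by auto
  moreover have "r \<noteq> 1/3" using r(3) 1 by (metis less_irrefl)
  ultimately have "r \<in> {0<..<1/3} \<and> radius_fun K \<mu> r = 0" using r by auto
  moreover have "s = r" if "s \<in> {0<..<1/3} \<and> radius_fun K \<mu> s = 0" for s
    using radius_fun_strict_decreasing[OF K \<mu>, of r s] radius_fun_strict_decreasing[OF K \<mu>, of s r] that r
    by (cases r s rule: linorder_cases) auto
  ultimately show ?thesis by blast
qed

text \<open>Since 8 K / (K + 1) \<ge> 4 and \<mu> \<ge> 0, a root satisfies 4 r \<le> (1 - r)^2, so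
  it cannot lie between 3 - 2 sqrt 2 and 1/3.\<close>

lemma radius_root_le:
  assumes K: "K \<ge> 1" and \<mu>: "\<mu> \<ge> 0" and r: "0 < r" "r < 1/3" "radius_fun K \<mu> r = 0"
  shows "r \<le> 1716 / 10000"
proof (rule ccontr)
  assume "\<not> r \<le> 1716 / 10000"
  then have gt: "r > 1716 / 10000" by simp
  have "4 \<le> 8 * K / (K + 1)" using K by (simp add: pos_le_divide_eq)
  then have "4 * r * (1 + r)\<^sup>2 \<le> (8 * K / (K + 1)) * r * (1 + r)\<^sup>2"
    using r by (intro mult_right_mono) auto
  moreover have "0 \<le> 4 * \<mu> * r * sqrt (r ^ 4 + 4 * r\<^sup>2 + 1)" using \<mu> r by simp
  ultimately have "4 * r * (1 + r)\<^sup>2 \<le> (1 - r\<^sup>2)\<^sup>2" using r(3) unfolding radius_fun_def by linarith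
  also have "(1 - r\<^sup>2)\<^sup>2 = (1 - r)\<^sup>2 * (1 + r)\<^sup>2" by algebra
  finally have "4 * r \<le> (1 - r)\<^sup>2" using r by simp
  then have "0 \<le> 1 - 6 * r + r * r" by (simp add: power2_eq_square algebra_simps)
  \<comment> \<open>Positivity of (r - 0.1716) (1/3 - r) bounds r^2 by an affine function of r,
    which makes the contradiction linear.\<close>
  moreover have "0 < r * (15148 / 30000) - 1716 / 30000 - r * r"
  proof -
    have "0 < (r - 1716 / 10000) * (1/3 - r)" using gt r by simp
    also have "\<dots> = r * (15148 / 30000) - 1716 / 30000 - r * r" by algebra
    finally show ?thesis .
  qed
  ultimately show False using gt by argo
qed

text \<open>The left side is four times the Bohr sum of the Koebe mapping with g = k h, so it equals
  1 exactly at a root. Both the inequality and its sharpness are read off from this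
  identity.\<close>

lemma radius_fun_factor:
  assumes "0 \<le> r" "r < 1"
  shows "(8 * K / (K + 1)) * (r / (1 - r)\<^sup>2) + 4 * \<mu> * (r * sqrt (r ^ 4 + 4 * r\<^sup>2 + 1) / (1 - r\<^sup>2)\<^sup>2) =
    1 - radius_fun K \<mu> r / (1 - r\<^sup>2)\<^sup>2"
proof -
  have e: "(1 - r\<^sup>2)\<^sup>2 = (1 - r)\<^sup>2 * (1 + r)\<^sup>2" by algebra
  have nz: "1 - r \<noteq> 0" "1 + r \<noteq> 0" using assms by auto
  then have D: "(1 - r\<^sup>2)\<^sup>2 \<noteq> 0" unfolding e by simp
  have "r / (1 - r)\<^sup>2 = r * (1 + r)\<^sup>2 / (1 - r\<^sup>2)\<^sup>2" unfolding e using nz by simp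
  then show ?thesis using D unfolding radius_fun_def by (simp add: diff_divide_distrib)
qed

text \<open>Rogosinski's inequality for partial sums is weighted by n r^(2n) through summation by
  parts. These weights do not increase as long as (n + 1) r^2 \<le> n, and the worst case n = 1 is
  r^2 \<le> 1/2.\<close>

lemma subordinate_area_partial_sum:
  assumes w: "schwarz_function w W" and r: "0 \<le> r" "r\<^sup>2 \<le> 1/2"
  shows "(\<Sum>n<N. real (Suc n) * (norm (fps_nth (fps_compose \<Phi> W) (Suc n)))\<^sup>2 * (r\<^sup>2) ^ Suc n) \<le>
    (\<Sum>n<N. real (Suc n) * (norm (fps_nth \<Phi> (Suc n)))\<^sup>2 * (r\<^sup>2) ^ Suc n)"
proof (cases N)
  case (Suc M)
  interpret schwarz_function w W by (rule w)
  have "(\<Sum>n\<le>M. real (Suc n) * (r\<^sup>2) ^ Suc n * (norm (fps_nth (fps_compose \<Phi> W) (Suc n)))\<^sup>2) \<le>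
     (\<Sum>n\<le>M. real (Suc n) * (r\<^sup>2) ^ Suc n * (norm (fps_nth \<Phi> (Suc n)))\<^sup>2)"
  proof (rule weighted_partial_sums_le)
    fix L
    show "(\<Sum>n\<le>L. (norm (fps_nth (fps_compose \<Phi> W) (Suc n)))\<^sup>2) \<le> (\<Sum>n\<le>L. (norm (fps_nth \<Phi> (Suc n)))\<^sup>2)"
      using subordinate_l2[of \<Phi> "Suc L"] by (simp only: sum.atMost_Suc_shift) simp
    show "0 \<le> real (Suc L) * (r\<^sup>2) ^ Suc L" by simp
    have "real (Suc (Suc L)) * r\<^sup>2 \<le> real (Suc (Suc L)) * (1/2)" using r by (intro mult_left_mono) auto
    also have "\<dots> \<le> real (Suc L)" by simp
    finally have "(real (Suc (Suc L)) * r\<^sup>2) * (r\<^sup>2) ^ Suc L \<le> real (Suc L) * (r\<^sup>2) ^ Suc L"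
      by (intro mult_right_mono) auto
    then show "real (Suc (Suc L)) * (r\<^sup>2) ^ Suc (Suc L) \<le> real (Suc L) * (r\<^sup>2) ^ Suc L"
      by (simp only: power_Suc mult_ac)
  qed
  then show ?thesis unfolding Suc lessThan_Suc_atMost by (simp only: mult_ac)
qed simp

text \<open>Stated for nonnegative \<open>radius_fun\<close> instead of r \<le> \<open>r0\<close>;
  strict monotonicity links the two conditions.\<close>

lemma bohr_inequality:
  assumes adm: "admissible K f h g a b \<phi>" and K: "K \<ge> 1" and \<mu>: "\<mu> \<ge> 0"
    and r: "0 \<le> r" "r \<le> 1716 / 10000" and F: "0 \<le> radius_fun K \<mu> r"
  shows "bohr_ineq \<mu> h a b \<phi> r"
proof -
  have holh: "h holomorphic_on unit_disc" and holg: "g holomorphic_on unit_disc"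
    and ah: "\<And>z. z \<in> unit_disc \<Longrightarrow> (\<lambda>n. a n * z ^ n) sums h z"
    and bg: "\<And>z. z \<in> unit_disc \<Longrightarrow> (\<lambda>n. b (Suc n) * z ^ Suc n) sums g z"
    and qc: "\<And>z. z \<in> unit_disc \<Longrightarrow> deriv h z \<noteq> 0" "\<And>z. z \<in> unit_disc \<Longrightarrow> norm (dilatation h g z) \<le> (K - 1) / (K + 1)"
    and hol\<phi>: "\<phi> holomorphic_on unit_disc" and inj\<phi>: "inj_on \<phi> unit_disc" and sub: "subordinate h \<phi>"
    using adm unfolding admissible_def harmonic_mapping_def quasiconformal_def sense_preserving_locally_univalent_def by auto
  obtain w where w: "w holomorphic_on unit_disc" "w ` unit_disc \<subseteq> unit_disc" "w 0 = 0"
    and hw: "\<And>z. z \<in> unit_disc \<Longrightarrow> h z = \<phi> (w z)"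
    using sub unfolding subordinate_def by blast
  define \<Phi> where "\<Phi> = fps_expansion \<phi> 0"
  define W where "W = fps_expansion w 0"
  have \<Phi>: "disc_expansion \<phi> \<Phi>" unfolding \<Phi>_def by (rule disc_expansion_fps_expansion[OF hol\<phi>])
  have W: "disc_expansion w W" unfolding W_def by (rule disc_expansion_fps_expansion[OF w(1)])
  interpret schwarz_function w W using W w by unfold_locales auto
  define H where "H = fps_compose \<Phi> W"
  have "disc_expansion (\<lambda>z. \<phi> (w z)) H" unfolding H_def by (rule disc_expansion_compose[OF \<Phi> W W0 w(2)])
  then have H: "disc_expansion h H" by (rule disc_expansion_cong) (rule hw)
  have "disc_expansion h (Abs_fps a)" by (rule disc_expansionI) (use ah in simp)
  then have Ha: "fps_nth H n = a n" for n using disc_expansion_unique[OF H] by simp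
  \<comment> \<open>The value \<open>b 0\<close> is arbitrary, so the constant term of g is set to 0
    explicitly.\<close>
  define G where "G = Abs_fps (\<lambda>n. if n = 0 then 0 else b n)"
  have G: "disc_expansion g G" unfolding G_def
  proof (rule disc_expansionI)
    fix z :: complex assume "norm z < 1"
    then have "(\<lambda>n. b (Suc n) * z ^ Suc n) sums g z" using bg by simp
    then show "(\<lambda>n. (if n = 0 then 0 else b n) * z ^ n) sums g z"
      using sums_Suc_iff[of "\<lambda>n. (if n = 0 then 0 else b n) * z ^ n" "g z"] by simp
  qed
  have Gb: "fps_nth G (Suc n) = b (Suc n)" for n by (simp add: G_def)
  define k where "k = (K - 1) / (K + 1)"
  \<comment> \<open>1 + k is the factor by which the |b_n| enlarge the bound on the majorant of h;
    times 4 from the Koebe bound it is the constant 8 K / (K + 1).\<close>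
  have k: "1 + k = 2 * K / (K + 1)" "0 \<le> k" using K by (auto simp: k_def field_simps)
  have holom: "dilatation h g holomorphic_on unit_disc"
    unfolding dilatation_def using qc(1) holg holh by (intro holomorphic_intros holomorphic_deriv) auto
  define Om where "Om = fps_expansion (dilatation h g) 0"
  have Om: "disc_expansion (dilatation h g) Om" unfolding Om_def by (rule disc_expansion_fps_expansion[OF holom])
  have "disc_expansion (\<lambda>z. dilatation h g z * deriv h z) (Om * fps_deriv H)"
    by (rule disc_expansion_mult[OF Om disc_expansion_deriv[OF H]])
  moreover have "disc_expansion (\<lambda>z. dilatation h g z * deriv h z) (fps_deriv G)"
    by (rule disc_expansion_cong[OF disc_expansion_deriv[OF G]]) (use qc(1) in \<open>simp add: dilatation_def\<close>)
  ultimately have GH: "fps_deriv G = Om * fps_deriv H" using disc_expansion_unique by blast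
  define d where "d = infdist (\<phi> 0) (frontier (\<phi> ` unit_disc))"
  note est = univalent_estimates[OF hol\<phi> inj\<phi> \<Phi> r, folded d_def]
  have r3: "r \<le> 1/3" and r1: "r < 1" using r by auto
  have a_part: "(\<Sum>n<N. norm (a (Suc n)) * r ^ Suc n) \<le> 4 * d * (r / (1 - r)\<^sup>2)" for N
  proof -
    have "(\<Sum>n<N. norm (fps_nth H (Suc n)) * r ^ Suc n) \<le> (\<Sum>n<N. norm (fps_nth \<Phi> (Suc n)) * r ^ Suc n)"
      unfolding H_def by (rule subordinate_majorant[OF r(1) r3])
    also have "\<dots> \<le> 4 * d * (r / (1 - r)\<^sup>2)" by (rule est(1))
    finally show ?thesis by (simp only: Ha)
  qed
  have ab_part: "(\<Sum>n<N. (norm (a (Suc n)) + norm (b (Suc n))) * r ^ Suc n) \<le> d * (8 * K / (K + 1) * (r / (1 - r)\<^sup>2))" for N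
  proof -
    have "(\<Sum>n<N. norm (b (Suc n)) * r ^ Suc n) \<le> k * (\<Sum>n<N. norm (a (Suc n)) * r ^ Suc n)"
    proof (cases N)
      case (Suc M)
      show ?thesis
        using dilatation_majorant[OF Om _ GH r(1) r3, of k M] qc(2)
        unfolding Suc lessThan_Suc_atMost by (simp add: Gb Ha k_def)
    qed simp
    then have "(\<Sum>n<N. (norm (a (Suc n)) + norm (b (Suc n))) * r ^ Suc n) \<le> (1 + k) * (\<Sum>n<N. norm (a (Suc n)) * r ^ Suc n)"
      by (simp only: distrib_right sum.distrib mult_1)
    also have "\<dots> \<le> (1 + k) * (4 * d * (r / (1 - r)\<^sup>2))"
      using k a_part[of N] by (intro mult_left_mono) auto
    also have "\<dots> = d * (8 * K / (K + 1) * (r / (1 - r)\<^sup>2))" unfolding k by simp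
    finally show ?thesis .
  qed
  have s1: "(\<Sum>n. (norm (a (Suc n)) + norm (b (Suc n))) * r ^ Suc n) \<le> d * (8 * K / (K + 1) * (r / (1 - r)\<^sup>2))"
  proof (rule suminf_le_const[OF _ ab_part])
    show "summable (\<lambda>n. (norm (a (Suc n)) + norm (b (Suc n))) * r ^ Suc n)"
      by (rule summableI_nonneg_bounded[OF _ ab_part]) (use r in auto)
  qed
  have s2: "sqrt (area_functional r h / pi) \<le> d * (4 * (r * sqrt (r ^ 4 + 4 * r\<^sup>2 + 1) / (1 - r\<^sup>2)\<^sup>2))"
  proof -
    have "(\<lambda>n. pi * (real n * (norm (a n))\<^sup>2 * r ^ (2 * n))) sums area_functional r h"
      using area_functional_series[OF H r(1) r1] by (simp only: Ha)
    then have "(\<lambda>n. pi * (real n * (norm (a n))\<^sup>2 * r ^ (2 * n)) / pi) sums (area_functional r h / pi)"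
      by (rule sums_divide)
    then have "(\<lambda>n. real n * (norm (a n))\<^sup>2 * r ^ (2 * n)) sums (area_functional r h / pi)" by simp
    then have ar: "(\<lambda>n. real (Suc n) * (norm (a (Suc n)))\<^sup>2 * r ^ (2 * Suc n)) sums (area_functional r h / pi)"
      using sums_Suc_iff[of "\<lambda>n. real n * (norm (a n))\<^sup>2 * r ^ (2 * n)" "area_functional r h / pi"] by simp
    have "r\<^sup>2 \<le> (1/3)\<^sup>2" using r r3 by (intro power_mono) auto
    then have r2: "r\<^sup>2 \<le> 1/2" by (simp add: power2_eq_square)
    have "area_functional r h / pi \<le> 16 * d\<^sup>2 * (r\<^sup>2 * (1 + 4 * r\<^sup>2 + (r\<^sup>2)\<^sup>2) / (1 - r\<^sup>2) ^ 4)"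
      unfolding sums_unique[OF ar]
    proof (rule suminf_le_const[OF sums_summable[OF ar]])
      fix N
      have "(\<Sum>n<N. real (Suc n) * (norm (a (Suc n)))\<^sup>2 * r ^ (2 * Suc n)) =
        (\<Sum>n<N. real (Suc n) * (norm (fps_nth (fps_compose \<Phi> W) (Suc n)))\<^sup>2 * (r\<^sup>2) ^ Suc n)"
        unfolding H_def[symmetric] Ha power_mult ..
      also have "\<dots> \<le> (\<Sum>n<N. real (Suc n) * (norm (fps_nth \<Phi> (Suc n)))\<^sup>2 * (r\<^sup>2) ^ Suc n)"
        by (rule subordinate_area_partial_sum[OF schwarz_function_axioms r(1) r2])
      also have "\<dots> \<le> 16 * d\<^sup>2 * (r\<^sup>2 * (1 + 4 * r\<^sup>2 + (r\<^sup>2)\<^sup>2) / (1 - r\<^sup>2) ^ 4)" by (rule est(2))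
      finally show "(\<Sum>n<N. real (Suc n) * (norm (a (Suc n)))\<^sup>2 * r ^ (2 * Suc n)) \<le> 16 * d\<^sup>2 * (r\<^sup>2 * (1 + 4 * r\<^sup>2 + (r\<^sup>2)\<^sup>2) / (1 - r\<^sup>2) ^ 4)" .
    qed
    also have "\<dots> = (d * (4 * (r * sqrt (r ^ 4 + 4 * r\<^sup>2 + 1) / (1 - r\<^sup>2)\<^sup>2)))\<^sup>2"
    proof -
      have "(sqrt (r ^ 4 + 4 * r\<^sup>2 + 1))\<^sup>2 = 1 + 4 * r\<^sup>2 + (r\<^sup>2)\<^sup>2" using r by simp
      moreover have "((1 - r\<^sup>2)\<^sup>2)\<^sup>2 = (1 - r\<^sup>2) ^ 4" by simp
      ultimately show ?thesis by (simp only: power_mult_distrib power_divide) simp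
    qed
    finally have "sqrt (area_functional r h / pi) \<le> sqrt ((d * (4 * (r * sqrt (r ^ 4 + 4 * r\<^sup>2 + 1) / (1 - r\<^sup>2)\<^sup>2)))\<^sup>2)"
      by (rule real_sqrt_le_mono)
    also have "\<dots> = d * (4 * (r * sqrt (r ^ 4 + 4 * r\<^sup>2 + 1) / (1 - r\<^sup>2)\<^sup>2))"
      using est(3) r by (subst real_sqrt_abs) simp
    finally show ?thesis .
  qed
  have "(\<Sum>n. (norm (a (Suc n)) + norm (b (Suc n))) * r ^ Suc n) + \<mu> * sqrt (area_functional r h / pi) \<le>
     d * (8 * K / (K + 1) * (r / (1 - r)\<^sup>2)) + \<mu> * (d * (4 * (r * sqrt (r ^ 4 + 4 * r\<^sup>2 + 1) / (1 - r\<^sup>2)\<^sup>2)))"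
    using s1 s2 \<mu> by (intro add_mono mult_left_mono) auto
  also have "\<dots> = d * ((8 * K / (K + 1)) * (r / (1 - r)\<^sup>2) + 4 * \<mu> * (r * sqrt (r ^ 4 + 4 * r\<^sup>2 + 1) / (1 - r\<^sup>2)\<^sup>2))"
    by (simp only: distrib_left mult_ac)
  also have "\<dots> = d * (1 - radius_fun K \<mu> r / (1 - r\<^sup>2)\<^sup>2)" by (simp only: radius_fun_factor[OF r(1) r1])
  also have "\<dots> \<le> d * 1" using est(3) F by (intro mult_left_mono) auto
  finally show ?thesis by (simp add: bohr_ineq_def d_def)
qed

section \<open>Sharpness\<close>

definition koebe :: "complex \<Rightarrow> complex" where
  "koebe z = z / (1 - z)\<^sup>2"

lemma koebe_has_field_derivative:
  assumes "z \<in> unit_disc"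
  shows "(koebe has_field_derivative (1 + z) / (1 - z) ^ 3) (at z)"
proof -
  have nz: "1 - z \<noteq> 0" using assms by auto
  have "((\<lambda>z. (1 - z)\<^sup>2) has_field_derivative 2 * (1 - z) * (0 - 1)) (at z)"
    by (auto intro!: derivative_eq_intros)
  from DERIV_divide[OF DERIV_ident this]
  have "(koebe has_field_derivative (1 * (1 - z)\<^sup>2 - z * (2 * (1 - z) * (0 - 1))) / ((1 - z)\<^sup>2 * (1 - z)\<^sup>2)) (at z)"
    unfolding koebe_def using nz by simp
  also have "(1 * (1 - z)\<^sup>2 - z * (2 * (1 - z) * (0 - 1))) / ((1 - z)\<^sup>2 * (1 - z)\<^sup>2) = (1 + z) / (1 - z) ^ 3"
  proof -
    have "(1 * (1 - z)\<^sup>2 - z * (2 * (1 - z) * (0 - 1))) = (1 + z) * (1 - z)" by algebra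
    then show ?thesis using nz by (simp add: power2_eq_square power3_eq_cube)
  qed
  finally show ?thesis .
qed

lemma koebe_holomorphic: "koebe holomorphic_on unit_disc"
  unfolding holomorphic_on_open[OF open_ball] using koebe_has_field_derivative by blast

lemma koebe_deriv_nonzero: "z \<in> unit_disc \<Longrightarrow> deriv koebe z \<noteq> 0"
proof -
  assume z: "z \<in> unit_disc"
  then have "1 + z \<noteq> 0" "1 - z \<noteq> 0" by (auto simp: add_eq_0_iff)
  then show "deriv koebe z \<noteq> 0" using DERIV_imp_deriv[OF koebe_has_field_derivative[OF z]] by simp
qed

lemma koebe_inj: "inj_on koebe unit_disc"
proof (rule inj_onI)
  fix u v assume uv: "u \<in> unit_disc" "v \<in> unit_disc" "koebe u = koebe v"
  have nz: "1 - u \<noteq> 0" "1 - v \<noteq> 0" using uv by auto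
  have "u * (1 - v)\<^sup>2 = v * (1 - u)\<^sup>2" using uv(3) nz by (simp add: koebe_def frac_eq_eq)
  then have "(u - v) * (1 - u * v) = 0" by algebra
  moreover have "norm (u * v) < 1" using uv mult_strict_mono'[of "norm u" 1 "norm v" 1] by (simp add: norm_mult)
  then have "1 - u * v \<noteq> 0" by auto
  ultimately show "u = v" by simp
qed

lemma koebe_sums: "z \<in> unit_disc \<Longrightarrow> (\<lambda>n. of_nat n * z ^ n) sums koebe z"
proof -
  assume "z \<in> unit_disc"
  then have "(\<lambda>n. of_nat (Suc n) * z ^ n) sums (1 / (1 - z)\<^sup>2)" using geometric_deriv_sums[of z] by simp
  from sums_mult[OF this, of z] have "(\<lambda>n. of_nat (Suc n) * z ^ Suc n) sums koebe z"
    by (simp add: mult_ac koebe_def)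
  then show ?thesis using sums_Suc_iff[of "\<lambda>n. of_nat n * z ^ n" "koebe z"] by simp
qed

text \<open>-1/4 is a boundary point: the equation koebe z = -1/4 reduces to (1 + z)^2 = 0, and -1
  is a limit of points of the disc. For a counterexample only an upper bound on the distance
  matters.\<close>

lemma koebe_infdist: "infdist (koebe 0) (frontier (koebe ` unit_disc)) \<le> 1/4"
proof -
  have "- (1/4) \<notin> koebe ` unit_disc"
  proof
    assume "- (1/4) \<in> koebe ` unit_disc"
    then obtain z where z: "z \<in> unit_disc" "- (1/4) = koebe z" by blast
    then have "1 - z \<noteq> 0" by auto
    then have "- ((1 - z)\<^sup>2) = 4 * z" using z(2) by (simp add: koebe_def field_simps)
    then have "(1 + z)\<^sup>2 = 0" by algebra
    then have "z = - 1" by (simp add: add_eq_0_iff)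
    then show False using z(1) by simp
  qed
  moreover have "- (1/4) \<in> closure (koebe ` unit_disc)"
  proof -
    define z where "z n = - 1 + complex_of_real (1 / real (Suc n))" for n
    have "z n \<in> unit_disc" for n
    proof -
      have "z n = of_real (- 1 + 1 / real (Suc n))" by (simp add: z_def)
      then have "norm (z n) = \<bar>- 1 + 1 / real (Suc n)\<bar>" by (simp only: norm_of_real)
      also have "\<dots> < 1" by (auto simp: abs_less_iff field_simps)
      finally show ?thesis by simp
    qed
    moreover have "(\<lambda>n. koebe (z n)) \<longlonglongrightarrow> koebe (- 1)"
    proof -
      have "(\<lambda>n. inverse (real (Suc n))) \<longlonglongrightarrow> 0" by (rule LIMSEQ_inverse_real_of_nat)
      then have "(\<lambda>n. complex_of_real (1 / real (Suc n))) \<longlonglongrightarrow> of_real 0"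
        unfolding inverse_eq_divide by (rule tendsto_of_real)
      then have "z \<longlonglongrightarrow> - 1 + of_real 0" unfolding z_def by (rule tendsto_add[OF tendsto_const])
      then show ?thesis unfolding koebe_def by (intro tendsto_intros) auto
    qed
    ultimately have "koebe (- 1) \<in> closure (koebe ` unit_disc)"
      unfolding closure_sequential by (intro exI[of _ "\<lambda>n. koebe (z n)"]) auto
    then show ?thesis by (simp add: koebe_def power2_eq_square)
  qed
  ultimately have "- (1/4) \<in> frontier (koebe ` unit_disc)"
    unfolding frontier_def using interior_subset by blast
  then have "infdist (koebe 0) (frontier (koebe ` unit_disc)) \<le> dist (koebe 0) (- (1/4))" by (rule infdist_le)
  then show ?thesis by (simp add: koebe_def)
qed

text \<open>The dilatation is constant with the largest permitted modulus, and the subordination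
  holds with w = id.\<close>

lemma koebe_admissible:
  assumes K: "K \<ge> 1"
  defines "k \<equiv> complex_of_real ((K - 1) / (K + 1))"
  shows "admissible K (\<lambda>z. koebe z + cnj (k * koebe z)) koebe (\<lambda>z. k * koebe z) of_nat (\<lambda>n. k * of_nat n) koebe"
proof -
  have dk: "deriv (\<lambda>z. k * koebe z) z = k * deriv koebe z" if "z \<in> unit_disc" for z
    using koebe_holomorphic that by (intro deriv_cmult) (auto simp: holomorphic_on_open field_differentiable_def intro: koebe_has_field_derivative)
  have nk: "norm k = (K - 1) / (K + 1)" unfolding k_def norm_of_real using K by simp
  have dil: "norm (dilatation koebe (\<lambda>z. k * koebe z) z) = (K - 1) / (K + 1)" if "z \<in> unit_disc" for z
    using koebe_deriv_nonzero[OF that] nk by (simp add: dilatation_def dk[OF that])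
  have lt: "(K - 1) / (K + 1) < 1" using K by simp
  have "quasiconformal K koebe (\<lambda>z. k * koebe z)"
    unfolding quasiconformal_def sense_preserving_locally_univalent_def
    using dil lt koebe_deriv_nonzero by auto
  moreover have "harmonic_mapping (\<lambda>z. koebe z + cnj (k * koebe z)) koebe (\<lambda>z. k * koebe z)"
    unfolding harmonic_mapping_def using koebe_holomorphic by (auto intro!: holomorphic_intros)
  moreover have "(\<lambda>n. k * of_nat (Suc n) * z ^ Suc n) sums (k * koebe z)" if "z \<in> unit_disc" for z
  proof -
    have "(\<lambda>n. of_nat (Suc n) * z ^ Suc n) sums koebe z"
      using koebe_sums[OF that] sums_Suc_iff[of "\<lambda>n. of_nat n * z ^ n" "koebe z"] by simp
    from sums_mult[OF this, of k] show ?thesis by (simp only: mult.assoc)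
  qed
  moreover have "subordinate koebe koebe"
    unfolding subordinate_def by (intro exI[of _ "\<lambda>z. z"]) (auto intro: holomorphic_intros)
  ultimately show ?thesis
    unfolding admissible_def using koebe_sums koebe_holomorphic koebe_inj by blast
qed

text \<open>The coefficients n and k n make both terms of the Bohr sum explicit; by
  \<open>radius_fun_factor\<close> their total exceeds 1/4 as soon as \<open>radius_fun\<close> is
  negative.\<close>

lemma koebe_bohr_fails:
  assumes K: "K \<ge> 1" and \<mu>: "\<mu> \<ge> 0" and r: "0 \<le> r" "r < 1" and F: "radius_fun K \<mu> r < 0"
  defines "k \<equiv> complex_of_real ((K - 1) / (K + 1))"
  shows "\<not> bohr_ineq \<mu> koebe of_nat (\<lambda>n. k * of_nat n) koebe r"
proof -
  have nk: "norm k = (K - 1) / (K + 1)" unfolding k_def norm_of_real using K by simp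
  have "(\<lambda>n. (1 + (K - 1) / (K + 1)) * (real (Suc n) * r ^ Suc n)) sums ((1 + (K - 1) / (K + 1)) * (r / (1 - r)\<^sup>2))"
    using r by (intro sums_mult sums_koebe) auto
  moreover have "(1 + (K - 1) / (K + 1)) * (real (Suc n) * r ^ Suc n) = (norm (of_nat (Suc n) :: complex) + norm (k * of_nat (Suc n))) * r ^ Suc n" for n
  proof -
    have "(1 + q) * (c * X) = (c + q * c) * X" for q c X :: real by algebra
    then show ?thesis unfolding norm_mult norm_of_nat nk .
  qed
  ultimately have "(\<lambda>n. (norm (of_nat (Suc n) :: complex) + norm (k * of_nat (Suc n))) * r ^ Suc n) sums ((1 + (K - 1) / (K + 1)) * (r / (1 - r)\<^sup>2))"
    by (simp only:)
  moreover have "1 + (K - 1) / (K + 1) = 2 * K / (K + 1)" using K by (simp add: field_simps)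
  ultimately have s1: "(\<Sum>n. (norm (of_nat (Suc n) :: complex) + norm (k * of_nat (Suc n))) * r ^ Suc n) = 2 * K / (K + 1) * (r / (1 - r)\<^sup>2)"
    by (simp add: sums_iff)
  have H: "disc_expansion koebe (Abs_fps of_nat)" by (rule disc_expansionI) (use koebe_sums in simp)
  have r2: "r\<^sup>2 < 1" using r by (simp add: abs_square_less_1)
  have "(\<lambda>n. pi * (real n ^ 3 * (r\<^sup>2) ^ n)) sums area_functional koebe_r koebe" if "koebe_r = r" for koebe_r
  proof -
    have "real n * (norm (fps_nth (Abs_fps of_nat :: complex fps) n))\<^sup>2 * r ^ (2 * n) = real n ^ 3 * (r\<^sup>2) ^ n" for n
      by (simp add: power_mult power2_eq_square power3_eq_cube)
    then show ?thesis using area_functional_series[OF H r] that by (simp only:)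
  qed
  then have "(\<lambda>n. pi * (real n ^ 3 * (r\<^sup>2) ^ n)) sums area_functional r koebe" by simp
  then have "(\<lambda>n. pi * (real (Suc n) ^ 3 * (r\<^sup>2) ^ Suc n)) sums area_functional r koebe"
    using sums_Suc_iff[of "\<lambda>n. pi * (real n ^ 3 * (r\<^sup>2) ^ n)" "area_functional r koebe"] by simp
  moreover have "(\<lambda>n. pi * (real (Suc n) ^ 3 * (r\<^sup>2) ^ Suc n)) sums (pi * (r\<^sup>2 * (1 + 4 * r\<^sup>2 + (r\<^sup>2)\<^sup>2) / (1 - r\<^sup>2) ^ 4))"
    using r2 by (intro sums_mult sums_cubes) auto
  ultimately have "area_functional r koebe = pi * (r\<^sup>2 * (1 + 4 * r\<^sup>2 + (r\<^sup>2)\<^sup>2) / (1 - r\<^sup>2) ^ 4)"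
    by (rule sums_unique2)
  then have "area_functional r koebe / pi = r\<^sup>2 * (1 + 4 * r\<^sup>2 + (r\<^sup>2)\<^sup>2) / (1 - r\<^sup>2) ^ 4" by simp
  also have "\<dots> = (r * sqrt (r ^ 4 + 4 * r\<^sup>2 + 1) / (1 - r\<^sup>2)\<^sup>2)\<^sup>2"
  proof -
    have "(sqrt (r ^ 4 + 4 * r\<^sup>2 + 1))\<^sup>2 = 1 + 4 * r\<^sup>2 + (r\<^sup>2)\<^sup>2" using r by simp
    moreover have "((1 - r\<^sup>2)\<^sup>2)\<^sup>2 = (1 - r\<^sup>2) ^ 4" by simp
    ultimately show ?thesis by (simp only: power_mult_distrib power_divide)
  qed
  finally have "sqrt (area_functional r koebe / pi) = \<bar>r * sqrt (r ^ 4 + 4 * r\<^sup>2 + 1) / (1 - r\<^sup>2)\<^sup>2\<bar>"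
    by (simp only: real_sqrt_abs)
  also have "\<dots> = r * sqrt (r ^ 4 + 4 * r\<^sup>2 + 1) / (1 - r\<^sup>2)\<^sup>2" using r by simp
  finally have s2: "sqrt (area_functional r koebe / pi) = r * sqrt (r ^ 4 + 4 * r\<^sup>2 + 1) / (1 - r\<^sup>2)\<^sup>2" .
  have "radius_fun K \<mu> r / (1 - r\<^sup>2)\<^sup>2 < 0" using F r2 by (simp add: divide_less_0_iff)
  then have "1 < (8 * K / (K + 1)) * (r / (1 - r)\<^sup>2) + 4 * \<mu> * (r * sqrt (r ^ 4 + 4 * r\<^sup>2 + 1) / (1 - r\<^sup>2)\<^sup>2)"
    unfolding radius_fun_factor[OF r] by linarith
  also have "\<dots> = 4 * (2 * K / (K + 1) * (r / (1 - r)\<^sup>2) + \<mu> * (r * sqrt (r ^ 4 + 4 * r\<^sup>2 + 1) / (1 - r\<^sup>2)\<^sup>2))"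
    by simp
  finally have "1 < 4 * (2 * K / (K + 1) * (r / (1 - r)\<^sup>2) + \<mu> * (r * sqrt (r ^ 4 + 4 * r\<^sup>2 + 1) / (1 - r\<^sup>2)\<^sup>2))" .
  moreover have "1/4 < v" if "1 < 4 * v" for v :: real using that by simp
  ultimately have "1/4 < 2 * K / (K + 1) * (r / (1 - r)\<^sup>2) + \<mu> * (r * sqrt (r ^ 4 + 4 * r\<^sup>2 + 1) / (1 - r\<^sup>2)\<^sup>2)"
    by blast
  then show ?thesis
    unfolding bohr_ineq_def s1 s2 using koebe_infdist by linarith
qed

theorem theorem4p1:
  fixes K \<mu> :: real
  assumes "K \<ge> 1" and "\<mu> \<ge> 0"
  shows "(\<exists>!r0. r0 \<in> {0<..<1/3} \<and> radius_eqn K \<mu> r0) \<and>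
    (\<forall>r0. r0 \<in> {0<..<1/3} \<and> radius_eqn K \<mu> r0 \<longrightarrow>
       (\<forall>f h g a b \<phi>. admissible K f h g a b \<phi> \<longrightarrow>
          (\<forall>r. 0 \<le> r \<and> r \<le> r0 \<longrightarrow> bohr_ineq \<mu> h a b \<phi> r)) \<and>
       (\<forall>R>r0. \<not> (\<forall>f h g a b \<phi>. admissible K f h g a b \<phi> \<longrightarrow>
          (\<forall>r. 0 \<le> r \<and> r < 1 \<and> r \<le> R \<longrightarrow> bohr_ineq \<mu> h a b \<phi> r))))"
proof -
  have eqn: "radius_eqn K \<mu> r \<longleftrightarrow> radius_fun K \<mu> r = 0" for r
    by (simp only: radius_eqn_def radius_fun_def)
  show ?thesis
    unfolding eqn
  proof (intro conjI allI impI)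
    show "\<exists>!r0. r0 \<in> {0<..<1/3} \<and> radius_fun K \<mu> r0 = 0" by (rule radius_fun_root_unique[OF assms])
  next
    fix r0 f h g a b \<phi> r
    assume r0: "r0 \<in> {0<..<1/3} \<and> radius_fun K \<mu> r0 = 0" and adm: "admissible K f h g a b \<phi>"
      and r: "0 \<le> r \<and> r \<le> r0"
    have le: "r0 \<le> 1716 / 10000" using r0 by (intro radius_root_le[OF assms]) auto
    have "0 \<le> radius_fun K \<mu> r"
      using radius_fun_strict_decreasing[OF assms, of r r0] r r0 by (cases "r = r0") auto
    then show "bohr_ineq \<mu> h a b \<phi> r" using r le by (intro bohr_inequality[OF adm assms]) auto
  next
    fix r0 R
    assume r0: "r0 \<in> {0<..<1/3} \<and> radius_fun K \<mu> r0 = 0" and R: "r0 < R"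
    \<comment> \<open>\<open>R\<close> may exceed 1, where the series have no meaning; capping at
      1/2 keeps r < 1 and still above \<open>r0\<close> < 1/3.\<close>
    define r where "r = min R (1/2)"
    have r: "r0 < r" "0 \<le> r" "r < 1" "r \<le> R" using r0 R by (auto simp: r_def)
    have "radius_fun K \<mu> r < 0"
      using radius_fun_strict_decreasing[OF assms, of r0 r] r r0 by auto
    then have "\<not> bohr_ineq \<mu> koebe of_nat (\<lambda>n. complex_of_real ((K - 1) / (K + 1)) * of_nat n) koebe r"
      by (rule koebe_bohr_fails[OF assms r(2,3)])
    with koebe_admissible[OF assms(1)] r
    show "\<not> (\<forall>f h g a b \<phi>. admissible K f h g a b \<phi> \<longrightarrow> (\<forall>r. 0 \<le> r \<and> r < 1 \<and> r \<le> R \<longrightarrow> bohr_ineq \<mu> h a b \<phi> r))"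
      by blast
  qed
qed

end
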